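(* Let $(E,\nabla)$ be an irreducible algebraic connection on a Zariski open subset of the affine line, which is not a rank $1$ connection with only a singularity at infinity of order less than two, and let $I=\langle q\rangle_a$ and $I'=\langle q'\rangle_{a'}$ be active circles of its modified formal data (possibly equal). Let $\beta=\mathrm{ram}(q)$, $\alpha=\mathrm{Irr}(q)$, $\beta'=\mathrm{ram}(q')$, $\alpha'=\mathrm{Irr}(q')$. Then the number of edges $B_{I,I'}$ between the vertices of the diagram $\Gamma(E,\nabla)$ associated to $I$ and $I'$ (number of oriented loops if $I=I'$) is the following: 1. if $a=a'=\infty$ then $B_{I,I'}=B^\infty_{I,I'}$; 2. if $a=\infty$ and $a'\neq\infty$ then $B_{I,I'}=\beta(\alpha'+\beta')$; 3. if $a\neq\infty$, $a'\neq\infty$ and $a\ne a'$ then $B_{I,I'}=0$; 4. if $a=a'\ne\infty$ then $B_{I,I'}=B^\infty_{I,I'}-\alpha\beta'-\alpha'\beta$.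
   Context: **Circles.** For $a\in\mathbb P^1$ put $z_a=z-a$ if $a\in\mathbb C$ and $z_\infty=1/z$. An exponential factor at $a$ is a polynomial $q$ without constant term in $z_a^{-1/r}$; with $r\geq1$ minimal, $\mathrm{ram}(q)=r$, $\mathrm{Irr}(q)$ is its degree in $z_a^{-1/r}$, and $\mathrm{slope}(q)=\mathrm{Irr}(q)/\mathrm{ram}(q)$ (slope of $0$ is $0$). Its Galois conjugates are obtained by $z_a^{1/r}\mapsto\omega z_a^{1/r}$, $\omega^r=1$; the circle $\langle q\rangle_a$ is its Galois orbit, seen as a connected $r$-fold cover of the circle $\partial_a$ of real directions at $a$; $\langle0\rangle_a$ is the tame circle. $\mathcal I_a\to\partial_a$ is the disjoint union of all circles at $a$. **The numbers $B^\infty$.** For two circles $I=\langle q\rangle_a$, $I'=\langle q'\rangle_a$ at the same point $a$, let $A_{I,I'}=\mathrm{Irr}(\mathrm{Hom}(I,I'))=\sum\mathrm{slope}(q_k-q'_l)$, sum over all pairs of Galois conjugates $q_k$ of $q$, $q'_l$ of $q'$. Put $B^\infty_{I,I'}=A_{I,I'}-\mathrm{ram}(q)\mathrm{ram}(q')$ if $I\ne I'$, and $B^\infty_{I,I}=A_{I,I}-\mathrm{ram}(q)^2+1$. (This depends only on the exponents and coefficients of $q$, $q'$ in the local coordinate, not on the point $a$.) **(Modified) formal data.** By the Turrittin–Levelt theorem, the formalization of $(E,\nabla)$ at $a$ is equivalent to an $\mathcal I_a$-graded local system on $\partial_a$, whose circles with nonzero part are those with a factor $e^{q}$ occurring in the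 formal horizontal sections. The part graded by $\langle q\rangle_a$ is a local system on $\langle q\rangle_a$ of some rank (multiplicity), with a monodromy conjugacy class. The modified formal data $(\breve\Theta,\breve{\mathcal C})$ are obtained by keeping multiplicities and classes of all circles at infinity and all irregular circles at finite distance, and replacing, for each tame circle $\langle0\rangle_a$ with $a\neq\infty$ and monodromy $T$, the multiplicity by $\mathrm{rank}(T-\mathrm{Id})$ and the class by that of $T|_{\mathrm{Im}(T-\mathrm{Id})}$. Active circles are those with nonzero multiplicity. **The diagram.** There is an open dense set of $A\in\mathrm{SL}_2(\mathbb C)$ sending all active circles of $\breve\Theta$ to circles at infinity. Choosing any $A$ such that all active circles are sent to infinity, the core diagram of $\Gamma(E,\nabla)$ has as vertices the active circles $I$ of $\breve\Theta$ (identified with the circles $A\cdot I$ at infinity), and by definition $B_{I,I'}:=B^\infty_{A\cdot I,\,A\cdot I'}$; this does not depend on $A$. **Action of $\mathrm{SL}_2(\mathbb C)$ on circles.** It is generated by elementary transformations: - Twist $T_\mu=\begin{pmatrix}1&\mu\\0&1\end{pmatrix}$: $\langle q\rangle_\infty\mapsto\langle q-\tfrac{\mu}{2}z^2\rangle_\infty$; circles at finite points are fixed. - Scaling $S_\mu=\begin{pmatrix}\mu^{-1}&0\\0&\mu\end{pmatrix}$, $\mu\ne 0$: the circle obtained from the change of variable $q(z)\mapsto q(z/\mu)$ (so a circle at $a$ goes to one at $\mu a$). - Fourier transform $F=\begin{pmatrix}0&1\\-1&0\end{pmatrix}$ (Legendre transform, with dual variable $\xi$ then renamed $z$): a circle $\langle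 q\rangle_\infty$ of slope $>1$, or $\langle q\rangle_a$ with $a\in\mathbb C$, $q\neq0$, goes to $\langle\tilde q\rangle_\infty$ where $\tilde q(\xi)=q(z)-\xi z$ with $z=z(\xi)$ determined by $dq/dz=\xi$ (keeping only positive powers of $\xi$); $\langle0\rangle_a\mapsto\langle-a\xi\rangle_\infty$; $\langle\alpha z\rangle_\infty\mapsto\langle0\rangle_\alpha$; and $\langle\alpha z+q\rangle_\infty$ with $0<\mathrm{slope}(q)<1$ goes to the circle $\langle\tilde q\rangle_\alpha$ at $\xi=\alpha$ given by the polar part of $\alpha z+q(z)-\xi z$ with $\xi=\alpha+dq/dz$. For general $A$, $A\cdot\langle q\rangle$ is obtained by factoring $A$ into elementary transformations (the result does not depend on the factorization). *)

theory Defs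
  imports
    "HOL-Complex_Analysis.Complex_Analysis"
    "HOL-Library.Poly_Mapping"
    "HOL-Library.Function_Algebras"
begin

section \<open>Exponential factors and circles\<close>

datatype point = Infinity | Finite complex

text \<open>
  The factor \<open>\<Sum>k. c k * z_a powr (-k)\<close> at a point \<open>a\<close> is stored as the finitely supported map
  \<open>k \<mapsto> c k\<close> on the rationals: the key \<open>k\<close> is the exponent of \<open>1 / z_a\<close>, where \<open>z_a = z - a\<close> at a
  finite point and \<open>z_a = 1 / z\<close> at infinity. So at infinity \<open>c k\<close> is the coefficient of \<open>z powr k\<close>.
\<close>

type_synonym ef = "rat \<Rightarrow>\<^sub>0 complex"

definition exp_factor :: "ef \<Rightarrow> bool" where
  "exp_factor q \<longleftrightarrow> (\<forall>k \<in> Poly_Mapping.keys q. 0 < k)"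

definition ram :: "ef \<Rightarrow> nat" where
  "ram q = (LEAST r. 0 < r \<and> (\<forall>k \<in> Poly_Mapping.keys q. of_nat r * k \<in> \<int>))"

definition slope :: "ef \<Rightarrow> rat" where
  "slope q = (if q = 0 then 0 else Max (Poly_Mapping.keys q))"

definition Irr :: "ef \<Rightarrow> nat" where
  "Irr q = nat \<lfloor>of_nat (ram q) * slope q\<rfloor>"

definition rescale :: "(rat \<Rightarrow> complex) \<Rightarrow> ef \<Rightarrow> ef" where
  "rescale g q = (\<Sum>k \<in> Poly_Mapping.keys q. Poly_Mapping.single k (g k * Poly_Mapping.lookup q k))"

text \<open>The substitution \<open>z_a powr (1/r) \<mapsto> \<omega> * z_a powr (1/r)\<close> multiplies the coefficient of
  \<open>z_a powr (-k)\<close>, which is the power of exponent \<open>- r * k\<close> of \<open>z_a powr (1/r)\<close>, by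
  \<open>\<omega> powi (- r * k)\<close>.\<close>

definition galois_orbit :: "ef \<Rightarrow> ef set" where
  "galois_orbit q =
     {rescale (\<lambda>k. \<omega> powi (- \<lfloor>of_nat (ram q) * k\<rfloor>)) q |\<omega>. \<omega> ^ ram q = 1}"

type_synonym circ = "point \<times> ef set"

definition circle :: "point \<Rightarrow> ef \<Rightarrow> circ" where
  "circle a q = (a, galois_orbit q)"

abbreviation base_point :: "circ \<Rightarrow> point" where
  "base_point \<equiv> fst"

section \<open>The numbers \<open>B\<^sup>\<infinity>\<close>\<close>

definition irr_Hom :: "circ \<Rightarrow> circ \<Rightarrow> rat" where
  "irr_Hom I I' = (\<Sum>q \<in> snd I. \<Sum>q' \<in> snd I'. slope (q - q'))"

text \<open>All Galois conjugates have the same ramification.\<close>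

definition circ_ram :: "circ \<Rightarrow> nat" where
  "circ_ram I = the_elem (ram ` snd I)"

definition B_inf :: "circ \<Rightarrow> circ \<Rightarrow> rat" where
  "B_inf I I' =
     (if I = I' then irr_Hom I I - of_nat (circ_ram I ^ 2) + 1
      else irr_Hom I I' - of_nat (circ_ram I * circ_ram I'))"

section \<open>Action of \<open>SL\<^sub>2\<close> on circles\<close>

definition twist :: "complex \<Rightarrow> circ \<Rightarrow> circ" where
  "twist \<mu> I = (case I of
     (Infinity, Q) \<Rightarrow> (Infinity, (\<lambda>q. q - Poly_Mapping.single 2 (\<mu> / 2)) ` Q)
   | (Finite a, Q) \<Rightarrow> (Finite a, Q))"

text \<open>In \<open>q (z / \<mu>)\<close> one has \<open>(z / \<mu>) powr k = \<mu> powr (-k) * z powr k\<close> at infinity and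
  \<open>(z / \<mu> - a) powr (-k) = \<mu> powr k * (z - \<mu> * a) powr (-k)\<close> at a finite point; another branch of
  the powers of \<open>\<mu>\<close> permutes the Galois conjugates.\<close>

definition scaling :: "complex \<Rightarrow> circ \<Rightarrow> circ" where
  "scaling \<mu> I = (case I of
     (Infinity, Q) \<Rightarrow> (Infinity, rescale (\<lambda>k. \<mu> powr (- of_rat k)) ` Q)
   | (Finite a, Q) \<Rightarrow> (Finite (\<mu> * a), rescale (\<lambda>k. \<mu> powr (of_rat k)) ` Q))"

text \<open>
  Legendre transforms are computed in local uniformizers. Upstairs, \<open>z_a = t ^ r\<close> with \<open>r = ram q\<close>;
  on the dual side, \<open>\<xi>_b = u ^ s\<close> with \<open>\<xi>_b\<close> the local coordinate at the target \<open>b\<close> and \<open>s > 0\<close> the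
  order of \<open>\<xi>_b\<close> in \<open>t\<close>. Solving \<open>dq/dz = \<xi>\<close> for \<open>z\<close> means finding \<open>t = T (u)\<close>, a formal series
  with a simple zero at \<open>u = 0\<close>; it is unique up to multiplying \<open>u\<close> by an \<open>s\<close>-th root of unity, i.e.
  up to replacing the transform by a Galois conjugate.
\<close>

text \<open>\<open>z_a powr e\<close> for \<open>z_a = T ^ r\<close> and a rational \<open>e\<close> with \<open>r * e\<close> an integer\<close>

definition loc_powr :: "nat \<Rightarrow> complex fls \<Rightarrow> rat \<Rightarrow> complex fls" where
  "loc_powr r T e = T powi \<lfloor>of_nat r * e\<rfloor>"

definition ef_subst :: "ef \<Rightarrow> complex fls \<Rightarrow> complex fls" where
  "ef_subst q T =
     (\<Sum>k \<in> Poly_Mapping.keys q. fls_const (Poly_Mapping.lookup q k) * loc_powr (ram q) T (- k))"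

text \<open>\<open>dq/dz\<close> at a finite point and at infinity, where \<open>q\<close> is a sum of terms \<open>c * (z - a) powr (-k)\<close>
  and \<open>c * z powr k = c * (1/z) powr (-k)\<close> respectively\<close>

definition ef_deriv_fin :: "ef \<Rightarrow> complex fls \<Rightarrow> complex fls" where
  "ef_deriv_fin q T =
     (\<Sum>k \<in> Poly_Mapping.keys q.
        fls_const (- of_rat k * Poly_Mapping.lookup q k) * loc_powr (ram q) T (- k - 1))"

definition ef_deriv_inf :: "ef \<Rightarrow> complex fls \<Rightarrow> complex fls" where
  "ef_deriv_inf q T =
     (\<Sum>k \<in> Poly_Mapping.keys q.
        fls_const (of_rat k * Poly_Mapping.lookup q k) * loc_powr (ram q) T (1 - k))"

text \<open>The part of \<open>L (u)\<close> with negative powers of \<open>u\<close>, as an exponential factor in \<open>\<xi>_b = u ^ s\<close>\<close>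

definition polar_ef :: "nat \<Rightarrow> complex fls \<Rightarrow> ef" where
  "polar_ef s L =
     (\<Sum>m = 1..nat (- fls_subdegree L).
        Poly_Mapping.single (of_nat m / of_nat s) (fls_nth L (- int m)))"

inductive legendre :: "point \<Rightarrow> ef \<Rightarrow> point \<Rightarrow> ef \<Rightarrow> bool" where
  inf_slope_gt_1:
    "\<lbrakk>exp_factor q; slope q > 1; s = Irr q - ram q; fls_subdegree T = 1;
      ef_deriv_inf q T = fls_X powi (- int s)\<rbrakk>
     \<Longrightarrow> legendre Infinity q
           Infinity (polar_ef s (ef_subst q T - fls_X powi (- int s) * T powi (- int (ram q))))"
| fin_irregular:
    "\<lbrakk>exp_factor q; q \<noteq> 0; s = Irr q + ram q; fls_subdegree T = 1;
      ef_deriv_fin q T = fls_X powi (- int s)\<rbrakk>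
     \<Longrightarrow> legendre (Finite a) q
           Infinity (polar_ef s (ef_subst q T - fls_X powi (- int s) * (fls_const a + T ^ ram q)))"
| fin_tame:
    "legendre (Finite a) 0 Infinity (Poly_Mapping.single 1 (- a))"
| inf_linear:
    "legendre Infinity (Poly_Mapping.single 1 \<alpha>) (Finite \<alpha>) 0"
| inf_slope_lt_1:
    \<comment> \<open>Here \<open>\<xi> - \<alpha> = dq/dz = u ^ s\<close> and \<open>\<alpha> * z + q - \<xi> * z = q - (\<xi> - \<alpha>) * z\<close>.\<close>
    "\<lbrakk>exp_factor q; 0 < slope q; slope q < 1; s = ram q - Irr q; fls_subdegree T = 1;
      ef_deriv_inf q T = fls_X ^ s\<rbrakk>
     \<Longrightarrow> legendre Infinity (Poly_Mapping.single 1 \<alpha> + q)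
           (Finite \<alpha>) (polar_ef s (ef_subst q T - fls_X ^ s * T powi (- int (ram q))))"

definition fourier :: "circ \<Rightarrow> circ" where
  "fourier I = (SOME J. \<exists>a q b p. I = circle a q \<and> legendre a q b p \<and> J = circle b p)"

definition twist_mat :: "complex \<Rightarrow> complex^2^2" where
  "twist_mat \<mu> = vector [vector [1, \<mu>], vector [0, 1]]"

definition scaling_mat :: "complex \<Rightarrow> complex^2^2" where
  "scaling_mat \<mu> = vector [vector [inverse \<mu>, 0], vector [0, \<mu>]]"

definition fourier_mat :: "complex^2^2" where
  "fourier_mat = vector [vector [0, 1], vector [- 1, 0]]"

text \<open>\<open>sl2_action A \<phi>\<close>: the map \<open>\<phi>\<close> on circles is the action of \<open>A\<close> computed along some
  factorization of \<open>A\<close> into elementary matrices. No particular factorization is singled out.\<close>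

inductive sl2_action :: "complex^2^2 \<Rightarrow> (circ \<Rightarrow> circ) \<Rightarrow> bool" where
  "sl2_action (mat 1) (\<lambda>I. I)"
| "sl2_action A \<phi> \<Longrightarrow> sl2_action (twist_mat \<mu> ** A) (twist \<mu> \<circ> \<phi>)"
| "sl2_action A \<phi> \<Longrightarrow> \<mu> \<noteq> 0 \<Longrightarrow> sl2_action (scaling_mat \<mu> ** A) (scaling \<mu> \<circ> \<phi>)"
| "sl2_action A \<phi> \<Longrightarrow> sl2_action (fourier_mat ** A) (fourier \<circ> \<phi>)"

section \<open>Algebraic connections\<close>

text \<open>
  \<open>U = - S\<close> for a finite set \<open>S\<close>. The ring of regular functions on \<open>U\<close> is a principal ideal domain,
  so every algebraic vector bundle on \<open>U\<close> has a global frame; in a frame, the connection is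
  \<open>\<nabla> = d - M dz\<close> with a matrix \<open>M\<close> of regular functions. Functions on \<open>U\<close> are extended by \<open>0\<close>.
\<close>

definition regular_funs :: "complex set \<Rightarrow> (complex \<Rightarrow> complex) set" where
  "regular_funs S = {f. (\<forall>z \<in> S. f z = 0) \<and>
     (\<exists>p d. \<forall>z. z \<notin> S \<longrightarrow> poly d z \<noteq> 0 \<and> f z = poly p z / poly d z)}"

definition bundle_sections :: "complex set \<Rightarrow> (complex \<Rightarrow> complex^'n) set" where
  "bundle_sections S = {v. \<forall>i. (\<lambda>z. v z $ i) \<in> regular_funs S}"

definition alg_connection :: "complex set \<Rightarrow> (complex \<Rightarrow> complex^'n^'n) \<Rightarrow> bool" where
  "alg_connection S M \<longleftrightarrow> finite S \<and> (\<forall>i j. (\<lambda>z. M z $ i $ j) \<in> regular_funs S)"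

definition nabla ::
  "complex set \<Rightarrow> (complex \<Rightarrow> complex^'n^'n) \<Rightarrow> (complex \<Rightarrow> complex^'n) \<Rightarrow> complex \<Rightarrow> complex^'n" where
  "nabla S M v = (\<lambda>z. if z \<in> S then 0 else (\<chi> i. deriv (\<lambda>w. v w $ i) z) - M z *v v z)"

text \<open>A \<open>\<nabla>\<close>-stable submodule over the regular functions is automatically a subbundle, since the
  quotient module carries a connection and is therefore torsion free.\<close>

definition subconnection ::
  "complex set \<Rightarrow> (complex \<Rightarrow> complex^'n^'n) \<Rightarrow> (complex \<Rightarrow> complex^'n) set \<Rightarrow> bool" where
  "subconnection S M N \<longleftrightarrow> N \<subseteq> bundle_sections S \<and> (\<lambda>z. 0) \<in> N \<and>
     (\<forall>v \<in> N. \<forall>w \<in> N. (\<lambda>z. v z + w z) \<in> N) \<and>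
     (\<forall>f \<in> regular_funs S. \<forall>v \<in> N. (\<lambda>z. f z *s v z) \<in> N) \<and>
     (\<forall>v \<in> N. nabla S M v \<in> N)"

definition irreducible_connection :: "complex set \<Rightarrow> (complex \<Rightarrow> complex^'n^'n) \<Rightarrow> bool" where
  "irreducible_connection S M \<longleftrightarrow>
     alg_connection S M \<and> (\<forall>N. subconnection S M N \<longrightarrow> N = {\<lambda>z. 0} \<or> N = bundle_sections S)"

section \<open>Formal data\<close>

text \<open>With \<open>x = z_a\<close>, this is the coefficient of \<open>x ^ m\<close> in the matrix \<open>N\<close> with \<open>M dz = N dx / x\<close>.
  At infinity \<open>z = 1 / x\<close> and \<open>dz = - dx / x ^ 2\<close>.\<close>

definition local_coeff :: "(complex \<Rightarrow> complex^'n^'n) \<Rightarrow> point \<Rightarrow> int \<Rightarrow> complex^'n^'n" where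
  "local_coeff M a m = (\<chi> i j. fls_nth (case a of
       Finite c \<Rightarrow> laurent_expansion (\<lambda>x. x * M (c + x) $ i $ j) 0
     | Infinity \<Rightarrow> laurent_expansion (\<lambda>x. - (M (1 / x) $ i $ j) / x) 0) m)"

text \<open>
  A function \<open>f\<close> of the type below stands for the formal vector \<open>\<Sum>s j. f s j * x powr s * (log x) ^ j\<close>,
  with complex exponents \<open>s\<close>; it is required that the exponents lie in finitely many progressions
  \<open>e + \<nat> / r\<close> and that the powers of \<open>log x\<close> are bounded.
\<close>

type_synonym 'n formal_vec = "complex \<Rightarrow> nat \<Rightarrow> complex^'n"

definition moderate :: "'n::finite formal_vec \<Rightarrow> bool" where
  "moderate f \<longleftrightarrow> (\<exists>\<Lambda> r J. finite \<Lambda> \<and> 0 < (r::nat) \<and>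
     (\<forall>s j. f s j \<noteq> 0 \<longrightarrow> j \<le> J \<and> (\<exists>e \<in> \<Lambda>. \<exists>m::nat. s = e + of_nat m / of_nat r)))"

text \<open>
  The formal vectors \<open>f\<close> for which \<open>exp q * f\<close> is horizontal at \<open>a\<close>: coefficientwise in
  \<open>x powr s * (log x) ^ j\<close>, the equation \<open>\<theta> f + (\<theta> q) * f = N f\<close> with \<open>\<theta> = x * d/dx\<close>. Here
  \<open>\<theta> (x powr s * (log x) ^ j) = s * x powr s * (log x) ^ j + j * x powr s * (log x) ^ (j - 1)\<close> and
  \<open>\<theta> q = (\<Sum>k. - k * q k * x powr (- k))\<close>. For a moderate \<open>f\<close> the sum over \<open>m\<close> is finite.
\<close>

definition horizontal ::
  "(complex \<Rightarrow> complex^'n^'n) \<Rightarrow> point \<Rightarrow> ef \<Rightarrow> 'n formal_vec set" where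
  "horizontal M a q = {f. moderate f \<and> (\<forall>s j.
      s *s f s j + of_nat (j + 1) *s f s (j + 1)
        + (\<Sum>k \<in> Poly_Mapping.keys q.
             (- of_rat k * Poly_Mapping.lookup q k) *s f (s + of_rat k) j)
      = (\<Sum>m \<in> {m. local_coeff M a m \<noteq> 0 \<and> f (s - of_int m) j \<noteq> 0}.
             local_coeff M a m *v f (s - of_int m) j))}"

text \<open>Continuation once around the point: \<open>x powr s\<close> becomes \<open>exp (2 * pi * \<i> * s) * x powr s\<close> and
  \<open>log x\<close> becomes \<open>log x + 2 * pi * \<i>\<close>.\<close>

definition monodromy :: "'n::finite formal_vec \<Rightarrow> 'n formal_vec" where
  "monodromy f = (\<lambda>s j. exp (2 * of_real pi * \<i> * s) *s
     (\<Sum>i \<in> {i. j \<le> i \<and> f s i \<noteq> 0}.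
        (of_nat (i choose j) * (2 * of_real pi * \<i>) ^ (i - j)) *s f s i))"

definition cdim :: "'n::finite formal_vec set \<Rightarrow> nat" where
  "cdim = vector_space.dim (\<lambda>c f s j. c *s f s j)"

text \<open>Rank of the local system on \<open>\<langle>q\<rangle>\<^sub>a\<close>\<close>

definition multiplicity :: "(complex \<Rightarrow> complex^'n^'n) \<Rightarrow> point \<Rightarrow> ef \<Rightarrow> nat" where
  "multiplicity M a q = cdim (horizontal M a q)"

definition modified_multiplicity :: "(complex \<Rightarrow> complex^'n^'n) \<Rightarrow> point \<Rightarrow> ef \<Rightarrow> nat" where
  "modified_multiplicity M a q =
     (if a \<noteq> Infinity \<and> q = 0
      then cdim ((\<lambda>f. monodromy f - f) ` horizontal M a 0)
      else multiplicity M a q)"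

definition active_circles :: "(complex \<Rightarrow> complex^'n^'n) \<Rightarrow> circ set" where
  "active_circles M = {circle a q |a q. exp_factor q \<and> modified_multiplicity M a q \<noteq> 0}"

text \<open>A finite point carries an active circle iff it is a genuine singularity: the connection is
  regular there, up to a gauge transformation, iff its formal solutions are tame with trivial
  monodromy. The order at infinity is the degree of the exponential factor in \<open>z\<close>, so that the
  connections singled out are those with horizontal sections \<open>exp (\<alpha> * z)\<close> up to a rational factor.\<close>

definition rank_one_only_infinity_order_less_two ::
  "(complex \<Rightarrow> complex^'n^'n) \<Rightarrow> bool" where
  "rank_one_only_infinity_order_less_two M \<longleftrightarrow> CARD('n) = 1 \<and>
     (\<forall>I \<in> active_circles M. base_point I = Infinity \<and> (\<forall>q \<in> snd I. Irr q < 2))"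

section \<open>The core diagram\<close>

definition core_diagram :: "(complex \<Rightarrow> complex^'n^'n) \<Rightarrow> (circ \<Rightarrow> circ \<Rightarrow> rat) \<Rightarrow> bool" where
  "core_diagram M B \<longleftrightarrow> (\<exists>A \<phi>. det A = 1 \<and> sl2_action A \<phi> \<and>
     (\<forall>I \<in> active_circles M. base_point (\<phi> I) = Infinity) \<and>
     (\<forall>I \<in> active_circles M. \<forall>I' \<in> active_circles M. B I I' = B_inf (\<phi> I) (\<phi> I')))"

end

theory Submission
  imports Defs
begin

text \<open>The four formulas define a number of edges for any two circles, at infinity or not, and this number is
  invariant under every elementary transformation; as \<open>A\<close> moves both circles to infinity, it equals
  \<open>B\<^sup>\<infinity>\<close> of the images. For twists and scalings the invariance is immediate. For the Fourier
  transform, compare a circle of ramification \<open>r\<close> with the conjugates of another one of the same slope. The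
  conjugates with the same leading term are matched with those on the dual side by the leading coefficients of
  the local solutions of \<open>dq/dz = \<xi>\<close>, and \<open>dL/d\<xi> = - z\<close> for the transform \<open>L\<close> shows that the
  pole order of the difference, measured in the uniformizers, is the same on both sides. For all other
  conjugates this order is the maximal one, the common irregularity, so that only the numbers of conjugates
  enter. The same comparison shows that the transform is injective on circles and determines its ramification.\<close>

text \<open>The formulas reflect how the transform moves the pair (\<open>Irr\<close>,
  \<open>ram\<close>), linear terms being ignored: (\<alpha>, \<beta>) becomes (\<alpha>, \<alpha> +
  \<beta>) from a finite point to infinity, (\<alpha>, \<beta> - \<alpha>) on the way back, and
  (\<alpha>, \<alpha> - \<beta>) for slopes above one. These numbers do not determine the
  irregularity of Hom, which depends on how many terms two circles share. No transform is computed
  for it: what is followed is its defect from the largest value allowed by the slopes, and this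
  defect is preserved. The obstacle is that two circles and their two transforms may have four
  different ramifications, so minimal uniformizers cannot be compared. Sums over conjugates are
  therefore taken over the roots of unity of common covers, of degree \<open>R\<close> on one side
  and \<open>S\<close> on the other, and the multiplicities are divided out at the end. Moreover the
  transform of a factor is only a relation, and a loop carries an extra 1 in its number. Equality of
  circles thus has to be transported together with the irregularity.\<close>

abbreviation (input) coef :: "ef \<Rightarrow> rat \<Rightarrow> complex" where
  "coef \<equiv> Poly_Mapping.lookup"

section \<open>Exponential factors\<close>

lemma lookup_rescale [simp]: "coef (rescale g q) k = g k * coef q k"
proof (cases "k \<in> Poly_Mapping.keys q")
  case True
  have "coef (rescale g q) k = (\<Sum>i \<in> Poly_Mapping.keys q. if i = k then g k * coef q k else 0)"
    unfolding rescale_def lookup_sum by (intro sum.cong) (auto simp: lookup_single when_def)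
  with True show ?thesis by simp
next
  case False
  then have "coef (rescale g q) k = 0"
    unfolding rescale_def lookup_sum by (intro sum.neutral) (auto simp: lookup_single when_def)
  with False show ?thesis by (simp add: in_keys_iff)
qed

lemma exp_factor_iff: "exp_factor q \<longleftrightarrow> (\<forall>k. coef q k \<noteq> 0 \<longrightarrow> 0 < k)"
  unfolding exp_factor_def Ball_def in_keys_iff ..

lemma exp_factor_0 [simp]: "exp_factor 0"
  and exp_factor_add: "exp_factor p \<Longrightarrow> exp_factor q \<Longrightarrow> exp_factor (p + q)"
  and exp_factor_diff: "exp_factor p \<Longrightarrow> exp_factor q \<Longrightarrow> exp_factor (p - q)"
  and exp_factor_rescale: "exp_factor q \<Longrightarrow> exp_factor (rescale g q)"
  and exp_factor_single: "0 < k \<Longrightarrow> exp_factor (Poly_Mapping.single k c)"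
  by (auto simp: exp_factor_iff lookup_add lookup_minus lookup_single when_def)
     (metis add.right_neutral, metis diff_0_right eq_iff_diff_eq_0)

lemma slope_mem: "q \<noteq> 0 \<Longrightarrow> coef q (slope q) \<noteq> 0"
  using Max_in[of "Poly_Mapping.keys q"] by (auto simp: slope_def simp flip: in_keys_iff)

lemma slope_ge: "coef q k \<noteq> 0 \<Longrightarrow> k \<le> slope q"
  by (auto simp: slope_def in_keys_iff)

lemma slope_0 [simp]: "slope 0 = 0"
  by (simp add: slope_def)

lemma slope_eqI: "coef q k \<noteq> 0 \<Longrightarrow> (\<And>j. k < j \<Longrightarrow> coef q j = 0) \<Longrightarrow> slope q = k"
  by (metis linorder_less_linear lookup_zero order.strict_iff_not slope_ge slope_mem)

lemma slope_pos: "exp_factor q \<Longrightarrow> q \<noteq> 0 \<Longrightarrow> 0 < slope q"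
  using slope_mem by (auto simp: exp_factor_iff)

lemma slope_eq_0_iff: "exp_factor q \<Longrightarrow> slope q = 0 \<longleftrightarrow> q = 0"
  using slope_pos by fastforce

lemma slope_nonneg: "exp_factor q \<Longrightarrow> 0 \<le> slope q"
  using slope_pos[of q] by (cases "q = 0") auto

lemma slope_leI: "exp_factor q \<Longrightarrow> 0 \<le> k \<Longrightarrow> (\<And>j. k < j \<Longrightarrow> coef q j = 0) \<Longrightarrow> slope q \<le> k"
  by (metis linorder_not_le slope_0 slope_mem)

lemma coef_above_slope: "slope q < k \<Longrightarrow> coef q k = 0"
  using slope_ge by force

lemma keys_rescale: "(\<And>k. g k \<noteq> 0) \<Longrightarrow> Poly_Mapping.keys (rescale g q) = Poly_Mapping.keys q"
  by (auto simp: in_keys_iff)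

lemma keys_eq_imp_slope_eq: "Poly_Mapping.keys p = Poly_Mapping.keys q \<Longrightarrow> slope p = slope q"
  by (auto simp: slope_def simp flip: keys_eq_empty)

lemma keys_eq_imp_ram_eq: "Poly_Mapping.keys p = Poly_Mapping.keys q \<Longrightarrow> ram p = ram q"
  by (simp add: ram_def)

lemma slope_minus_commute: "slope (p - q) = slope (q - p)"
  by (rule keys_eq_imp_slope_eq) (auto simp: in_keys_iff lookup_minus)

lemma slope_diff_neq:
  assumes "exp_factor p" "exp_factor q" "slope p \<noteq> slope q"
  shows "slope (p - q) = max (slope p) (slope q)"
proof -
  have *: "slope (p - q) = slope p" if "exp_factor p" "exp_factor q" "slope q < slope p" for p q
  proof (rule slope_eqI)
    have "p \<noteq> 0" using that slope_nonneg[of q] by force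
    then show "coef (p - q) (slope p) \<noteq> 0"
      using that slope_mem[of p] by (simp add: lookup_minus coef_above_slope)
  qed (use that in \<open>simp add: lookup_minus coef_above_slope\<close>)
  show ?thesis
    using assms *[of p q] *[of q p] slope_minus_commute[of p q] by (cases "slope p" "slope q" rule: linorder_cases) auto
qed

lemma slope_diff_lead_neq:
  assumes "slope p = slope q" "coef p (slope q) \<noteq> coef q (slope q)"
  shows "slope (p - q) = slope q"
  using assms by (intro slope_eqI) (auto simp: lookup_minus coef_above_slope)

section \<open>Ramification\<close>

text \<open>The degree \<open>R\<close> of a cover on which \<open>q\<close> becomes single valued
  need not be minimal: factors of different ramification are compared on a common cover.\<close>

definition covers :: "nat \<Rightarrow> ef \<Rightarrow> bool" where
  "covers R q \<longleftrightarrow> (\<forall>k. coef q k \<noteq> 0 \<longrightarrow> of_nat R * k \<in> \<int>)"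

text \<open>The floor only turns a rational into an integer; it is exact at every exponent occurring
  in \<open>q\<close> when \<open>covers R q\<close> holds.\<close>

definition expo :: "nat \<Rightarrow> rat \<Rightarrow> int" where
  "expo R k = \<lfloor>of_nat R * k\<rfloor>"

lemma of_int_expo: "covers R q \<Longrightarrow> coef q k \<noteq> 0 \<Longrightarrow> of_int (expo R k) = of_nat R * k"
  by (auto simp: covers_def expo_def elim!: Ints_cases)

lemma covers_rescale: "covers R q \<Longrightarrow> covers R (rescale g q)"
  and covers_add: "covers R p \<Longrightarrow> covers R q \<Longrightarrow> covers R (p + q)"
  and covers_diff: "covers R p \<Longrightarrow> covers R q \<Longrightarrow> covers R (p - q)"
  and covers_single: "covers R (Poly_Mapping.single (of_int n) c)"
proof -
  have *: "x = 0 \<Longrightarrow> y = 0 \<Longrightarrow> x + y = 0" "x = 0 \<Longrightarrow> y = 0 \<Longrightarrow> x - y = 0" for x y :: complex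
    by simp_all
  show "covers R q \<Longrightarrow> covers R (rescale g q)"
    "covers R (Poly_Mapping.single (of_int n) c)"
    by (auto simp: covers_def lookup_single when_def split: if_splits)
  show "covers R (p + q)" "covers R (p - q)" if "covers R p" "covers R q"
    using that * unfolding covers_def lookup_add lookup_minus by blast+
qed

lemma covers_mult:
  assumes "covers R q"
  shows "covers (R * m) q"
  unfolding covers_def
proof (intro allI impI)
  fix k assume "coef q k \<noteq> 0"
  with assms have "of_nat R * k \<in> \<int>" unfolding covers_def by blast
  then have "of_nat m * (of_nat R * k) \<in> \<int>" by (rule Ints_mult[OF Ints_of_nat])
  moreover have "of_nat m * (of_nat R * k) = of_nat (R * m) * k" by simp
  ultimately show "of_nat (R * m) * k \<in> \<int>" by simp
qed

lemma ram_def': "ram q = (LEAST r. 0 < r \<and> covers r q)"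
  unfolding ram_def covers_def Ball_def in_keys_iff ..

lemma ex_covers: "\<exists>r>0. covers r q"
proof -
  define d where "d k = snd (quotient_of k)" for k :: rat
  have d: "d k > 0" "of_int (d k) * k \<in> \<int>" for k
  proof -
    obtain a b where ab: "quotient_of k = (a, b)" by force
    then have "b > 0" "k = of_int a / of_int b"
      using quotient_of_denom_pos quotient_of_div by auto
    with ab show "d k > 0" "of_int (d k) * k \<in> \<int>" by (auto simp: d_def)
  qed
  define r where "r = nat (\<Prod>k \<in> Poly_Mapping.keys q. d k)"
  have "of_nat r * k \<in> \<int>" if "k \<in> Poly_Mapping.keys q" for k
  proof -
    have "(\<Prod>k \<in> Poly_Mapping.keys q. d k) = d k * (\<Prod>k \<in> Poly_Mapping.keys q - {k}. d k)"
      using that by (simp add: prod.remove)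
    moreover have "(\<Prod>k \<in> Poly_Mapping.keys q. d k) \<ge> 0"
      using d(1) by (intro prod_nonneg) (auto intro: less_imp_le)
    ultimately have "of_nat r * k = of_int (\<Prod>k \<in> Poly_Mapping.keys q - {k}. d k) * (of_int (d k) * k)"
      by (simp add: r_def flip: of_int_mult) (simp add: mult_ac)
    with d(2) show ?thesis by (metis Ints_mult Ints_of_int)
  qed
  moreover have "r > 0" using d(1) by (auto simp: r_def intro!: prod_pos)
  ultimately show ?thesis by (auto simp: covers_def in_keys_iff)
qed

lemma ram_pos: "0 < ram q" and covers_ram: "covers (ram q) q"
  using LeastI_ex[OF ex_covers[of q, unfolded Bex_def], unfolded] unfolding ram_def' by auto

lemma ram_le: "0 < r \<Longrightarrow> covers r q \<Longrightarrow> ram q \<le> r"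
  unfolding ram_def' by (rule Least_le) auto

text \<open>Division with remainder: \<open>R mod ram q\<close> again satisfies the integrality
  condition, so minimality of \<open>ram q\<close> forces it to be 0.\<close>

lemma covers_imp_ram_dvd:
  assumes "covers R q"
  shows "ram q dvd R"
proof -
  have "covers (R mod ram q) q"
    unfolding covers_def
  proof (intro allI impI)
    fix k assume k: "coef q k \<noteq> 0"
    have "of_nat (R mod ram q) * k = of_nat R * k - of_nat (R div ram q) * (of_nat (ram q) * k)"
    proof -
      have "(of_nat R :: rat) = of_nat (R div ram q) * of_nat (ram q) + of_nat (R mod ram q)"
        by (metis div_mult_mod_eq of_nat_add of_nat_mult)
      then show ?thesis by (simp add: algebra_simps)
    qed
    with assms covers_ram[of q] k show "of_nat (R mod ram q) * k \<in> \<int>"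
      unfolding covers_def by (metis Ints_diff Ints_mult Ints_of_nat)
  qed
  with ram_le[of "R mod ram q" q] ram_pos[of q] show ?thesis
    by (metis dvd_eq_mod_eq_0 gr0I leD mod_less_divisor)
qed

text \<open>The floor and the truncation in \<open>Irr\<close> lose nothing, because the slope is
  itself a nonnegative exponent of \<open>q\<close> (or 0).\<close>

lemma Irr_eq: "exp_factor q \<Longrightarrow> of_nat (Irr q) = of_nat (ram q) * slope q"
proof (cases "q = 0")
  case False
  assume q: "exp_factor q"
  have "of_nat (ram q) * slope q \<in> \<int>"
    using covers_ram slope_mem[OF False] by (auto simp: covers_def)
  moreover have "0 \<le> of_nat (ram q) * slope q"
    using slope_nonneg[OF q] by simp
  ultimately show ?thesis unfolding Irr_def by (auto elim!: Ints_cases)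
qed (simp add: Irr_def)

section \<open>Galois orbits\<close>

definition act :: "nat \<Rightarrow> complex \<Rightarrow> ef \<Rightarrow> ef" where
  "act R \<omega> q = rescale (\<lambda>k. \<omega> powi (- expo R k)) q"

definition roots :: "nat \<Rightarrow> complex set" where
  "roots R = {\<omega>. \<omega> ^ R = 1}"

lemma galois_orbit_alt: "galois_orbit q = (\<lambda>\<omega>. act (ram q) \<omega> q) ` roots (ram q)"
  by (auto simp: galois_orbit_def act_def roots_def expo_def)

lemma roots_nonzero: "0 < R \<Longrightarrow> \<omega> \<in> roots R \<Longrightarrow> \<omega> \<noteq> 0"
  by (auto simp: roots_def zero_power)

lemma one_in_roots [simp]: "1 \<in> roots R"
  by (simp add: roots_def)

lemma finite_roots: "0 < R \<Longrightarrow> finite (roots R)"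
  unfolding roots_def by (rule finite_roots_unity) auto

lemma card_roots: "0 < R \<Longrightarrow> card (roots R) = R"
  unfolding roots_def by (rule card_roots_unity_eq)

lemma roots_mult: "\<omega> \<in> roots R \<Longrightarrow> \<eta> \<in> roots R \<Longrightarrow> \<omega> * \<eta> \<in> roots R"
  and roots_divide: "\<omega> \<in> roots R \<Longrightarrow> \<eta> \<in> roots R \<Longrightarrow> \<omega> / \<eta> \<in> roots R"
  and roots_inverse: "\<omega> \<in> roots R \<Longrightarrow> inverse \<omega> \<in> roots R"
  by (simp_all add: roots_def power_mult_distrib power_divide power_inverse)

lemma roots_powi: "\<omega> \<in> roots R \<Longrightarrow> \<omega> powi (int R * n) = 1"
  by (simp add: roots_def power_int_mult)

lemma coef_act: "coef (act R \<omega> q) k = \<omega> powi (- expo R k) * coef q k"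
  by (simp add: act_def)

lemma act_1 [simp]: "act R 1 q = q"
  by (rule poly_mapping_eqI) (simp add: coef_act)

lemma act_mult: "act R \<omega> (act R \<eta> q) = act R (\<omega> * \<eta>) q"
  by (rule poly_mapping_eqI) (simp add: coef_act power_int_mult_distrib)

lemma act_diff: "act R \<omega> (p - q) = act R \<omega> p - act R \<omega> q"
  by (rule poly_mapping_eqI) (simp add: coef_act lookup_minus algebra_simps)

lemma act_add: "act R \<omega> (p + q) = act R \<omega> p + act R \<omega> q"
  by (rule poly_mapping_eqI) (simp add: coef_act lookup_add algebra_simps)

lemma keys_act: "\<omega> \<noteq> 0 \<Longrightarrow> Poly_Mapping.keys (act R \<omega> q) = Poly_Mapping.keys q"
  unfolding act_def by (rule keys_rescale) simp

lemma slope_act: "\<omega> \<noteq> 0 \<Longrightarrow> slope (act R \<omega> q) = slope q"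
  by (intro keys_eq_imp_slope_eq keys_act)

lemma ram_act: "\<omega> \<noteq> 0 \<Longrightarrow> ram (act R \<omega> q) = ram q"
  by (intro keys_eq_imp_ram_eq keys_act)

lemma exp_factor_act: "exp_factor q \<Longrightarrow> exp_factor (act R \<omega> q)"
  and covers_act: "covers r q \<Longrightarrow> covers r (act R \<omega> q)"
  unfolding act_def by (simp_all add: exp_factor_rescale covers_rescale)

lemma act_change_cover:
  assumes "covers r q" "0 < m"
  shows "act (r * m) \<omega> q = act r (\<omega> ^ m) q"
proof (rule poly_mapping_eqI)
  fix k
  show "coef (act (r * m) \<omega> q) k = coef (act r (\<omega> ^ m) q) k"
  proof (cases "coef q k = 0")
    case False
    have "(of_int (expo (r * m) k) :: rat) = of_int (int m * expo r k)"
      using of_int_expo[OF assms(1) False] of_int_expo[OF covers_mult[OF assms(1)] False, of m] by simp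
    then have "expo (r * m) k = int m * expo r k" by (simp only: of_int_eq_iff)
    then have "\<omega> powi (- expo (r * m) k) = \<omega> powi (int m * (- expo r k))" by simp
    also have "\<dots> = (\<omega> ^ m) powi (- expo r k)" by (simp only: power_int_mult power_int_of_nat)
    finally show ?thesis by (simp add: coef_act)
  qed (simp add: coef_act)
qed

lemma power_in_roots_iff: "\<omega> ^ m \<in> roots r \<longleftrightarrow> \<omega> \<in> roots (r * m)"
  by (simp add: roots_def power_mult mult.commute)

lemma ex_root: "0 < n \<Longrightarrow> \<exists>z::complex. z ^ n = c"
proof (cases "c = 0")
  case False
  assume "0 < n"
  then have "card {z. z ^ n = c} = n" using False by (intro card_nth_roots) auto
  with \<open>0 < n\<close> have "{z. z ^ n = c} \<noteq> {}" by (metis card.empty less_irrefl)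
  then show ?thesis by auto
qed (auto intro: exI[of _ 0])

lemma roots_power_surj: "0 < m \<Longrightarrow> \<eta> \<in> roots r \<Longrightarrow> \<exists>\<omega> \<in> roots (r * m). \<eta> = \<omega> ^ m"
  using ex_root[of m \<eta>] power_in_roots_iff by metis

text \<open>Conjugates may be computed on any cover, since taking \<open>m\<close>-th powers maps
  \<open>roots (r * m)\<close> onto \<open>roots r\<close>.\<close>

lemma galois_orbit_cover:
  assumes "0 < R" "covers R q"
  shows "galois_orbit q = (\<lambda>\<omega>. act R \<omega> q) ` roots R"
proof -
  obtain m where m: "R = ram q * m" using covers_imp_ram_dvd[OF assms(2)] by auto
  with assms have "m > 0" by auto
  show ?thesis
    unfolding galois_orbit_alt m act_change_cover[OF covers_ram \<open>m > 0\<close>]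
    using power_in_roots_iff roots_power_surj[OF \<open>m > 0\<close>] by fastforce
qed

text \<open>Freeness of the action on the minimal cover. Write \<omega> as
  \<open>cis (2 * pi * j / r)\<close> with \<open>j < r\<close>. If \<omega> fixes \<open>q\<close>,
  then \<open>j * k\<close> is an integer for every exponent \<open>k\<close>, so \<open>j\<close>
  covers \<open>q\<close>, and minimality of \<open>r\<close> leaves only
  \<open>j = 0\<close>.\<close>

lemma act_ram_eq_imp:
  assumes "\<omega> \<in> roots (ram q)" "act (ram q) \<omega> q = q"
  shows "\<omega> = 1"
proof -
  define r where "r = ram q"
  have r: "r > 0" by (simp add: r_def ram_pos)
  obtain j where j: "j < r" "\<omega> = cis (2 * pi * real j / real r)"
    using Complex.bij_betw_roots_unity[OF r] assms(1) by (auto simp: roots_def r_def bij_betw_def)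
  have "covers j q"
    unfolding covers_def
  proof (intro allI impI)
    fix k assume k: "coef q k \<noteq> 0"
    have "\<omega> powi (- expo r k) = 1"
      using arg_cong[OF assms(2), of "\<lambda>p. coef p k"] k by (simp add: coef_act r_def)
    then have "cis (of_int (- expo r k) * (2 * pi * real j / real r)) = 1"
      by (simp add: j(2) cis_power_int)
    then have "cos (of_int (- expo r k) * (2 * pi * real j / real r)) = 1"
      by (metis cis.sel(1) one_complex.sel(1))
    then obtain n where "of_int (- expo r k) * (2 * pi * real j / real r) = of_int n * 2 * pi"
      unfolding cos_one_2pi_int by blast
    then have "(2 * pi) * (of_int (- expo r k) * real j) / real r = (2 * pi) * of_int n"
      by (simp add: mult_ac)
    then have "(2 * pi) * (of_int (- expo r k) * real j) = (2 * pi) * (of_int n * real r)"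
      using r nonzero_divide_eq_eq[of "real r" "(2 * pi) * (of_int (- expo r k) * real j)"]
      by (metis mult.assoc of_nat_0_eq_iff less_irrefl)
    then have "of_int (- expo r k) * real j = of_int n * real r"
      unfolding mult_cancel_left using pi_neq_zero by linarith
    then have "of_int (- expo r k * int j) = (of_int (n * int r) :: real)"
      unfolding of_int_mult of_int_of_nat_eq .
    then have "- expo r k * int j = n * int r" by (simp only: of_int_eq_iff)
    then have "(of_int (- expo r k * int j) :: rat) = of_int (n * int r)" by simp
    then have "- (of_int (expo r k)) * of_nat j = (of_int n * of_nat r :: rat)"
      unfolding of_int_mult of_int_of_nat_eq of_int_minus .
    moreover have "of_int (expo r k) = of_nat r * k"
      using of_int_expo[OF covers_ram k] by (simp add: r_def)
    ultimately have "of_nat r * (of_nat j * k) = of_nat r * (of_int (- n) :: rat)"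
      by (simp add: mult_ac minus_equation_iff)
    then have "of_nat j * k = of_int (- n)" using r by (simp only: mult_cancel_left) simp
    then show "of_nat j * k \<in> \<int>" by (metis Ints_of_int)
  qed
  with ram_le[of j q] j(1) have "j = 0" by (cases "j = 0") (auto simp: r_def)
  with j show ?thesis by simp
qed

lemma inj_on_act_ram: "inj_on (\<lambda>\<omega>. act (ram q) \<omega> q) (roots (ram q))"
proof (rule inj_onI)
  fix \<omega> \<eta> assume *: "\<omega> \<in> roots (ram q)" "\<eta> \<in> roots (ram q)" "act (ram q) \<omega> q = act (ram q) \<eta> q"
  have "act (ram q) (inverse \<eta> * \<omega>) q = act (ram q) (inverse \<eta> * \<eta>) q"
    using *(3) by (simp flip: act_mult)
  moreover have "\<eta> \<noteq> 0" using * roots_nonzero ram_pos by blast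
  ultimately have "inverse \<eta> * \<omega> = 1"
    using * by (intro act_ram_eq_imp) (auto intro: roots_mult roots_inverse)
  with \<open>\<eta> \<noteq> 0\<close> show "\<omega> = \<eta>" by (simp add: field_simps)
qed

section \<open>Sums over conjugates as sums over roots of unity\<close>

lemma sum_roots_power:
  assumes "0 < r" "0 < m"
  shows "(\<Sum>\<omega> \<in> roots (r * m). g (\<omega> ^ m)) = of_nat m * (\<Sum>\<eta> \<in> roots r. g \<eta> :: rat)"
proof -
  have "(\<Sum>\<omega> \<in> roots (r * m). g (\<omega> ^ m)) =
      (\<Sum>\<eta> \<in> roots r. \<Sum>\<omega> \<in> {\<omega> \<in> roots (r * m). \<omega> ^ m = \<eta>}. g (\<omega> ^ m))"
    using assms by (intro sum.group[symmetric] finite_roots) (auto simp: power_in_roots_iff)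
  also have "\<dots> = (\<Sum>\<eta> \<in> roots r. of_nat m * g \<eta>)"
  proof (intro sum.cong refl)
    fix \<eta> assume \<eta>: "\<eta> \<in> roots r"
    have "{\<omega> \<in> roots (r * m). \<omega> ^ m = \<eta>} = {\<omega>. \<omega> ^ m = \<eta>}"
      using \<eta> power_in_roots_iff by auto
    moreover have "card {\<omega>. \<omega> ^ m = \<eta>} = m"
      using assms \<eta> roots_nonzero by (intro card_nth_roots) auto
    ultimately show "(\<Sum>\<omega> \<in> {\<omega> \<in> roots (r * m). \<omega> ^ m = \<eta>}. g (\<omega> ^ m)) = of_nat m * g \<eta>"
      by simp
  qed
  finally show ?thesis by (simp add: sum_distrib_left)
qed

text \<open>On a cover of degree \<open>R\<close> each conjugate is hit by \<open>R / ram q\<close>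
  roots of unity; the quotient is cleared by cross-multiplication.\<close>

lemma sum_roots_orbit:
  assumes "0 < R" "covers R q"
  shows "of_nat (ram q) * (\<Sum>\<omega> \<in> roots R. f (act R \<omega> q)) = of_nat R * (\<Sum>x \<in> galois_orbit q. f x :: rat)"
proof -
  obtain m where m: "R = ram q * m" using covers_imp_ram_dvd[OF assms(2)] by auto
  with assms have "m > 0" by auto
  have "(\<Sum>x \<in> galois_orbit q. f x) = (\<Sum>\<eta> \<in> roots (ram q). f (act (ram q) \<eta> q))"
    unfolding galois_orbit_alt by (rule sum.reindex_cong[OF inj_on_act_ram]) auto
  moreover have "(\<Sum>\<omega> \<in> roots R. f (act R \<omega> q)) = (\<Sum>\<omega> \<in> roots (ram q * m). f (act (ram q) (\<omega> ^ m) q))"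
    unfolding m act_change_cover[OF covers_ram \<open>m > 0\<close>] ..
  ultimately show ?thesis
    using sum_roots_power[OF ram_pos \<open>m > 0\<close>, of "\<lambda>\<eta>. f (act (ram q) \<eta> q)"] by (simp add: m)
qed

lemma sum_roots_translate:
  assumes "0 < R" "\<eta> \<in> roots R"
  shows "(\<Sum>\<omega> \<in> roots R. f (\<omega> / \<eta>)) = (\<Sum>\<omega> \<in> roots R. f \<omega>)"
  by (rule sum.reindex_bij_witness[of _ "\<lambda>\<omega>. \<omega> * \<eta>" "\<lambda>\<omega>. \<omega> / \<eta>"])
     (use assms roots_nonzero[OF assms] in \<open>auto intro: roots_mult roots_divide\<close>)

text \<open>Rotating both factors by the same root of unity does not change the slope of their
  difference. One of the two sums over roots therefore collapses to a factor
  \<open>R\<close>.\<close>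

lemma irr_Hom_cover:
  assumes "0 < R" "covers R q" "covers R q'"
  shows "of_nat R * irr_Hom (circle a q) (circle b q') =
           of_nat (ram q * ram q') * (\<Sum>\<omega> \<in> roots R. slope (q - act R \<omega> q'))"
proof -
  have "of_nat R * (of_nat R * irr_Hom (circle a q) (circle b q')) =
      of_nat R * (\<Sum>x \<in> galois_orbit q. of_nat R * (\<Sum>y \<in> galois_orbit q'. slope (x - y)))"
    by (simp add: irr_Hom_def circle_def sum_distrib_left)
  also have "\<dots> = of_nat (ram q) * (\<Sum>\<eta> \<in> roots R. of_nat (ram q') * (\<Sum>\<omega> \<in> roots R. slope (act R \<eta> q - act R \<omega> q')))"
    unfolding sum_roots_orbit[OF assms(1,3), symmetric] sum_roots_orbit[OF assms(1,2), symmetric] ..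
  also have "\<dots> = of_nat (ram q) * (\<Sum>\<eta> \<in> roots R. of_nat (ram q') * (\<Sum>\<omega> \<in> roots R. slope (q - act R \<omega> q')))"
  proof (rule arg_cong[where f = "(*) (of_nat (ram q))"], rule sum.cong[OF refl])
    fix \<eta> assume \<eta>: "\<eta> \<in> roots R"
    have "act R \<eta> q - act R \<omega> q' = act R \<eta> (q - act R (\<omega> / \<eta>) q')" for \<omega>
      using roots_nonzero[OF assms(1) \<eta>] by (simp add: act_diff act_mult)
    then show "of_nat (ram q') * (\<Sum>\<omega> \<in> roots R. slope (act R \<eta> q - act R \<omega> q')) =
        of_nat (ram q') * (\<Sum>\<omega> \<in> roots R. slope (q - act R \<omega> q'))"
      using sum_roots_translate[OF assms(1) \<eta>, of "\<lambda>\<omega>. slope (q - act R \<omega> q')"]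
        slope_act[OF roots_nonzero[OF assms(1) \<eta>]] by simp
  qed
  also have "\<dots> = of_nat R * (of_nat (ram q * ram q') * (\<Sum>\<omega> \<in> roots R. slope (q - act R \<omega> q')))"
    by (simp add: card_roots assms algebra_simps flip: sum_distrib_left)
  finally show ?thesis using assms(1) by simp
qed

lemma galois_orbit_eq_iff:
  assumes "0 < R" "covers R q" "covers R q'"
  shows "galois_orbit q = galois_orbit q' \<longleftrightarrow> (\<exists>\<omega> \<in> roots R. q = act R \<omega> q')"
proof
  assume *: "galois_orbit q = galois_orbit q'"
  have "q \<in> galois_orbit q"
    unfolding galois_orbit_cover[OF assms(1,2)] by (rule image_eqI[of _ _ 1]) auto
  with * show "\<exists>\<omega> \<in> roots R. q = act R \<omega> q'" unfolding galois_orbit_cover[OF assms(1,3)] by auto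
next
  assume "\<exists>\<omega> \<in> roots R. q = act R \<omega> q'"
  then obtain \<omega> where \<omega>: "\<omega> \<in> roots R" "q = act R \<omega> q'" by auto
  have q': "q' = act R (inverse \<omega>) q" using \<omega> roots_nonzero[OF assms(1) \<omega>(1)] by (simp add: act_mult)
  show "galois_orbit q = galois_orbit q'"
    unfolding galois_orbit_cover[OF assms(1,2)] galois_orbit_cover[OF assms(1,3)]
  proof safe
    fix \<eta> assume "\<eta> \<in> roots R"
    then show "act R \<eta> q \<in> (\<lambda>\<omega>. act R \<omega> q') ` roots R"
      using \<omega> by (auto simp: act_mult intro!: roots_mult)
    show "act R \<eta> q' \<in> (\<lambda>\<omega>. act R \<omega> q) ` roots R"
      using \<omega> \<open>\<eta> \<in> roots R\<close> unfolding q' act_mult by (intro imageI roots_mult roots_inverse)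
  qed
qed

lemma circ_ram_circle [simp]: "circ_ram (circle a q) = ram q"
proof -
  have "ram ` galois_orbit q = {ram q}"
    unfolding galois_orbit_alt image_image
  proof (intro equalityI subsetI)
    fix x assume "x \<in> {ram q}"
    then show "x \<in> (\<lambda>\<omega>. ram (act (ram q) \<omega> q)) ` roots (ram q)"
      by (intro image_eqI[of _ _ 1]) auto
  qed (use ram_act roots_nonzero[OF ram_pos] in auto)
  then show ?thesis by (simp add: circ_ram_def circle_def)
qed

lemma circle_eq_iff [simp]: "circle a q = circle b q' \<longleftrightarrow> a = b \<and> galois_orbit q = galois_orbit q'"
  by (simp add: circle_def)

lemma circle_eq_imp:
  assumes "galois_orbit q = galois_orbit q'"
  shows "\<exists>\<omega> \<in> roots (ram q). q = act (ram q) \<omega> q'" "ram q = ram q'" "slope q = slope q'"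
    and "Irr q = Irr q'" "exp_factor q \<longleftrightarrow> exp_factor q'"
proof -
  define R where "R = ram q * ram q'"
  have R: "0 < R" "covers R q" "covers R q'"
    using covers_mult[OF covers_ram[of q], of "ram q'"] covers_mult[OF covers_ram[of q'], of "ram q"]
    by (auto simp: R_def ram_pos mult.commute)
  obtain \<omega> where \<omega>: "\<omega> \<in> roots R" "q = act R \<omega> q'"
    using assms galois_orbit_eq_iff[OF R] by auto
  show r: "ram q = ram q'" and s: "slope q = slope q'"
    using \<omega> roots_nonzero[OF R(1)] ram_act slope_act by metis+
  then show "Irr q = Irr q'" by (simp add: Irr_def)
  show "\<exists>\<omega> \<in> roots (ram q). q = act (ram q) \<omega> q'"
    using assms galois_orbit_eq_iff[of "ram q" q q'] ram_pos covers_ram[of q] covers_ram[of q'] r by auto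
  show "exp_factor q \<longleftrightarrow> exp_factor q'"
    using \<omega> roots_nonzero[OF R(1)] unfolding exp_factor_def by (metis keys_act)
qed

lemma common_cover:
  obtains R where "0 < R" "covers R q" "covers R q'"
proof
  show "covers (ram q * ram q') q" "covers (ram q * ram q') q'"
    using covers_mult[OF covers_ram[of q], of "ram q'"] covers_mult[OF covers_ram[of q'], of "ram q"]
    by (auto simp: mult.commute)
qed (auto simp: ram_pos)

section \<open>Terms of integral exponent, which every conjugation fixes\<close>

lemma act_integral:
  assumes "0 < R" "\<omega> \<in> roots R"
  shows "act R \<omega> (Poly_Mapping.single (of_int n) c) = Poly_Mapping.single (of_int n) c"
proof (rule poly_mapping_eqI)
  fix k :: rat
  have "\<omega> powi (- expo R (of_int n)) = 1"
  proof -
    have "of_nat R * of_int n = (of_int (int R * n) :: rat)" by simp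
    then have "- expo R (of_int n) = int R * (- n)" unfolding expo_def by (simp only: floor_of_int)
    then show ?thesis using roots_powi[OF assms(2)] by metis
  qed
  then show "coef (act R \<omega> (Poly_Mapping.single (of_int n) c)) k = coef (Poly_Mapping.single (of_int n) c) k"
    by (auto simp: coef_act lookup_single when_def)
qed

lemma covers_shift_iff: "covers R (q + Poly_Mapping.single (of_int n) c) \<longleftrightarrow> covers R q"
  using covers_add[OF _ covers_single, of R q n c] covers_diff[OF _ covers_single, of R "q + Poly_Mapping.single (of_int n) c" n c]
  by auto

lemma ram_shift: "ram (q + Poly_Mapping.single (of_int n) c) = ram q"
  by (simp add: ram_def' covers_shift_iff)

lemma galois_orbit_shift:
  "galois_orbit (q + Poly_Mapping.single (of_int n) c) = (\<lambda>x. x + Poly_Mapping.single (of_int n) c) ` galois_orbit q"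
  unfolding galois_orbit_alt ram_shift image_image
  by (intro image_cong refl) (simp add: act_add act_integral ram_pos)

lemma galois_orbit_shift_eq_iff:
  "galois_orbit (q + Poly_Mapping.single (of_int n) c) = galois_orbit (q' + Poly_Mapping.single (of_int n) c)
     \<longleftrightarrow> galois_orbit q = galois_orbit q'"
  unfolding galois_orbit_shift by (rule inj_image_eq_iff) (auto intro: injI)

lemma irr_Hom_shift:
  "irr_Hom (circle a (q + Poly_Mapping.single (of_int n) c)) (circle b (q' + Poly_Mapping.single (of_int n) c))
     = irr_Hom (circle a' q) (circle b' q')"
  unfolding irr_Hom_def circle_def galois_orbit_shift by (simp add: sum.reindex inj_on_def)

notation fls_nth (infixl "$$" 75)

declare fls_X_power_int [simp del]

section \<open>Leading terms of formal Laurent series\<close>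

text \<open>The coefficient \<open>c\<close> is allowed to vanish, so that leading terms can be added and multiplied.\<close>

definition leads :: "complex fls \<Rightarrow> int \<Rightarrow> complex \<Rightarrow> bool" where
  "leads f n c \<longleftrightarrow> (\<forall>m<n. f $$ m = 0) \<and> f $$ n = c"

lemma leads_fps: "leads f n c \<longleftrightarrow> (\<exists>F. f = fls_shift (- n) (fps_to_fls F) \<and> fps_nth F 0 = c)"
proof
  assume *: "leads f n c"
  have "f = fls_shift (- n) (fps_to_fls (fls_regpart (fls_shift n f)))"
  proof (rule fls_eqI)
    fix k
    show "f $$ k = fls_shift (- n) (fps_to_fls (fls_regpart (fls_shift n f))) $$ k"
      using * by (cases "k < n") (auto simp: leads_def)
  qed
  moreover have "fps_nth (fls_regpart (fls_shift n f)) 0 = c" using * by (simp add: leads_def)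
  ultimately show "\<exists>F. f = fls_shift (- n) (fps_to_fls F) \<and> fps_nth F 0 = c" by blast
qed (auto simp: leads_def)

lemma leads_mult: "leads f m a \<Longrightarrow> leads g n b \<Longrightarrow> leads (f * g) (m + n) (a * b)"
  unfolding leads_fps by (force simp: fls_shifted_times_simps fls_times_fps_to_fls[symmetric] add.commute)

lemma leads_add: "leads f n a \<Longrightarrow> leads g n b \<Longrightarrow> leads (f + g) n (a + b)"
  and leads_uminus: "leads f n a \<Longrightarrow> leads (- f) n (- a)"
  and leads_0: "leads 0 n 0"
  and leads_const: "leads (fls_const c) 0 c"
  and leads_mono: "leads f n a \<Longrightarrow> m < n \<Longrightarrow> leads f m 0"
  by (simp_all add: leads_def)

lemma leads_sum: "(\<And>i. i \<in> A \<Longrightarrow> leads (f i) n (c i)) \<Longrightarrow> leads (\<Sum>i\<in>A. f i) n (\<Sum>i\<in>A. c i)"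
  by (induction A rule: infinite_finite_induct) (auto intro: leads_0 leads_add)

lemma leads_subdegree: "leads f n c \<Longrightarrow> c \<noteq> 0 \<Longrightarrow> fls_subdegree f = n"
  by (auto simp: leads_def intro: fls_subdegree_eqI)

lemma leads_nonzero: "leads f n c \<Longrightarrow> c \<noteq> 0 \<Longrightarrow> f \<noteq> 0"
  by (auto simp: leads_def)

lemma subdegree_leads: "leads f (fls_subdegree f) (f $$ fls_subdegree f)"
  by (simp add: leads_def)

lemma leads_unique:
  assumes "leads f n c" "leads f m d" "c \<noteq> 0" "d \<noteq> 0"
  shows "n = m" "c = d"
proof -
  show "n = m" using leads_subdegree assms by metis
  with assms show "c = d" by (simp add: leads_def)
qed

lemma leads_power: "leads f n c \<Longrightarrow> leads (f ^ k) (int k * n) (c ^ k)"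
proof (induction k)
  case 0
  show ?case using leads_const[of 1] by simp
next
  case (Suc k)
  from leads_mult[OF Suc.prems Suc.IH[OF Suc.prems]] show ?case by (simp add: algebra_simps)
qed

lemma leads_inverse:
  assumes "leads f n c" "c \<noteq> 0"
  shows "leads (inverse f) (- n) (inverse c)"
proof -
  have f: "f \<noteq> 0" "fls_subdegree f = n" using assms leads_nonzero leads_subdegree by blast+
  define d where "d = inverse f $$ (- n)"
  have *: "leads (inverse f) (- n) d" using subdegree_leads[of "inverse f"] f by (simp add: d_def)
  from leads_mult[OF assms(1) *] f have "leads 1 0 (c * d)" by simp
  then have "c * d = 1" by (simp add: leads_def)
  with * show ?thesis by (metis inverse_unique)
qed

lemma leads_powi: "leads f n c \<Longrightarrow> c \<noteq> 0 \<Longrightarrow> leads (f powi k) (k * n) (c powi k)"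
  using leads_power[of f n c "nat k"] leads_power[OF leads_inverse, of f n c "nat (- k)"]
  by (auto simp: power_int_def)

lemma leads_X: "leads fls_X 1 1"
  by (simp add: leads_def)

lemma leads_X_powi: "leads (fls_X powi k) k 1"
  using leads_powi[OF leads_X, of k] by simp

text \<open>First-order expansion: the difference of the powers behaves like
  \<open>n * \<theta> powi (n - 1)\<close> times \<open>T - T'\<close>.\<close>

lemma leads_powi_diff:
  assumes "leads T 1 \<theta>" "leads T' 1 \<theta>" "\<theta> \<noteq> 0" "leads (T - T') m h"
  shows "leads (T powi n - T' powi n) (n - 1 + m) (of_int n * \<theta> powi (n - 1) * h)"
proof -
  have nz: "T \<noteq> 0" "T' \<noteq> 0" using assms leads_nonzero by blast+
  have nat: "leads (T ^ k - T' ^ k) (int k - 1 + m) (of_nat k * \<theta> powi (int k - 1) * h)" for k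
  proof (induction k)
    case 0
    show ?case using leads_0 by simp
  next
    case (Suc k)
    have "T ^ Suc k - T' ^ Suc k = T * (T ^ k - T' ^ k) + (T - T') * T' ^ k"
      by (simp add: algebra_simps)
    moreover have "leads \<dots> (int k + m) (\<theta> * (of_nat k * \<theta> powi (int k - 1) * h) + h * \<theta> ^ k)"
      using leads_mult[OF assms(1) Suc.IH] leads_mult[OF assms(4) leads_power[OF assms(2), of k]]
      by (intro leads_add) (simp_all add: algebra_simps)
    moreover have "\<theta> * (of_nat k * \<theta> powi (int k - 1) * h) + h * \<theta> ^ k = of_nat (Suc k) * \<theta> powi (int (Suc k) - 1) * h"
      using assms(3) by (simp add: power_int_diff algebra_simps)
    ultimately show ?case by simp
  qed
  show ?thesis
  proof (cases "n \<ge> 0")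
    case True
    with nat[of "nat n"] show ?thesis by (simp add: power_int_def)
  next
    case False
    define k where "k = nat (- n)"
    have n: "n = - int k" using False by (simp add: k_def)
    \<comment> \<open>Negative exponents are reduced to positive ones by putting the two reciprocals
      over a common denominator.\<close>
    have "T powi n - T' powi n = - ((T ^ k - T' ^ k) * (inverse T ^ k * inverse T' ^ k))"
      using nz by (simp add: n power_int_minus field_simps)
    moreover have "leads \<dots> (int k - 1 + m + (int k * (- 1) + int k * (- 1)))
        (- (of_nat k * \<theta> powi (int k - 1) * h * (inverse \<theta> ^ k * inverse \<theta> ^ k)))"
      by (intro leads_uminus leads_mult nat leads_power leads_inverse assms)
    moreover have "of_nat k * \<theta> powi (int k - 1) * h * (inverse \<theta> ^ k * inverse \<theta> ^ k) = of_nat k * \<theta> powi (n - 1) * h"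
      using assms(3) by (simp add: n power_int_diff power_int_minus field_simps)
    moreover have "int k - 1 + m + (int k * (- 1) + int k * (- 1)) = n - 1 + m" by (simp add: n)
    moreover have "- (of_nat k * \<theta> powi (n - 1) * h) = of_int n * \<theta> powi (n - 1) * h" by (simp add: n)
    ultimately show ?thesis by metis
  qed
qed

text \<open>Formal integration. All orders up to \<open>n\<close> are negative, so only nonzero
  integers are divided out and the constant of integration is out of reach.\<close>

lemma leads_of_deriv:
  assumes "leads (fls_deriv f) (n - 1) (of_int n * c)" "n < 0"
  shows "leads f n c"
  unfolding leads_def
proof (intro conjI allI impI)
  fix m assume "m < n"
  moreover have "\<forall>i<n - 1. fls_deriv f $$ i = 0" using assms(1) unfolding leads_def by blast
  ultimately have "fls_deriv f $$ (m - 1) = 0" by (simp del: fls_deriv_nth)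
  then have "of_int (m - 1 + 1) * f $$ (m - 1 + 1) = 0" unfolding fls_deriv_nth .
  then have "of_int m * f $$ m = 0" by (simp only: diff_add_cancel)
  then show "f $$ m = 0" using \<open>m < n\<close> assms(2) by simp
next
  show "f $$ n = c" using assms by (simp add: leads_def)
qed

lemma fls_deriv_powi:
  assumes "(f :: complex fls) \<noteq> 0"
  shows "fls_deriv (f powi n) = of_int n * f powi (n - 1) * fls_deriv f"
proof (cases "n \<ge> 0")
  case True
  then show ?thesis
    using assms by (cases "n = 0") (auto simp: power_int_def fls_deriv_power nat_diff_distrib)
next
  case False
  define k where "k = nat (- n)"
  have n: "n = - int k" using False by (simp add: k_def)
  have k: "k > 0" using False by (simp add: k_def)
  have "fls_deriv (f ^ k * f powi n) = 0" using assms by (simp add: n power_int_minus)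
  then have "f ^ k * fls_deriv (f powi n) = - (of_nat k * f ^ (k - 1) * fls_deriv f * f powi n)"
    by (simp add: fls_deriv_power eq_neg_iff_add_eq_0)
  then have "fls_deriv (f powi n) = - (of_nat k * f ^ (k - 1) * fls_deriv f * f powi n) / f ^ k"
    using assms by (simp add: field_simps)
  also have "\<dots> = of_int n * f powi (n - 1) * fls_deriv f"
    using assms k by (cases k) (auto simp: n power_int_minus power_int_diff power2_eq_square field_simps)
  finally show ?thesis .
qed

section \<open>Substituting a series into an exponential factor\<close>

text \<open>One form for two series at \<open>z_a = T ^ R\<close>: weight 1 and \<open>j = 0\<close>
  give \<open>q\<close>, while \<open>w k = - \<epsilon> * k\<close> and
  \<open>j = - \<epsilon> * R\<close> give \<open>dq/dz\<close>, with \<open>\<epsilon> = 1\<close>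
  at a finite point and \<open>\<epsilon> = - 1\<close> at infinity.\<close>

definition ev :: "nat \<Rightarrow> (rat \<Rightarrow> complex) \<Rightarrow> int \<Rightarrow> ef \<Rightarrow> complex fls \<Rightarrow> complex fls" where
  "ev R w j q T = (\<Sum>k \<in> Poly_Mapping.keys q. fls_const (w k * coef q k) * T powi (j - expo R k))"

lemma ev_superset:
  assumes "finite A" "Poly_Mapping.keys q \<subseteq> A"
  shows "ev R w j q T = (\<Sum>k \<in> A. fls_const (w k * coef q k) * T powi (j - expo R k))"
  unfolding ev_def by (rule sum.mono_neutral_left) (use assms in \<open>auto simp: in_keys_iff\<close>)

lemma ev_diff: "ev R w j (p - q) T = ev R w j p T - ev R w j q T"
proof -
  define A where "A = Poly_Mapping.keys p \<union> Poly_Mapping.keys q"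
  have A: "finite A" "Poly_Mapping.keys p \<subseteq> A" "Poly_Mapping.keys q \<subseteq> A" by (auto simp: A_def)
  have "Poly_Mapping.keys (p - q) \<subseteq> A" by (auto simp: A_def in_keys_iff lookup_minus)
  with A show ?thesis
    by (simp add: ev_superset[of A] lookup_minus right_diff_distrib left_diff_distrib
        flip: fls_minus_const sum_subtractf)
qed

lemma ev_0 [simp]: "ev R w j 0 T = 0"
  by (simp add: ev_def)

lemma ev_change_cover:
  assumes "covers r q" "0 < m"
  shows "ev (r * m) w (j * int m) q T = ev r w j q (T ^ m)"
  unfolding ev_def
proof (intro sum.cong refl)
  fix k assume "k \<in> Poly_Mapping.keys q"
  then have k: "coef q k \<noteq> 0" by (simp add: in_keys_iff)
  have "(of_int (expo (r * m) k) :: rat) = of_int (int m * expo r k)"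
    using of_int_expo[OF assms(1) k] of_int_expo[OF covers_mult[OF assms(1)] k, of m] by simp
  then have "expo (r * m) k = int m * expo r k" by (simp only: of_int_eq_iff)
  then have "j * int m - expo (r * m) k = int m * (j - expo r k)" by (simp add: algebra_simps)
  then show "fls_const (w k * coef q k) * T powi (j * int m - expo (r * m) k) =
      fls_const (w k * coef q k) * (T ^ m) powi (j - expo r k)"
    by (simp only: power_int_mult power_int_of_nat)
qed

text \<open>Conjugating the factor amounts to rotating the uniformizer. The extra exponent is a
  multiple of \<open>R\<close>, so the root of unity drops out of it.\<close>

lemma ev_act:
  assumes "\<omega> \<in> roots R" "0 < R"
  shows "ev R w (int R * j) (act R \<omega> q) T = ev R w (int R * j) q (fls_const \<omega> * T)"
  unfolding ev_def keys_act[OF roots_nonzero[OF assms(2,1)]]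
proof (intro sum.cong refl)
  fix k
  have "(fls_const \<omega> * T) powi (int R * j - expo R k) = fls_const (\<omega> powi (int R * j - expo R k)) * T powi (int R * j - expo R k)"
    by (simp add: power_int_mult_distrib fls_const_power_int)
  also have "\<omega> powi (int R * j - expo R k) = \<omega> powi (- expo R k)"
    using power_int_add[of \<omega> "int R * j" "- expo R k"] roots_powi[OF assms(1)] roots_nonzero[OF assms(2,1)] by simp
  finally show "fls_const (w k * coef (act R \<omega> q) k) * T powi (int R * j - expo R k) =
        fls_const (w k * coef q k) * (fls_const \<omega> * T) powi (int R * j - expo R k)"
    by (simp add: coef_act mult_ac flip: fls_const_mult_const)
qed

lemma expo_slope: "covers R q \<Longrightarrow> q \<noteq> 0 \<Longrightarrow> of_int (expo R (slope q)) = of_nat R * slope q"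
  using of_int_expo slope_mem by blast

lemma expo_less_slope:
  assumes "covers R q" "0 < R" "coef q k \<noteq> 0" "k \<noteq> slope q"
  shows "expo R k < expo R (slope q)"
proof -
  have "k < slope q" using assms slope_ge by force
  moreover have "q \<noteq> 0" using assms by auto
  ultimately have "(of_int (expo R k) :: rat) < of_int (expo R (slope q))"
    using assms by (simp add: of_int_expo expo_slope)
  then show ?thesis by simp
qed

text \<open>As \<open>T\<close> has a simple zero, the largest exponent of \<open>q\<close> gives
  the term of lowest order.\<close>

lemma leads_ev:
  assumes "covers R q" "0 < R" "q \<noteq> 0" "leads T 1 \<theta>" "\<theta> \<noteq> 0"
  shows "leads (ev R w j q T) (j - expo R (slope q))
           (w (slope q) * coef q (slope q) * \<theta> powi (j - expo R (slope q)))"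
proof -
  let ?n = "j - expo R (slope q)" and ?c = "w (slope q) * coef q (slope q) * \<theta> powi (j - expo R (slope q))"
  \<comment> \<open>All other terms start strictly later and enter with coefficient 0 at this
    order.\<close>
  have "leads (ev R w j q T) ?n (\<Sum>k \<in> Poly_Mapping.keys q. if k = slope q then ?c else 0)"
    unfolding ev_def
  proof (rule leads_sum)
    fix k assume "k \<in> Poly_Mapping.keys q"
    then have k: "coef q k \<noteq> 0" by (simp add: in_keys_iff)
    have *: "leads (fls_const (w k * coef q k) * T powi (j - expo R k)) (j - expo R k) (w k * coef q k * \<theta> powi (j - expo R k))"
      using leads_mult[OF leads_const leads_powi[OF assms(4,5)], of "w k * coef q k" "j - expo R k"] by simp
    show "leads (fls_const (w k * coef q k) * T powi (j - expo R k)) ?n (if k = slope q then ?c else 0)"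
      using * expo_less_slope[OF assms(1,2) k] by (auto intro: leads_mono)
  qed
  also have "(\<Sum>k \<in> Poly_Mapping.keys q. if k = slope q then ?c else 0) = ?c"
    using slope_mem[OF assms(3)] by (simp add: in_keys_iff)
  finally show ?thesis .
qed

text \<open>First variation of \<open>ev\<close> in its argument; again only the top exponent
  counts. In the application \<open>N = \<delta> * S\<close>, so the factor \<open>N\<close> in the
  coefficient is nonzero there.\<close>

lemma leads_ev_diff:
  fixes j :: int
  assumes "covers R q" "0 < R" "q \<noteq> 0" "leads T 1 \<theta>" "leads T' 1 \<theta>" "\<theta> \<noteq> 0" "leads (T - T') m h"
  defines "N \<equiv> j - expo R (slope q)"
  shows "leads (ev R w j q T - ev R w j q T') (N - 1 + m)
           (w (slope q) * coef q (slope q) * (of_int N * \<theta> powi (N - 1) * h))"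
proof -
  let ?c = "w (slope q) * coef q (slope q) * (of_int N * \<theta> powi (N - 1) * h)"
  have "leads (ev R w j q T - ev R w j q T') (N - 1 + m) (\<Sum>k \<in> Poly_Mapping.keys q. if k = slope q then ?c else 0)"
    unfolding ev_def sum_subtractf[symmetric] right_diff_distrib[symmetric]
  proof (rule leads_sum)
    fix k assume "k \<in> Poly_Mapping.keys q"
    then have k: "coef q k \<noteq> 0" by (simp add: in_keys_iff)
    let ?f = "fls_const (w k * coef q k) * (T powi (j - expo R k) - T' powi (j - expo R k))"
    have *: "leads ?f (j - expo R k - 1 + m)
        (w k * coef q k * (of_int (j - expo R k) * \<theta> powi (j - expo R k - 1) * h))"
      using leads_mult[OF leads_const leads_powi_diff[OF assms(4-7)], of "w k * coef q k" "j - expo R k"] by simp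
    show "leads ?f (N - 1 + m) (if k = slope q then ?c else 0)"
      using * expo_less_slope[OF assms(1,2) k] by (auto simp: N_def intro: leads_mono)
  qed
  also have "(\<Sum>k \<in> Poly_Mapping.keys q. if k = slope q then ?c else 0) = ?c"
    using slope_mem[OF assms(3)] by (simp add: in_keys_iff)
  finally show ?thesis .
qed

text \<open>Both \<open>u \<mapsto> c * u\<close> and \<open>u \<mapsto> u ^ m\<close> act on Laurent series by ring endomorphisms fixing the constants.\<close>

lemma ev_hom:
  fixes h :: "complex fls \<Rightarrow> complex fls"
  assumes "\<And>f g. h (f + g) = h f + h g" "\<And>f g. h (f * g) = h f * h g"
    and "\<And>f n. h (f powi n) = h f powi n" "\<And>c. h (fls_const c) = fls_const c"
  shows "h (ev R w j q T) = ev R w j q (h T)"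
proof -
  have "h 0 = 0" using assms(4)[of 0] by simp
  then have "h (sum f A) = (\<Sum>i\<in>A. h (f i))" for f :: "rat \<Rightarrow> complex fls" and A
    by (induction A rule: infinite_finite_induct) (auto simp: assms(1))
  then show ?thesis by (simp add: ev_def assms)
qed

lemma fls_compose_power_powi:
  assumes "0 < d"
  shows "fls_compose_power (f powi n :: complex fls) d = fls_compose_power f d powi n"
proof -
  have *: "fls_compose_power (inverse f) d = inverse (fls_compose_power f d)" for f :: "complex fls"
  proof (cases "f = 0")
    case False
    have "fls_compose_power (inverse f) d * fls_compose_power f d = fls_compose_power (inverse f * f) d"
      by simp
    also have "\<dots> = 1" using False assms by simp
    finally show ?thesis by (metis inverse_unique mult.commute)
  qed simp
  show ?thesis by (simp add: power_int_def * assms)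
qed

lemma ev_compose_power: "0 < d \<Longrightarrow> fls_compose_power (ev R w j q T) d = ev R w j q (fls_compose_power T d)"
  by (rule ev_hom) (simp_all add: fls_compose_power_powi)

lemma ev_compose_fps:
  "H \<noteq> 0 \<Longrightarrow> fps_nth H 0 = 0 \<Longrightarrow> fls_compose_fps (ev R w j q T) H = ev R w j q (fls_compose_fps T H)"
  by (rule ev_hom) (simp_all add: fls_compose_fps_add fls_compose_fps_mult fls_compose_fps_powi)

lemma leads_compose_power:
  assumes "leads f n c" "0 < d"
  shows "leads (fls_compose_power f d) (int d * n) c"
  using assms by (auto simp: leads_def fls_nth_compose_power elim!: dvdE)

section \<open>Roots and existence of solutions\<close>

lemma fps_root:
  fixes F :: "complex fps"
  assumes "0 < n" "fps_nth F 0 \<noteq> 0"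
  shows "\<exists>G. G ^ n = F \<and> fps_nth G 0 \<noteq> 0"
proof -
  obtain z where z: "z ^ n = fps_nth F 0" using ex_root[OF assms(1)] by blast
  define G where "G = fps_radical (\<lambda>_ _. z) n F"
  obtain k where k: "n = Suc k" using assms(1) by (cases n) auto
  have "G ^ n = F" unfolding G_def k using power_radical[OF assms(2), of "\<lambda>_ _. z" k] z k by simp
  moreover have "fps_nth G 0 = z" using assms(1) by (simp add: G_def)
  ultimately show ?thesis using z assms by (auto intro!: exI[of _ G] simp: zero_power)
qed

text \<open>The series is \<open>fls_X ^ n\<close> times a unit, and the unit has an
  \<open>n\<close>-th root.\<close>

lemma fls_root:
  assumes "0 < n" "leads f (int n) c" "c \<noteq> 0"
  shows "\<exists>W \<theta>. W ^ n = f \<and> leads W 1 \<theta> \<and> \<theta> \<noteq> 0"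
proof -
  obtain F where F: "f = fls_shift (- int n) (fps_to_fls F)" "fps_nth F 0 = c"
    using assms(2) by (auto simp: leads_fps)
  obtain G where G: "G ^ n = F" "fps_nth G 0 \<noteq> 0" using fps_root[of n F] assms F by auto
  have "(fls_X * fps_to_fls G) ^ n = f"
    by (simp add: power_mult_distrib F flip: G fps_to_fls_power) (simp add: fls_X_power_times_conv_shift)
  moreover have "leads (fls_X * fps_to_fls G) 1 (fps_nth G 0)"
    using leads_mult[OF leads_X, of "fps_to_fls G" 0 "fps_nth G 0"] by (simp add: leads_def)
  ultimately show ?thesis using G by blast
qed

lemma leads_1_fps:
  assumes "leads W 1 \<theta>" "\<theta> \<noteq> 0"
  shows "\<exists>H. W = fps_to_fls H \<and> fps_nth H 0 = 0 \<and> fps_nth H 1 = \<theta> \<and> H \<noteq> 0"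
proof -
  have "W = fps_to_fls (fls_regpart W)"
    using assms(1) by (intro fls_eqI) (simp add: leads_def)
  moreover have "fps_nth (fls_regpart W) 0 = 0" "fps_nth (fls_regpart W) 1 = \<theta>"
    using assms by (auto simp: leads_def)
  ultimately show ?thesis using assms by (metis fps_zero_nth)
qed

text \<open>Local normal form: \<open>f\<close> is the \<sigma>-th power of a series
  \<open>W\<close> with a simple zero, and the compositional inverse of \<open>W\<close> straightens
  it to a pure power.\<close>

lemma ex_substitution:
  assumes "leads f \<sigma> c" "c \<noteq> 0" "\<sigma> \<noteq> 0"
  shows "\<exists>H. fps_nth H 0 = 0 \<and> fps_nth H 1 \<noteq> 0 \<and> fls_compose_fps f H = fls_X powi \<sigma>"
proof -
  define n where "n = nat \<bar>\<sigma>\<bar>"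
  have n: "n > 0" "int n = \<bar>\<sigma>\<bar>" using assms(3) by (auto simp: n_def)
  \<comment> \<open>For a pole the root is extracted from the inverse, so that one root lemma serves
    both signs.\<close>
  define g where "g = (if \<sigma> > 0 then f else inverse f)"
  define d where "d = (if \<sigma> > 0 then c else inverse c)"
  have "leads g (int n) d" "d \<noteq> 0"
    using assms leads_inverse[of f \<sigma> c] by (auto simp: g_def n d_def)
  then obtain W \<theta> where W: "W ^ n = g" "leads W 1 \<theta>" "\<theta> \<noteq> 0"
    using fls_root[OF n(1)] by blast
  have f: "f = W powi \<sigma>"
  proof (cases "\<sigma> > 0")
    case True
    with W(1) show ?thesis by (simp add: g_def n_def power_int_def)
  next
    case False
    with W(1) have "W ^ n = inverse f" "nat (- \<sigma>) = n" by (simp_all add: g_def n_def)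
    with False assms(3) show ?thesis by (simp add: power_int_def power_inverse)
  qed
  obtain K where K: "W = fps_to_fls K" "fps_nth K 0 = 0" "fps_nth K 1 = \<theta>" "K \<noteq> 0"
    using leads_1_fps[OF W(2,3)] by blast
  define H where "H = fps_inv K"
  have KH: "K oo H = fps_X" using fps_inv_right[of K] K W(3) by (simp add: H_def)
  have H0: "fps_nth H 0 = 0" by (simp add: H_def fps_inv_def)
  have H1: "fps_nth H 1 \<noteq> 0" using K W(3) by (simp add: H_def fps_inv_def)
  have "H \<noteq> 0" using H1 by auto
  have "fls_compose_fps f H = fls_X powi \<sigma>"
    using \<open>H \<noteq> 0\<close> H0 by (simp add: f fls_compose_fps_powi K(1) KH)
  with H0 H1 show ?thesis by blast
qed

section \<open>Polar parts\<close>

lemma lookup_polar_ef: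
  assumes "0 < S"
  shows "coef (polar_ef S L) k = (if 0 < k \<and> of_nat S * k \<in> \<int> then L $$ (- expo S k) else 0)"
proof (cases "0 < k \<and> of_nat S * k \<in> \<int>")
  case True
  then obtain n where n: "of_nat S * k = of_int n" by (auto elim: Ints_cases)
  have "(of_int n :: rat) > 0" using True assms by (simp flip: n)
  then have "n > 0" by simp
  define m where "m = nat n"
  have m: "m > 0" "k = of_nat m / of_nat S" "expo S k = int m"
    using n \<open>n > 0\<close> assms by (auto simp: m_def expo_def field_simps)
  have "coef (polar_ef S L) k = (\<Sum>i = 1..nat (- fls_subdegree L). if i = m then L $$ (- int m) else 0)"
    unfolding polar_ef_def lookup_sum
    using assms by (intro sum.cong) (auto simp: lookup_single m when_def)
  also have "\<dots> = L $$ (- int m)"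
    using m(1) by (auto intro!: fls_eq0_below_subdegree[symmetric])
  finally show ?thesis using True m by simp
next
  case False
  have "of_nat m / of_nat S \<noteq> k" if "1 \<le> m" for m
  proof
    assume "of_nat m / of_nat S = k"
    then have "of_nat S * k = of_nat m" "0 < k" using assms that by auto
    with False show False by (metis Ints_of_nat)
  qed
  then have "coef (polar_ef S L) k = 0"
    unfolding polar_ef_def lookup_sum by (intro sum.neutral) (auto simp: lookup_single when_def)
  with False show ?thesis by auto
qed

lemma exp_factor_polar_ef: "0 < S \<Longrightarrow> exp_factor (polar_ef S L)"
  and covers_polar_ef: "0 < S \<Longrightarrow> covers S (polar_ef S L)"
  by (auto simp: exp_factor_iff covers_def lookup_polar_ef split: if_splits)

lemma polar_ef_diff: "0 < S \<Longrightarrow> polar_ef S (L - L') = polar_ef S L - polar_ef S L'"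
  by (rule poly_mapping_eqI) (simp add: lookup_minus lookup_polar_ef)

lemma polar_ef_leads:
  assumes "0 < S" "leads L (- int e) c" "0 < e" "c \<noteq> 0"
  shows "slope (polar_ef S L) = of_nat e / of_nat S" "coef (polar_ef S L) (of_nat e / of_nat S) = c"
proof -
  have e: "expo S (of_nat e / of_nat S) = int e" using assms(1) by (simp add: expo_def)
  show *: "coef (polar_ef S L) (of_nat e / of_nat S) = c"
    using assms by (simp add: lookup_polar_ef e leads_def)
  show "slope (polar_ef S L) = of_nat e / of_nat S"
  proof (rule slope_eqI)
    fix j :: rat assume j: "of_nat e / of_nat S < j"
    show "coef (polar_ef S L) j = 0"
    proof (cases "0 < j \<and> of_nat S * j \<in> \<int>")
      case True
      then obtain n where n: "of_nat S * j = of_int n" by (auto elim: Ints_cases)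
      have "of_nat e < of_nat S * j" using j assms(1) by (simp add: field_simps)
      then have "of_int (int e) < (of_int n :: rat)" by (simp add: n)
      then have "int e < n" by (simp only: of_int_less_iff)
      moreover have "expo S j = n" by (simp add: expo_def n)
      ultimately show ?thesis using assms(1,2) by (simp add: lookup_polar_ef leads_def)
    qed (auto simp: lookup_polar_ef assms(1))
  qed (use * assms in simp)
qed

text \<open>Under \<open>u = v ^ m\<close> one has \<open>\<xi>_b = u ^ S = v ^ (S * m)\<close>:
  exponents in \<open>\<xi>_b\<close> are unchanged, and powers of \<open>v\<close> not divisible by
  \<open>m\<close> do not occur.\<close>

lemma polar_ef_compose_power:
  assumes "0 < S" "0 < m"
  shows "polar_ef (S * m) (fls_compose_power L m) = polar_ef S L"
proof (rule poly_mapping_eqI)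
  fix k
  show "coef (polar_ef (S * m) (fls_compose_power L m)) k = coef (polar_ef S L) k"
  proof (cases "0 < k \<and> of_nat (S * m) * k \<in> \<int>")
    case True
    then obtain n where n: "of_nat (S * m) * k = of_int n" by (auto elim: Ints_cases)
    show ?thesis
    proof (cases "int m dvd n")
      case True
      then obtain i where i: "n = int m * i" by (auto elim: dvdE)
      then have "of_nat m * (of_nat S * k) = (of_nat m * of_int i :: rat)" using n by (simp add: mult_ac)
      then have "of_nat S * k = of_int i" using assms(2) by simp
      moreover have "expo (S * m) k = n" by (simp only: expo_def n floor_of_int)
      moreover have "(- (int m * i)) div int m = - i"
        using assms(2) by (metis mult_minus_right nonzero_mult_div_cancel_left of_nat_0_eq_iff less_irrefl)
      ultimately show ?thesis using assms i True n
        by (simp add: lookup_polar_ef fls_nth_compose_power expo_def del: of_nat_mult)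
    next
      case False
      have "of_nat S * k \<notin> \<int>"
      proof
        assume "of_nat S * k \<in> \<int>"
        then obtain i where "of_nat S * k = of_int i" by (auto elim: Ints_cases)
        moreover have "(of_int n :: rat) = of_nat m * (of_nat S * k)" by (simp add: mult_ac flip: n)
        ultimately have "(of_int n :: rat) = of_int (int m * i)" by simp
        then have "n = int m * i" by (simp only: of_int_eq_iff)
        with False show False by simp
      qed
      moreover have "expo (S * m) k = n" by (simp only: expo_def n floor_of_int)
      ultimately show ?thesis using assms n False
        by (simp add: lookup_polar_ef fls_nth_compose_power del: of_nat_mult)
    qed
  next
    case False
    have "of_nat (S * m) * k \<in> \<int>" if "of_nat S * k \<in> \<int>"
      using Ints_mult[OF Ints_of_nat[of m] that] by (simp add: mult_ac)
    with False assms show ?thesis by (auto simp: lookup_polar_ef)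
  qed
qed

lemma polar_ef_rotate:
  assumes "0 < S" "\<zeta> \<noteq> 0"
  shows "polar_ef S (fls_compose_fps L (fps_const \<zeta> * fps_X)) = act S \<zeta> (polar_ef S L)"
  by (rule poly_mapping_eqI)
     (use assms in \<open>simp add: lookup_polar_ef coef_act fls_nth_fls_compose_fps_linear\<close>)

section \<open>The Legendre transform in uniformizers\<close>

text \<open>Write \<open>z_a = t ^ R\<close> and \<open>\<xi>_b = u ^ S\<close> with \<open>R\<close> any multiple of the ramification, and \<open>\<epsilon>\<close>, \<open>\<delta>\<close>
  for \<open>1\<close> at a finite point and \<open>- 1\<close> at infinity, so that \<open>z\<close> and \<open>\<xi>\<close> are, up to constants,
  \<open>t powi (\<epsilon> * R)\<close> and \<open>u powi (\<delta> * S)\<close>. All cases of the transform then read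
  \<open>\<epsilon> * R + \<delta> * S + R * slope q = 0\<close>, which is symmetric under exchanging the two sides.\<close>

definition solves :: "nat \<Rightarrow> int \<Rightarrow> nat \<Rightarrow> int \<Rightarrow> ef \<Rightarrow> complex \<Rightarrow> complex fls \<Rightarrow> bool" where
  "solves R \<epsilon> S \<delta> q \<theta> T \<longleftrightarrow>
     exp_factor q \<and> q \<noteq> 0 \<and> covers R q \<and> 0 < R \<and> 0 < S \<and> \<bar>\<epsilon>\<bar> = 1 \<and> \<bar>\<delta>\<bar> = 1 \<and>
     \<epsilon> * int R + \<delta> * int S + expo R (slope q) = 0 \<and> leads T 1 \<theta> \<and> \<theta> \<noteq> 0 \<and>
     ev R (\<lambda>k. - of_int \<epsilon> * of_rat k) (int R * - \<epsilon>) q T = fls_X powi (\<delta> * int S)"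

text \<open>The expression \<open>q - \<xi> * z\<close> without the constants. A finite source
  \<open>a\<close> would add the term \<open>- a * \<xi>\<close>; at a finite target \<alpha> the
  local coordinate is \<open>\<xi> - \<alpha>\<close>, which absorbs the linear term
  \<open>\<alpha> * z\<close>.\<close>

definition legf :: "nat \<Rightarrow> int \<Rightarrow> nat \<Rightarrow> int \<Rightarrow> ef \<Rightarrow> complex fls \<Rightarrow> complex fls" where
  "legf R \<epsilon> S \<delta> q T = ev R (\<lambda>_. 1) 0 q T - fls_X powi (\<delta> * int S) * T powi (\<epsilon> * int R)"

lemma powi_eq_1_imp_root:
  assumes "z powi (\<delta> * int S) = 1" "\<bar>\<delta>\<bar> = 1"
  shows "(z :: complex) \<in> roots S"
proof -
  consider "\<delta> = 1" | "\<delta> = - 1" using assms(2) by linarith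
  then show ?thesis using assms(1) by cases (auto simp: roots_def power_int_minus)
qed

lemma expo_slope_pos:
  assumes "exp_factor q" "q \<noteq> 0" "covers R q" "0 < R"
  shows "0 < expo R (slope q)"
proof -
  have "0 < (of_int (expo R (slope q)) :: rat)"
    using assms slope_pos by (simp add: expo_slope)
  then show ?thesis by simp
qed

text \<open>Envelope property of the Legendre transform: by \<open>dq/dz = \<xi>\<close> the
  derivative of \<open>q\<close> along \<open>T\<close> cancels the summand of the product rule in
  which \<open>z\<close> is differentiated. Only \<open>- z * d\<xi>/du\<close> remains.\<close>

lemma solves_deriv:
  assumes "solves R \<epsilon> S \<delta> q \<theta> T"
  shows "fls_deriv (legf R \<epsilon> S \<delta> q T) =
           fls_const (- of_int (\<delta> * int S)) * (fls_X powi (\<delta> * int S - 1) * T powi (\<epsilon> * int R))"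
proof -
  have *: "covers R q" "\<bar>\<epsilon>\<bar> = 1" "T \<noteq> 0"
      "ev R (\<lambda>k. - of_int \<epsilon> * of_rat k) (int R * - \<epsilon>) q T = fls_X powi (\<delta> * int S)"
    using assms by (auto simp: solves_def dest: leads_nonzero)
  let ?\<rho> = "\<epsilon> * int R" and ?\<sigma> = "\<delta> * int S"
  have "fls_deriv (ev R (\<lambda>_. 1) 0 q T) =
      (\<Sum>k \<in> Poly_Mapping.keys q. of_int ?\<rho> * (fls_const (- of_int \<epsilon> * of_rat k * coef q k) * T powi (int R * - \<epsilon> - expo R k)) *
        (T powi (?\<rho> - 1) * fls_deriv T))"
    unfolding ev_def fls_deriv_sum
  proof (rule sum.cong[OF refl])
    fix k assume "k \<in> Poly_Mapping.keys q"
    then have k: "coef q k \<noteq> 0" by (simp add: in_keys_iff)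
    have "(of_int \<epsilon> * of_int \<epsilon> :: complex) = 1"
      using *(2) by (cases "\<epsilon> = 1") (auto simp: abs_if split: if_splits)
    moreover have "(of_int (expo R k) :: complex) = of_nat R * of_rat k"
      using arg_cong[OF of_int_expo[OF *(1) k], of "of_rat :: rat \<Rightarrow> complex"] by (simp add: of_rat_mult)
    \<comment> \<open>The exponent of \<open>T\<close> splits into the factor
      \<open>\<epsilon> * R\<close> from \<open>dz/du\<close> and the weight
      \<open>- \<epsilon> * k\<close> from \<open>dq/dz\<close>, since \<epsilon> squares to 1. This
      is the chain rule term by term.\<close>
    ultimately have c: "of_int (- expo R k) = (of_int ?\<rho> * (- of_int \<epsilon> * of_rat k) :: complex)"
      by (simp add: mult_ac)
    have "fls_deriv (fls_const (1 * coef q k) * T powi (0 - expo R k)) =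
        fls_const (of_int (- expo R k) * coef q k) * T powi (- expo R k - 1) * fls_deriv T"
      using *(3) by (simp add: fls_deriv_powi fls_of_int mult_ac flip: fls_const_mult_const)
    also have "\<dots> = fls_const (of_int ?\<rho>) * fls_const (- of_int \<epsilon> * of_rat k * coef q k) * T powi (- expo R k - 1) * fls_deriv T"
      unfolding c by (simp add: mult_ac)
    also have "T powi (- expo R k - 1) = T powi (int R * - \<epsilon> - expo R k) * T powi (?\<rho> - 1)"
    proof -
      have "- expo R k - 1 = (int R * - \<epsilon> - expo R k) + (?\<rho> - 1)" by simp
      then show ?thesis using *(3) power_int_add[of T "int R * - \<epsilon> - expo R k" "?\<rho> - 1"] by presburger
    qed
    finally show "fls_deriv (fls_const (1 * coef q k) * T powi (0 - expo R k)) =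
        of_int ?\<rho> * (fls_const (- of_int \<epsilon> * of_rat k * coef q k) * T powi (int R * - \<epsilon> - expo R k)) *
        (T powi (?\<rho> - 1) * fls_deriv T)"
      by (simp add: fls_of_int mult_ac)
  qed
  also have "\<dots> = of_int ?\<rho> * fls_X powi ?\<sigma> * (T powi (?\<rho> - 1) * fls_deriv T)"
    unfolding *(4)[symmetric] ev_def sum_distrib_left sum_distrib_right ..
  finally have "fls_deriv (ev R (\<lambda>_. 1) 0 q T) = of_int ?\<rho> * fls_X powi ?\<sigma> * (T powi (?\<rho> - 1) * fls_deriv T)" .
  moreover have "fls_deriv (fls_X powi ?\<sigma> :: complex fls) = of_int ?\<sigma> * fls_X powi (?\<sigma> - 1)"
    using fls_deriv_powi[of fls_X ?\<sigma>] by simp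
  ultimately show ?thesis
    using *(3) by (simp add: legf_def fls_deriv_powi fls_of_int algebra_simps)
qed

text \<open>Comparison of the leading terms in \<open>dq/dz = \<xi>\<close>. Hence the top
  coefficient of \<open>q\<close> determines \<theta> up to an \<open>S\<close>-th root of
  unity.\<close>

lemma solves_lead:
  assumes "solves R \<epsilon> S \<delta> q \<theta> T"
  shows "- of_int \<epsilon> * of_rat (slope q) * coef q (slope q) * \<theta> powi (\<delta> * int S) = 1"
proof -
  have *: "leads (ev R (\<lambda>k. - of_int \<epsilon> * of_rat k) (int R * - \<epsilon>) q T) (int R * - \<epsilon> - expo R (slope q))
      (- of_int \<epsilon> * of_rat (slope q) * coef q (slope q) * \<theta> powi (int R * - \<epsilon> - expo R (slope q)))"
    using assms by (intro leads_ev) (auto simp: solves_def)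
  have "int R * - \<epsilon> - expo R (slope q) = \<delta> * int S" using assms by (simp add: solves_def algebra_simps)
  with * assms have "leads (fls_X powi (\<delta> * int S)) (\<delta> * int S)
      (- of_int \<epsilon> * of_rat (slope q) * coef q (slope q) * \<theta> powi (\<delta> * int S))"
    unfolding solves_def by metis
  with leads_X_powi[of "\<delta> * int S"] show ?thesis unfolding leads_def by metis
qed

text \<open>Integration of \<open>- z * d\<xi>/du\<close>, whose order is \<open>- D - 1\<close> by
  the balance relation in \<open>solves\<close>. Mirror image of \<open>solves_lead\<close>: the top
  coefficient of the transform determines \<theta> up to an \<open>R\<close>-th root of
  unity.\<close>

lemma solves_legf_leads:
  assumes "solves R \<epsilon> S \<delta> q \<theta> T"
  defines "D \<equiv> expo R (slope q)"
  shows "leads (legf R \<epsilon> S \<delta> q T) (- D) (of_int (\<delta> * int S) / of_int D * \<theta> powi (\<epsilon> * int R))"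
proof (rule leads_of_deriv)
  have D: "D > 0" using assms expo_slope_pos by (auto simp: solves_def)
  then show "- D < 0" by simp
  have "leads (fls_const (- of_int (\<delta> * int S)) * (fls_X powi (\<delta> * int S - 1) * T powi (\<epsilon> * int R)))
      (0 + (\<delta> * int S - 1 + \<epsilon> * int R * 1)) (- of_int (\<delta> * int S) * (1 * \<theta> powi (\<epsilon> * int R)))"
    using assms by (intro leads_mult leads_const leads_X_powi leads_powi) (auto simp: solves_def)
  moreover have "0 + (\<delta> * int S - 1 + \<epsilon> * int R * 1) = - D - 1" using assms by (simp add: solves_def)
  moreover have "- of_int (\<delta> * int S) * (1 * \<theta> powi (\<epsilon> * int R)) =
      of_int (- D) * (of_int (\<delta> * int S) / of_int D * \<theta> powi (\<epsilon> * int R))" using D by simp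
  ultimately show "leads (fls_deriv (legf R \<epsilon> S \<delta> q T)) (- D - 1)
      (of_int (- D) * (of_int (\<delta> * int S) / of_int D * \<theta> powi (\<epsilon> * int R)))"
    unfolding solves_deriv[OF assms(1)] by metis
qed

text \<open>Solutions with the same leading coefficient differ first where \<open>q\<close> and \<open>q'\<close> do. Since
  \<open>dL/d\<xi> = - z\<close>, the order of the difference of the transforms can be read off \<open>T powi (\<epsilon> * R)\<close>.\<close>

lemma slope_diff_transform:
  assumes T: "solves R \<epsilon> S \<delta> q \<theta> T" and T': "solves R \<epsilon> S \<delta> q' \<theta> T'"
  shows "of_nat S * slope (polar_ef S (legf R \<epsilon> S \<delta> q T) - polar_ef S (legf R \<epsilon> S \<delta> q' T')) =
           of_nat R * slope (q - q')"
proof -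
  define w :: "rat \<Rightarrow> complex" where "w = (\<lambda>k. - of_int \<epsilon> * of_rat k)"
  have w: "w k \<noteq> 0" if "k > 0" for k using that T by (auto simp: w_def solves_def)
  let ?\<rho> = "\<epsilon> * int R" and ?\<sigma> = "\<delta> * int S" and ?j = "int R * - \<epsilon>"
  have q: "exp_factor q" "q \<noteq> 0" "covers R q" "0 < R" "0 < S" "leads T 1 \<theta>" "\<theta> \<noteq> 0"
      "ev R w ?j q T = fls_X powi ?\<sigma>"
    and q': "exp_factor q'" "q' \<noteq> 0" "covers R q'" "leads T' 1 \<theta>" "ev R w ?j q' T' = fls_X powi ?\<sigma>"
    and sum0: "?\<rho> + ?\<sigma> + expo R (slope q) = 0" and \<sigma>: "?\<sigma> \<noteq> 0" and \<rho>: "?\<rho> \<noteq> 0"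
    using T T' by (auto simp: solves_def w_def)
  have dq: "exp_factor (q' - q)" "covers R (q' - q)"
    using q q' by (simp_all add: exp_factor_diff covers_diff)
  have lead_diff: "leads (ev R w ?j (q' - q) T') (?j - expo R (slope (q' - q)))
      (w (slope (q' - q)) * coef (q' - q) (slope (q' - q)) * \<theta> powi (?j - expo R (slope (q' - q))))"
    and lead_nz: "w (slope (q' - q)) * coef (q' - q) (slope (q' - q)) * \<theta> powi (?j - expo R (slope (q' - q))) \<noteq> 0"
    if "q' \<noteq> q"
    using that q q' dq w[OF slope_pos[of "q' - q"]] slope_mem[of "q' - q"] by (auto intro!: leads_ev)
  show ?thesis
  proof (cases "T = T'")
    case True
    \<comment> \<open>A common solution means a common \<open>dq/dz\<close>, and factors without
      constant term are determined by their derivative.\<close>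
    have "q' = q"
    proof (rule ccontr)
      assume "q' \<noteq> q"
      moreover have "ev R w ?j (q' - q) T' = 0" using q q' True by (simp add: ev_diff)
      ultimately show False using lead_diff lead_nz by (simp add: leads_def)
    qed
    with True show ?thesis by simp
  next
    case False
    define m h where "m = fls_subdegree (T - T')" and "h = (T - T') $$ m"
    have h: "leads (T - T') m h" "h \<noteq> 0"
      using False subdegree_leads[of "T - T'"] nth_fls_subdegree_nonzero[of "T - T'"]
      unfolding m_def h_def by auto
    define N where "N = ?j - expo R (slope q)"
    have N: "N = ?\<sigma>" using sum0 by (simp add: N_def algebra_simps)
    define C where "C = w (slope q) * coef q (slope q) * (of_int N * \<theta> powi (N - 1) * h)"
    have "leads (ev R w ?j q T - ev R w ?j q T') (N - 1 + m) C"
      unfolding C_def N_def using q q' h by (intro leads_ev_diff) auto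
    \<comment> \<open>Both equations have the same right-hand side, so the variation of the solution
      balances \<open>q' - q\<close>. Equating the two orders expresses \<open>m\<close> through the
      slope of \<open>q' - q\<close>.\<close>
    moreover have "ev R w ?j q T - ev R w ?j q T' = ev R w ?j (q' - q) T'" using q q' by (simp add: ev_diff)
    ultimately have C: "leads (ev R w ?j (q' - q) T') (N - 1 + m) C" by simp
    have "C \<noteq> 0" using q w slope_pos[of q] slope_mem[of q] h \<sigma> by (auto simp: C_def N)
    with C have "q' \<noteq> q" by (auto simp: leads_def)
    define e where "e = expo R (slope (q' - q))"
    have e: "e > 0" using dq q \<open>q' \<noteq> q\<close> unfolding e_def by (intro expo_slope_pos) auto
    have "N - 1 + m = ?j - e"
      unfolding e_def using leads_unique(1)[OF C lead_diff \<open>C \<noteq> 0\<close> lead_nz] \<open>q' \<noteq> q\<close> by simp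
    then have m: "?\<sigma> - 1 + (?\<rho> - 1 + m) = - e - 1" by (simp add: N algebra_simps)
    let ?L = "legf R \<epsilon> S \<delta> q T - legf R \<epsilon> S \<delta> q' T'"
    define c where "c = - of_int ?\<sigma> * (of_int ?\<rho> * \<theta> powi (?\<rho> - 1) * h)"
    have "fls_deriv ?L = fls_const (- of_int ?\<sigma>) * (fls_X powi (?\<sigma> - 1) * (T powi ?\<rho> - T' powi ?\<rho>))"
      unfolding fls_deriv_sub solves_deriv[OF T] solves_deriv[OF T'] by (simp add: algebra_simps)
    moreover have "leads \<dots> (0 + (?\<sigma> - 1 + (?\<rho> - 1 + m))) (- of_int ?\<sigma> * (1 * (of_int ?\<rho> * \<theta> powi (?\<rho> - 1) * h)))"
      using q q' h by (intro leads_mult leads_const leads_X_powi leads_powi_diff) auto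
    ultimately have "leads (fls_deriv ?L) (- e - 1) c" by (simp add: m c_def)
    then have "leads (fls_deriv ?L) (- e - 1) (of_int (- e) * (c / of_int (- e)))" using e by simp
    then have "leads ?L (- e) (c / of_int (- e))" by (rule leads_of_deriv) (use e in simp)
    then have *: "leads ?L (- int (nat e)) (c / of_int (- e))" using e by simp
    have "c / of_int (- e) \<noteq> 0" using e q h \<sigma> \<rho> by (auto simp: c_def)
    with e q have "slope (polar_ef S ?L) = of_nat (nat e) / of_nat S"
      by (intro polar_ef_leads(1)[OF _ *]) auto
    then have "of_nat S * slope (polar_ef S ?L) = of_int e" using e q by simp
    also have "\<dots> = of_nat R * slope (q' - q)"
      unfolding e_def using dq \<open>q' \<noteq> q\<close> by (intro expo_slope) auto
    finally show ?thesis using q slope_minus_commute[of q q'] by (simp add: polar_ef_diff)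
  qed
qed

text \<open>Since \<open>\<omega> ^ R = 1\<close> and \<open>\<zeta> ^ S = 1\<close>, rotating
  \<open>t\<close> and \<open>u\<close> leaves the relation between \<open>z\<close> and \<xi>
  intact and only relabels branches. The two rotations are independent, which gives the freedom to
  adjust the leading coefficient of a solution.\<close>

lemma solves_rotate:
  assumes T: "solves R \<epsilon> S \<delta> q \<theta> T" and \<omega>: "\<omega> \<in> roots R" and \<zeta>: "\<zeta> \<in> roots S"
  defines "T' \<equiv> fls_const (inverse \<omega>) * fls_compose_fps T (fps_const \<zeta> * fps_X)"
  shows "solves R \<epsilon> S \<delta> (act R \<omega> q) (\<theta> * \<zeta> / \<omega>) T'"
    and "polar_ef S (legf R \<epsilon> S \<delta> (act R \<omega> q) T') = act S \<zeta> (polar_ef S (legf R \<epsilon> S \<delta> q T))"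
proof -
  define H where "H = fps_const \<zeta> * fps_X"
  have q: "exp_factor q" "q \<noteq> 0" "covers R q" "0 < R" "0 < S" "leads T 1 \<theta>" "\<theta> \<noteq> 0"
    using T by (auto simp: solves_def)
  have nz: "\<omega> \<noteq> 0" "\<zeta> \<noteq> 0" using q \<omega> \<zeta> roots_nonzero by blast+
  have H: "H \<noteq> 0" "fps_nth H 0 = 0" using nz by (auto simp: H_def)
  have TH: "fls_const \<omega> * T' = fls_compose_fps T H"
    using nz by (simp add: T'_def H_def flip: mult.assoc)
  have ev': "ev R w (int R * j) (act R \<omega> q) T' = fls_compose_fps (ev R w (int R * j) q T) H" for w j
    by (simp only: ev_act[OF \<omega> q(4)] TH ev_compose_fps[OF H])
  have X: "fls_compose_fps (fls_X powi (\<delta> * int S)) H = fls_X powi (\<delta> * int S)"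
  proof -
    have "fls_compose_fps (fls_X powi (\<delta> * int S)) H = (fls_const \<zeta> * fls_X) powi (\<delta> * int S)"
      using H by (simp add: fls_compose_fps_powi H_def fls_times_fps_to_fls)
    also have "\<dots> = fls_const (\<zeta> powi (int S * \<delta>)) * fls_X powi (\<delta> * int S)"
      by (simp add: power_int_mult_distrib fls_const_power_int mult.commute)
    finally show ?thesis using roots_powi[OF \<zeta>] by simp
  qed
  have T'_lead: "leads T' 1 (\<theta> * \<zeta> / \<omega>)"
  proof -
    have "leads (fls_compose_fps T H) 1 (\<theta> * \<zeta>)"
      using q nz by (simp add: H_def leads_def fls_nth_fls_compose_fps_linear)
    from leads_mult[OF leads_const this, of "inverse \<omega>"] show ?thesis
      by (simp add: T'_def H_def field_simps)
  qed
  have keys: "Poly_Mapping.keys (act R \<omega> q) = Poly_Mapping.keys q" using nz by (simp add: keys_act)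
  then have "act R \<omega> q \<noteq> 0" using q(2) by (metis keys_eq_empty)
  moreover have "exp_factor (act R \<omega> q)" "covers R (act R \<omega> q)" "slope (act R \<omega> q) = slope q"
    using q nz by (simp_all add: exp_factor_act covers_act slope_act)
  ultimately show "solves R \<epsilon> S \<delta> (act R \<omega> q) (\<theta> * \<zeta> / \<omega>) T'"
    using T T'_lead nz unfolding solves_def by (simp only: ev' X) simp
  have "T' powi (\<epsilon> * int R) = (fls_const (inverse \<omega>)) powi (int R * \<epsilon>) * fls_compose_fps T H powi (\<epsilon> * int R)"
    by (simp add: T'_def H_def power_int_mult_distrib mult.commute)
  also have "(fls_const (inverse \<omega>)) powi (int R * \<epsilon>) = 1"
    using roots_powi[OF roots_inverse[OF \<omega>]] by (simp flip: fls_const_power_int)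
  finally have "legf R \<epsilon> S \<delta> (act R \<omega> q) T' = fls_compose_fps (legf R \<epsilon> S \<delta> q T) H"
    using ev'[of "\<lambda>_. 1" 0] H X
    by (simp add: legf_def fls_compose_fps_diff fls_compose_fps_mult fls_compose_fps_powi)
  then show "polar_ef S (legf R \<epsilon> S \<delta> (act R \<omega> q) T') = act S \<zeta> (polar_ef S (legf R \<epsilon> S \<delta> q T))"
    using q nz by (simp add: H_def polar_ef_rotate)
qed

text \<open>A relation rather than a function: \<open>T\<close> is unique only up to rotating
  \<open>u\<close>, hence \<open>p\<close> only up to conjugation.\<close>

definition dual :: "nat \<Rightarrow> int \<Rightarrow> nat \<Rightarrow> int \<Rightarrow> ef \<Rightarrow> ef \<Rightarrow> bool" where
  "dual R \<epsilon> S \<delta> q p \<longleftrightarrow> (\<exists>\<theta> T. solves R \<epsilon> S \<delta> q \<theta> T \<and> p = polar_ef S (legf R \<epsilon> S \<delta> q T))"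

lemma ex_dual:
  assumes "exp_factor q" "q \<noteq> 0" "covers R q" "0 < R" "0 < S" "\<bar>\<epsilon>\<bar> = 1" "\<bar>\<delta>\<bar> = 1"
    and "\<epsilon> * int R + \<delta> * int S + expo R (slope q) = 0"
  shows "\<exists>p. dual R \<epsilon> S \<delta> q p"
proof -
  let ?w = "\<lambda>k. - of_int \<epsilon> * of_rat k :: complex" and ?j = "int R * - \<epsilon>"
  let ?c = "?w (slope q) * coef q (slope q) * 1 powi (?j - expo R (slope q))"
  \<comment> \<open>At \<open>T = fls_X\<close> this series is \<open>dq/dz\<close> in the
    uniformizer \<open>t\<close> itself; the substitution that turns it into a pure power of
    \<open>u\<close> is the solution sought.\<close>
  have "leads (ev R ?w ?j q fls_X) (?j - expo R (slope q)) ?c"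
    using assms by (intro leads_ev leads_X) auto
  moreover have "?j - expo R (slope q) = \<delta> * int S" using assms(8) by (simp add: algebra_simps)
  moreover have "?c \<noteq> 0" using assms slope_pos[of q] slope_mem[of q] by auto
  moreover have "\<delta> * int S \<noteq> 0" using assms by auto
  ultimately obtain H where H: "fps_nth H 0 = 0" "fps_nth H 1 \<noteq> 0"
      "fls_compose_fps (ev R ?w ?j q fls_X) H = fls_X powi (\<delta> * int S)"
    using ex_substitution by metis
  have "H \<noteq> 0" using H by auto
  with H have "ev R ?w ?j q (fps_to_fls H) = fls_X powi (\<delta> * int S)"
    by (simp add: ev_compose_fps)
  moreover have "leads (fps_to_fls H) 1 (fps_nth H 1)" using H by (auto simp: leads_def)
  ultimately have "solves R \<epsilon> S \<delta> q (fps_nth H 1) (fps_to_fls H)"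
    using assms H unfolding solves_def by simp
  then show ?thesis unfolding dual_def by blast
qed

text \<open>With \<open>u\<close> replaced by \<open>v ^ m\<close>, the solution on the larger cover
  is an \<open>m\<close>-th root \<open>W\<close> of \<open>T (v ^ m)\<close>. It exists because
  that series has order \<open>m\<close>.\<close>

lemma dual_change_cover:
  assumes "dual r \<epsilon> s \<delta> q p" "0 < m"
  shows "dual (r * m) \<epsilon> (s * m) \<delta> q p"
proof -
  obtain \<theta> T where T: "solves r \<epsilon> s \<delta> q \<theta> T" and p: "p = polar_ef s (legf r \<epsilon> s \<delta> q T)"
    using assms(1) by (auto simp: dual_def)
  then have q: "covers r q" "q \<noteq> 0" "0 < r" "0 < s" "leads T 1 \<theta>" "\<theta> \<noteq> 0" by (auto simp: solves_def)
  define U where "U = fls_compose_power T m"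
  have "leads U (int m) \<theta>" using leads_compose_power[OF q(5) assms(2)] by (simp add: U_def)
  then obtain W \<eta> where W: "W ^ m = U" "leads W 1 \<eta>" "\<eta> \<noteq> 0"
    using fls_root[of m U \<theta>] assms(2) q by blast
  have ev': "ev (r * m) w (int (r * m) * j) q W = fls_compose_power (ev r w (int r * j) q T) m" for w j
    using ev_change_cover[OF q(1) assms(2), of w "int r * j" W]
    by (simp add: W(1) ev_compose_power[OF assms(2)] U_def mult_ac)
  have X: "fls_compose_power (fls_X powi (\<delta> * int s) :: complex fls) m = fls_X powi (\<delta> * int (s * m))"
  proof -
    have "fls_compose_power (fls_X powi (\<delta> * int s) :: complex fls) m = (fls_X powi int m) powi (\<delta> * int s)"
      by (simp only: fls_compose_power_powi[OF assms(2)] fls_compose_power_X[OF assms(2)] fls_X_power_int[symmetric])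
    then show ?thesis by (simp only: power_int_mult[symmetric]) (simp add: mult_ac)
  qed
  have "(of_int (expo (r * m) (slope q)) :: rat) = of_int (int m * expo r (slope q))"
    using expo_slope[OF q(1,2)] expo_slope[OF covers_mult[OF q(1)] q(2), of m] by simp
  then have e: "expo (r * m) (slope q) = int m * expo r (slope q)" by (simp only: of_int_eq_iff)
  have "\<epsilon> * int (r * m) + \<delta> * int (s * m) + expo (r * m) (slope q) =
      int m * (\<epsilon> * int r + \<delta> * int s + expo r (slope q))" unfolding e by (simp add: algebra_simps)
  with T have "\<epsilon> * int (r * m) + \<delta> * int (s * m) + expo (r * m) (slope q) = 0" by (simp add: solves_def)
  then have "solves (r * m) \<epsilon> (s * m) \<delta> q \<eta> W"
    using T assms(2) W covers_mult[OF q(1)] unfolding solves_def by (simp only: ev' X) simp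
  moreover have "W powi (\<epsilon> * int (r * m)) = fls_compose_power (T powi (\<epsilon> * int r)) m"
  proof -
    have "W powi (\<epsilon> * int (r * m)) = (W powi int m) powi (\<epsilon> * int r)"
      by (simp only: power_int_mult[symmetric]) (simp add: mult_ac)
    then show ?thesis using assms(2) by (simp add: W(1) U_def fls_compose_power_powi)
  qed
  then have "legf (r * m) \<epsilon> (s * m) \<delta> q W = fls_compose_power (legf r \<epsilon> s \<delta> q T) m"
    using ev'[of "\<lambda>_. 1" 0] by (simp only: legf_def X mult_zero_right fls_compose_power_diff fls_compose_power_mult)
  ultimately show ?thesis
    unfolding dual_def using p polar_ef_compose_power[OF q(4) assms(2)] by metis
qed

lemma dual_imp:
  assumes "dual R \<epsilon> S \<delta> q p"
  shows "exp_factor p" "covers S p" "p \<noteq> 0" "of_nat S * slope p = of_nat R * slope q"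
    and "exp_factor q" "covers R q" "q \<noteq> 0" "0 < R" "0 < S" "\<bar>\<epsilon>\<bar> = 1" "\<bar>\<delta>\<bar> = 1"
    and "\<epsilon> * int R + \<delta> * int S + expo R (slope q) = 0"
proof -
  obtain \<theta> T where T: "solves R \<epsilon> S \<delta> q \<theta> T" and p: "p = polar_ef S (legf R \<epsilon> S \<delta> q T)"
    using assms(1) by (auto simp: dual_def)
  then show q: "exp_factor q" "covers R q" "q \<noteq> 0" "0 < R" "0 < S" "\<bar>\<epsilon>\<bar> = 1" "\<bar>\<delta>\<bar> = 1"
      "\<epsilon> * int R + \<delta> * int S + expo R (slope q) = 0"
    by (auto simp: solves_def)
  show "exp_factor p" "covers S p" using q by (auto simp: p exp_factor_polar_ef covers_polar_ef)
  define D where "D = expo R (slope q)"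
  have D: "D > 0" using q by (simp add: D_def expo_slope_pos)
  have L: "leads (legf R \<epsilon> S \<delta> q T) (- int (nat D)) (of_int (\<delta> * int S) / of_int D * \<theta> powi (\<epsilon> * int R))"
    using solves_legf_leads[OF T] D by (simp add: D_def)
  have "of_int (\<delta> * int S) / of_int D * \<theta> powi (\<epsilon> * int R) \<noteq> 0"
    using T D by (auto simp: solves_def)
  with D q have "slope p = of_nat (nat D) / of_nat S"
    unfolding p by (intro polar_ef_leads(1)[OF _ L]) auto
  then have "of_nat S * slope p = of_int D" using q D by simp
  also have "\<dots> = of_nat R * slope q" using q by (simp add: D_def expo_slope)
  finally show s: "of_nat S * slope p = of_nat R * slope q" .
  show "p \<noteq> 0" using s q slope_pos[of q] by auto
qed

text \<open>Meant for the weighted defects of the slopes, which vanish at unmatched roots;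
  \<open>\<omega> \<mapsto> \<omega> * \<theta> / \<theta>'\<close> is a bijection between the
  matched ones.\<close>

lemma sum_matching:
  fixes f g :: "complex \<Rightarrow> rat"
  assumes "0 < R" "0 < S" "\<theta> \<noteq> 0" "\<theta>' \<noteq> 0"
    and "\<And>\<omega>. \<omega> \<in> roots R \<Longrightarrow> \<omega> * \<theta> / \<theta>' \<notin> roots S \<Longrightarrow> f \<omega> = 0"
    and "\<And>\<zeta>. \<zeta> \<in> roots S \<Longrightarrow> \<zeta> * \<theta>' / \<theta> \<notin> roots R \<Longrightarrow> g \<zeta> = 0"
    and "\<And>\<omega>. \<omega> \<in> roots R \<Longrightarrow> \<omega> * \<theta> / \<theta>' \<in> roots S \<Longrightarrow> f \<omega> = g (\<omega> * \<theta> / \<theta>')"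
  shows "(\<Sum>\<omega> \<in> roots R. f \<omega>) = (\<Sum>\<zeta> \<in> roots S. g \<zeta>)"
proof -
  have "(\<Sum>\<omega> \<in> roots R. f \<omega>) = (\<Sum>\<omega> \<in> {\<omega> \<in> roots R. \<omega> * \<theta> / \<theta>' \<in> roots S}. f \<omega>)"
    using assms finite_roots by (intro sum.mono_neutral_right) auto
  also have "\<dots> = (\<Sum>\<zeta> \<in> {\<zeta> \<in> roots S. \<zeta> * \<theta>' / \<theta> \<in> roots R}. g \<zeta>)"
    using assms by (intro sum.reindex_bij_witness[of _ "\<lambda>\<zeta>. \<zeta> * \<theta>' / \<theta>" "\<lambda>\<omega>. \<omega> * \<theta> / \<theta>'"]) auto
  also have "\<dots> = (\<Sum>\<zeta> \<in> roots S. g \<zeta>)"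
    using assms finite_roots by (intro sum.mono_neutral_left) auto
  finally show ?thesis .
qed

text \<open>Conjugates of \<open>q'\<close> sharing the leading term of \<open>q\<close> correspond to conjugates of \<open>p'\<close> sharing that of
  \<open>p\<close>: with \<open>\<theta>\<close>, \<open>\<theta>'\<close> the leading coefficients of the solutions, \<open>\<omega>\<close> and \<open>\<zeta>\<close> are matched iff
  \<open>\<omega> * \<theta> = \<zeta> * \<theta>'\<close>. For all other conjugates the slopes of the differences are maximal.\<close>

lemma dual_pair:
  assumes "dual R \<epsilon> S \<delta> q p" "dual R \<epsilon> S \<delta> q' p'"
  shows "(\<Sum>\<omega> \<in> roots R. of_nat R * (slope q - slope (q - act R \<omega> q'))) =
           (\<Sum>\<zeta> \<in> roots S. of_nat S * (slope p - slope (p - act S \<zeta> p')))"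
    and "galois_orbit q = galois_orbit q' \<longleftrightarrow> galois_orbit p = galois_orbit p'"
    and "q = q' \<Longrightarrow> p = p' \<Longrightarrow> \<zeta> \<in> roots S \<Longrightarrow> act S \<zeta> p = p \<Longrightarrow> \<zeta> \<in> roots R \<and> act R \<zeta> q = q"
proof -
  obtain \<theta> T where T: "solves R \<epsilon> S \<delta> q \<theta> T" and p: "p = polar_ef S (legf R \<epsilon> S \<delta> q T)"
    using assms(1) by (auto simp: dual_def)
  \<comment> \<open>If the two pairs coincide, one solution is used twice. Then
    \<open>\<theta>' = \<theta>\<close> and the matching of roots is the identity, as the third
    claim requires.\<close>
  obtain \<theta>' T' where T': "solves R \<epsilon> S \<delta> q' \<theta>' T'" and p': "p' = polar_ef S (legf R \<epsilon> S \<delta> q' T')"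
    and \<theta>'_choice: "q = q' \<Longrightarrow> p = p' \<Longrightarrow> \<theta>' = \<theta>"
  proof (cases "q = q' \<and> p = p'")
    case True
    with T p show ?thesis by (intro that[of \<theta> T]) auto
  next
    case False
    with assms(2) that show ?thesis by (auto simp: dual_def)
  qed
  note d = dual_imp[OF assms(1)] and d' = dual_imp[OF assms(2)]
  have nz: "\<theta> \<noteq> 0" "\<theta>' \<noteq> 0" using T T' by (auto simp: solves_def)
  have "expo R (slope q) = expo R (slope q')" using d(12) d'(12) by linarith
  then have "of_nat R * slope q = of_nat R * slope q'"
    using expo_slope[OF d(6,7)] expo_slope[OF d'(6,7)] by metis
  then have sl: "slope q' = slope q" using d(8) by simp
  then have sl': "slope p' = slope p" using d(4,9) d'(4) by (metis mult_cancel_left of_nat_0_eq_iff less_irrefl)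
  have root_nz: "\<omega> \<noteq> 0" "\<zeta> \<noteq> 0" if "\<omega> \<in> roots R" "\<zeta> \<in> roots S" for \<omega> \<zeta>
    using that roots_nonzero d(8,9) by blast+
  have close: "of_nat S * slope (p - act S (\<omega> * \<theta> / \<theta>') p') = of_nat R * slope (q - act R \<omega> q')"
    if "\<omega> \<in> roots R" "\<omega> * \<theta> / \<theta>' \<in> roots S" for \<omega>
  proof -
    \<comment> \<open>Rotating \<open>T'\<close> on both sides gives it exactly the leading
      coefficient of \<open>T\<close>, as \<open>slope_diff_transform\<close> demands.\<close>
    have "\<theta>' * (\<omega> * \<theta> / \<theta>') / \<omega> = \<theta>" using nz root_nz[OF that] by (simp add: field_simps)
    with solves_rotate[OF T' that] slope_diff_transform[OF T] show ?thesis by (metis p p')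
  qed
  have far: "slope (q - act R \<omega> q') = slope q" if \<omega>: "\<omega> \<in> roots R" "\<omega> * \<theta> / \<theta>' \<notin> roots S" for \<omega>
  proof -
    have nz': "\<omega> \<noteq> 0" using roots_nonzero[OF d(8) \<omega>(1)] .
    define v where "v = - of_int \<epsilon> * of_rat (slope q) * coef q (slope q)"
    have 1: "v * \<theta> powi (\<delta> * int S) = 1" using solves_lead[OF T] by (simp add: v_def)
    have 2: "- of_int \<epsilon> * of_rat (slope q) * coef (act R \<omega> q') (slope q) * (\<theta>' / \<omega>) powi (\<delta> * int S) = 1"
      using solves_lead[OF solves_rotate(1)[OF T' \<omega>(1) one_in_roots]] nz' by (simp add: slope_act sl)
    \<comment> \<open>Equal top coefficients would make \<theta> and
      \<open>\<theta>' / \<omega>\<close> differ by an \<open>S\<close>-th root of unity, so that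
      \<omega> would be matched.\<close>
    have "coef (act R \<omega> q') (slope q) \<noteq> coef q (slope q)"
    proof
      assume "coef (act R \<omega> q') (slope q) = coef q (slope q)"
      with 2 have "v * (\<theta>' / \<omega>) powi (\<delta> * int S) = 1" by (simp add: v_def)
      moreover have "v \<noteq> 0" using 1 by auto
      ultimately have "\<theta> powi (\<delta> * int S) = (\<theta>' / \<omega>) powi (\<delta> * int S)" using 1 by (metis mult_cancel_left)
      then have "(\<theta> / (\<theta>' / \<omega>)) powi (\<delta> * int S) = 1"
        using nz nz' power_int_divide_distrib[of \<theta> "\<theta>' / \<omega>" "\<delta> * int S"] by simp
      then have "\<theta> / (\<theta>' / \<omega>) \<in> roots S" using d(11) by (rule powi_eq_1_imp_root)
      with \<omega>(2) show False by (simp add: mult.commute)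
    qed
    then show ?thesis
      using slope_diff_lead_neq[of "act R \<omega> q'" q] nz' sl slope_minus_commute[of q] by (simp add: slope_act)
  qed
  define D where "D = expo R (slope q)"
  have D: "D > 0" using expo_slope_pos d by (auto simp: D_def)
  have lead_p: "coef (polar_ef S (legf R \<epsilon> S \<delta> x U)) (slope p) = of_int (\<delta> * int S) / of_int D * \<eta> powi (\<epsilon> * int R)"
    if U: "solves R \<epsilon> S \<delta> x \<eta> U" "slope x = slope q" for x \<eta> U
  proof -
    have "of_nat S * slope p = of_int D" using expo_slope[OF d(6,7)] d(4) by (simp add: D_def)
    then have s: "slope p = of_nat (nat D) / of_nat S" using D d(9) by (simp add: field_simps)
    have L: "leads (legf R \<epsilon> S \<delta> x U) (- int (nat D)) (of_int (\<delta> * int S) / of_int D * \<eta> powi (\<epsilon> * int R))"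
      using solves_legf_leads[OF U(1)] U(2) D by (simp add: D_def)
    have "of_int (\<delta> * int S) / of_int D * \<eta> powi (\<epsilon> * int R) \<noteq> 0" using U D by (auto simp: solves_def)
    with polar_ef_leads(2)[OF d(9) L] D show ?thesis unfolding s by simp
  qed
  have far': "slope (p - act S \<zeta> p') = slope p" if \<zeta>: "\<zeta> \<in> roots S" "\<zeta> * \<theta>' / \<theta> \<notin> roots R" for \<zeta>
  proof -
    have nz': "\<zeta> \<noteq> 0" using roots_nonzero[OF d(9) \<zeta>(1)] .
    define v :: complex where "v = of_int (\<delta> * int S) / of_int D"
    have v: "v \<noteq> 0" using D d by (auto simp: v_def)
    have "coef (act S \<zeta> p') (slope p) = v * (\<theta>' * \<zeta>) powi (\<epsilon> * int R)"
      using lead_p[OF solves_rotate(1)[OF T' one_in_roots \<zeta>(1)]] solves_rotate(2)[OF T' one_in_roots \<zeta>(1)] sl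
      by (simp add: p' v_def)
    moreover have "coef p (slope p) = v * \<theta> powi (\<epsilon> * int R)" using lead_p[OF T] by (simp add: p v_def)
    moreover have "\<theta> powi (\<epsilon> * int R) \<noteq> (\<theta>' * \<zeta>) powi (\<epsilon> * int R)"
    proof
      assume "\<theta> powi (\<epsilon> * int R) = (\<theta>' * \<zeta>) powi (\<epsilon> * int R)"
      then have "(\<theta>' * \<zeta> / \<theta>) powi (\<epsilon> * int R) = 1" using nz nz' by (simp add: power_int_divide_distrib)
      then have "\<theta>' * \<zeta> / \<theta> \<in> roots R" using d(10) by (rule powi_eq_1_imp_root)
      with \<zeta>(2) show False by (simp add: mult.commute)
    qed
    ultimately have "coef (act S \<zeta> p') (slope p) \<noteq> coef p (slope p)" using v by simp
    then show ?thesis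
      using slope_diff_lead_neq[of "act S \<zeta> p'" p] nz' sl' slope_minus_commute[of p] by (simp add: slope_act)
  qed
  show "(\<Sum>\<omega> \<in> roots R. of_nat R * (slope q - slope (q - act R \<omega> q'))) =
           (\<Sum>\<zeta> \<in> roots S. of_nat S * (slope p - slope (p - act S \<zeta> p')))"
    by (rule sum_matching[of R S \<theta> \<theta>']) (use nz d far far' close in \<open>auto simp: right_diff_distrib\<close>)
  have eq_iff: "x - y = 0 \<longleftrightarrow> slope (x - y) = 0" if "exp_factor x" "exp_factor y" for x y
    using slope_eq_0_iff[OF exp_factor_diff[OF that]] by simp
  have pos: "slope q > 0" "slope p > 0" using d slope_pos by auto
  have fwd: "p = act S (\<omega> * \<theta> / \<theta>') p' \<and> \<omega> * \<theta> / \<theta>' \<in> roots S" if "\<omega> \<in> roots R" "q = act R \<omega> q'" for \<omega>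
  proof -
    have 0: "slope (q - act R \<omega> q') = 0" using that by simp
    then have "\<omega> * \<theta> / \<theta>' \<in> roots S" using far[OF that(1)] pos by auto
    moreover from close[OF that(1) this] 0 d(9) have "slope (p - act S (\<omega> * \<theta> / \<theta>') p') = 0" by simp
    ultimately show ?thesis using eq_iff[OF d(1) exp_factor_act[OF d'(1)]] by simp
  qed
  have bwd: "q = act R (\<zeta> * \<theta>' / \<theta>) q' \<and> \<zeta> * \<theta>' / \<theta> \<in> roots R" if "\<zeta> \<in> roots S" "p = act S \<zeta> p'" for \<zeta>
  proof -
    have 0: "slope (p - act S \<zeta> p') = 0" using that by simp
    then have *: "\<zeta> * \<theta>' / \<theta> \<in> roots R" using far'[OF that(1)] pos by auto
    moreover have "\<zeta> * \<theta>' / \<theta> * \<theta> / \<theta>' = \<zeta>" using nz by simp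
    with close[OF *] that(1) 0 d(8) have "slope (q - act R (\<zeta> * \<theta>' / \<theta>) q') = 0" by simp
    ultimately show ?thesis using eq_iff[OF d(5) exp_factor_act[OF d'(5)]] by simp
  qed
  show "galois_orbit q = galois_orbit q' \<longleftrightarrow> galois_orbit p = galois_orbit p'"
    unfolding galois_orbit_eq_iff[OF d(8,6) d'(6)] galois_orbit_eq_iff[OF d(9,2) d'(2)]
    using fwd bwd by blast
  show "\<zeta> \<in> roots R \<and> act R \<zeta> q = q" if "q = q'" "p = p'" "\<zeta> \<in> roots S" "act S \<zeta> p = p"
    using bwd[of \<zeta>] that \<theta>'_choice[OF that(1,2)] nz by simp
qed

text \<open>If \<open>s\<close> were a proper multiple of \<open>ram p\<close>, a nontrivial root of
  unity would fix \<open>p\<close>. By the third part of \<open>dual_pair\<close> it would fix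
  \<open>q\<close> too, against freeness on the minimal cover of \<open>q\<close>.\<close>

lemma dual_ram:
  assumes "dual (ram q) \<epsilon> s \<delta> q p"
  shows "ram p = s"
proof -
  note d = dual_imp[OF assms]
  obtain m where m: "s = ram p * m" using covers_imp_ram_dvd[OF d(2)] by auto
  with d(9) have "m > 0" by auto
  have "roots m \<subseteq> {1}"
  proof
    fix \<zeta> assume "\<zeta> \<in> roots m"
    then have \<zeta>: "\<zeta> ^ m = 1" by (simp add: roots_def)
    then have "act s \<zeta> p = p" unfolding m act_change_cover[OF covers_ram \<open>m > 0\<close>] by simp
    moreover have "\<zeta> \<in> roots s" using \<zeta> by (simp add: m roots_def power_mult mult.commute[of _ m])
    ultimately have "\<zeta> \<in> roots (ram q)" "act (ram q) \<zeta> q = q"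
      using dual_pair(3)[OF assms assms] by auto
    then show "\<zeta> \<in> {1}" using act_ram_eq_imp by auto
  qed
  then have "card (roots m) \<le> 1" using card_mono[of "{1 :: complex}" "roots m"] by simp
  then have "m = 1" using card_roots[OF \<open>m > 0\<close>] \<open>m > 0\<close> by simp
  with m show ?thesis by simp
qed

lemma dual_Irr:
  assumes "dual (ram q) \<epsilon> s \<delta> q p"
  shows "Irr p = Irr q" "\<epsilon> * int (ram q) + \<delta> * int (ram p) + int (Irr q) = 0"
proof -
  note d = dual_imp[OF assms]
  have "(of_nat (Irr p) :: rat) = of_nat (Irr q)"
    using d dual_ram[OF assms] by (simp add: Irr_eq)
  then show "Irr p = Irr q" by simp
  have "expo (ram q) (slope q) = int (Irr q)"
    using Irr_eq[OF d(5)] by (simp add: expo_def flip: of_nat_mult) (metis floor_of_nat)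
  with d(12) show "\<epsilon> * int (ram q) + \<delta> * int (ram p) + int (Irr q) = 0"
    by (simp add: dual_ram[OF assms])
qed

section \<open>Irregularity of Hom and its change under duality\<close>

lemma slope_cross: "exp_factor q \<Longrightarrow> exp_factor q' \<Longrightarrow>
    slope q < slope q' \<longleftrightarrow> Irr q * ram q' < Irr q' * ram q"
proof -
  assume "exp_factor q" "exp_factor q'"
  then have "slope q = of_nat (Irr q) / of_nat (ram q)" "slope q' = of_nat (Irr q') / of_nat (ram q')"
    using ram_pos[of q] ram_pos[of q'] by (simp_all add: Irr_eq)
  then have "slope q < slope q' \<longleftrightarrow> (of_nat (Irr q * ram q') :: rat) < of_nat (Irr q' * ram q)"
    using ram_pos[of q] ram_pos[of q'] by (simp add: divide_less_eq less_divide_eq mult_ac)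
  then show ?thesis by (simp only: of_nat_less_iff)
qed

text \<open>Top terms of different exponents cannot cancel, so each of the
  \<open>ram q * ram q'\<close> differences has the larger slope.\<close>

lemma irr_Hom_slope_neq:
  assumes "exp_factor q" "exp_factor q'" "slope q \<noteq> slope q'"
  shows "irr_Hom (circle a q) (circle b q') = of_nat (max (Irr q * ram q') (Irr q' * ram q))"
proof -
  obtain R where R: "0 < R" "covers R q" "covers R q'" by (rule common_cover)
  have "(\<Sum>\<omega> \<in> roots R. slope (q - act R \<omega> q')) = of_nat R * max (slope q) (slope q')"
    using assms R roots_nonzero[OF R(1)]
    by (simp add: slope_diff_neq exp_factor_act slope_act card_roots cong: sum.cong)
  then have "of_nat R * irr_Hom (circle a q) (circle b q') = of_nat R * (of_nat (ram q * ram q') * max (slope q) (slope q'))"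
    unfolding irr_Hom_cover[OF R] by simp
  then have "irr_Hom (circle a q) (circle b q') = of_nat (ram q * ram q') * max (slope q) (slope q')"
    using R(1) by simp
  also have "\<dots> = max (of_nat (ram q) * slope q * of_nat (ram q')) (of_nat (ram q') * slope q' * of_nat (ram q))"
    by (simp add: max_mult_distrib_left mult_ac)
  also have "\<dots> = of_nat (max (Irr q * ram q') (Irr q' * ram q))"
    by (simp add: Irr_eq[OF assms(1), symmetric] Irr_eq[OF assms(2), symmetric] of_nat_max)
  finally show ?thesis .
qed

text \<open>\<open>Irr q * ram q'\<close> and \<open>Irr q * ram p'\<close> are the largest
  irregularities the slopes allow on the two sides. The formula says that the defects from these
  bounds agree, which is \<open>dual_pair\<close> on a common cover.\<close>

lemma irr_Hom_dual_slope_eq: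
  assumes "dual (ram q) \<epsilon> s \<delta> q p" "dual (ram q') \<epsilon> s' \<delta> q' p'" "slope q = slope q'"
  shows "irr_Hom (circle a p) (circle a' p') =
           irr_Hom (circle b q) (circle b' q') + of_nat (Irr q * ram p') - of_nat (Irr q * ram q')"
    and "galois_orbit q = galois_orbit q' \<longleftrightarrow> galois_orbit p = galois_orbit p'"
proof -
  note d = dual_imp[OF assms(1)] and d' = dual_imp[OF assms(2)]
  define r r' where "r = ram q" and "r' = ram q'"
  have r: "r > 0" "r' > 0" by (simp_all add: r_def r'_def ram_pos)
  have s: "ram p = s" "ram p' = s'" using assms dual_ram by auto
  have cross: "Irr q * r' = Irr q' * r"
    using slope_cross[OF d(5) d'(5)] slope_cross[OF d'(5) d(5)] assms(3) by (simp add: r_def r'_def)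
  \<comment> \<open>By the balance relation \<open>\<delta> * s\<close> is a combination of
    \<open>r\<close> and \<open>Irr q\<close>, which for equal slopes are proportional to
    \<open>r'\<close> and \<open>Irr q'\<close>. Hence a single \<open>S\<close> serves both
    transforms.\<close>
  have "(\<delta> * int s) * int r' = (\<delta> * int s') * int r"
  proof -
    have "\<delta> * int s = - \<epsilon> * int r - int (Irr q)" "\<delta> * int s' = - \<epsilon> * int r' - int (Irr q')"
      using dual_Irr(2)[OF assms(1)] dual_Irr(2)[OF assms(2)] by (simp_all add: s r_def r'_def)
    moreover have "int (Irr q) * int r' = int (Irr q') * int r" using cross by (metis of_nat_mult)
    ultimately show ?thesis by (simp only: left_diff_distrib) (simp only: mult_ac)
  qed
  then have "\<delta> * int (s * r') = \<delta> * int (s' * r)" by (simp add: mult_ac)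
  then have "int (s * r') = int (s' * r)" using d(11) unfolding mult_cancel_left by linarith
  then have sr: "s * r' = s' * r" by (simp only: of_nat_eq_iff)
  define R S where "R = r * r'" and "S = s * r'"
  have RS: "R > 0" "S > 0" using r d(9) by (auto simp: R_def S_def)
  have D: "dual R \<epsilon> S \<delta> q p" using dual_change_cover[OF assms(1) r(2)] by (simp add: R_def S_def r_def)
  have D': "dual R \<epsilon> S \<delta> q' p'"
    using dual_change_cover[OF assms(2) r(1)] unfolding r'_def[symmetric]
    by (simp add: R_def S_def sr mult.commute[of r])
  show "galois_orbit q = galois_orbit q' \<longleftrightarrow> galois_orbit p = galois_orbit p'"
    by (rule dual_pair(2)[OF D D'])
  note E = dual_imp[OF D] and E' = dual_imp[OF D']
  define \<Sigma> \<Sigma>' where "\<Sigma> = (\<Sum>\<omega> \<in> roots R. slope (q - act R \<omega> q'))"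
    and "\<Sigma>' = (\<Sum>\<zeta> \<in> roots S. slope (p - act S \<zeta> p'))"
  let ?A = "irr_Hom (circle b q) (circle b' q')" and ?A' = "irr_Hom (circle a p) (circle a' p')"
  have A: "of_nat R * ?A = of_nat (r * r') * \<Sigma>"
    unfolding \<Sigma>_def r_def r'_def using E E' by (intro irr_Hom_cover) auto
  then have A: "?A = \<Sigma>" using RS by (simp add: R_def)
  have A': "of_nat S * ?A' = of_nat (s * s') * \<Sigma>'"
    unfolding \<Sigma>'_def s[symmetric] using E E' by (intro irr_Hom_cover) auto
  \<comment> \<open>The maximal slopes in the defects are counted once per root of unity, that is
    \<open>R\<close> and \<open>S\<close> times.\<close>
  have "of_nat R * (of_nat R * slope q) - of_nat R * \<Sigma> = of_nat S * (of_nat S * slope p) - of_nat S * \<Sigma>'"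
    using dual_pair(1)[OF D D'] RS unfolding \<Sigma>_def \<Sigma>'_def
    by (simp add: sum_subtractf card_roots right_diff_distrib flip: sum_distrib_left)
  then have *: "of_nat R * (of_nat R * slope q) - of_nat R * ?A = of_nat S * (of_nat R * slope q) - of_nat S * \<Sigma>'"
    by (simp add: A E(4))
  have Rs: "of_nat R * slope q = of_nat (Irr q * r')"
    using Irr_eq[OF d(5)] by (simp add: R_def r_def mult_ac)
  have "of_nat R * ?A' = of_nat S * ?A' * (of_nat r / of_nat s)"
    using d(9) by (simp add: R_def S_def)
  also have "\<dots> = of_nat (s' * r) * \<Sigma>'" using d(9) by (simp add: A')
  also have "\<dots> = of_nat S * \<Sigma>'" using sr by (simp add: S_def)
  also have "\<dots> = of_nat S * (of_nat R * slope q) - of_nat R * (of_nat R * slope q) + of_nat R * ?A"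
    using * by simp
  also have "\<dots> = of_nat R * (of_nat (Irr q * s') + ?A - of_nat (Irr q * r'))"
  proof -
    have "S * (Irr q * r') = R * (Irr q * s')" by (simp add: S_def R_def sr)
    then have "(of_nat S * of_nat (Irr q * r') :: rat) = of_nat R * of_nat (Irr q * s')" by (metis of_nat_mult)
    then show ?thesis unfolding Rs by (simp only: distrib_left right_diff_distrib)
  qed
  finally show "?A' = ?A + of_nat (Irr q * ram p') - of_nat (Irr q * ram q')"
    using RS by (simp add: s r'_def)
qed

section \<open>The Legendre transform of circles\<close>

lemma loc_powr_shift:
  assumes "coef q k \<noteq> 0"
  shows "loc_powr (ram q) T (of_int n - k) = T powi (int (ram q) * n - expo (ram q) k)"
proof -
  have "of_nat (ram q) * (of_int n - k) = (of_int (int (ram q) * n - expo (ram q) k) :: rat)"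
    using of_int_expo[OF covers_ram assms] by (simp add: algebra_simps)
  then show ?thesis unfolding loc_powr_def by (simp only: floor_of_int)
qed

lemma ef_subst_ev: "ef_subst q T = ev (ram q) (\<lambda>_. 1) 0 q T"
  unfolding ef_subst_def ev_def
  by (intro sum.cong refl) (use loc_powr_shift[of q _ T 0] in \<open>simp add: in_keys_iff\<close>)

lemma ef_deriv_fin_ev: "ef_deriv_fin q T = ev (ram q) (\<lambda>k. - of_int 1 * of_rat k) (int (ram q) * - 1) q T"
  unfolding ef_deriv_fin_def ev_def
  by (intro sum.cong refl) (use loc_powr_shift[of q _ T "- 1"] in \<open>simp add: in_keys_iff minus_diff_commute\<close>)

lemma ef_deriv_inf_ev: "ef_deriv_inf q T = ev (ram q) (\<lambda>k. - of_int (- 1) * of_rat k) (int (ram q) * - (- 1)) q T"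
  unfolding ef_deriv_inf_def ev_def
  by (intro sum.cong refl) (use loc_powr_shift[of q _ T 1] in \<open>simp add: in_keys_iff\<close>)

lemma expo_ram_slope: "exp_factor q \<Longrightarrow> expo (ram q) (slope q) = int (Irr q)"
  using Irr_eq[of q] by (simp add: expo_def) (metis floor_of_nat)

lemma slope_less_one_iff: "exp_factor q \<Longrightarrow> slope q < 1 \<longleftrightarrow> Irr q < ram q"
  and slope_gt_one_iff: "exp_factor q \<Longrightarrow> 1 < slope q \<longleftrightarrow> ram q < Irr q"
proof -
  assume q: "exp_factor q"
  have "slope q < 1 \<longleftrightarrow> of_nat (ram q) * slope q < of_nat (ram q)" "1 < slope q \<longleftrightarrow> of_nat (ram q) < of_nat (ram q) * slope q"
    using ram_pos[of q] by simp_all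
  then show "slope q < 1 \<longleftrightarrow> Irr q < ram q" "1 < slope q \<longleftrightarrow> ram q < Irr q"
    unfolding Irr_eq[OF q, symmetric] of_nat_less_iff by simp_all
qed

lemma subdegree_1_leads: "fls_subdegree T = 1 \<longleftrightarrow> (\<exists>\<theta>. leads T 1 \<theta> \<and> \<theta> \<noteq> 0)"
proof
  assume *: "fls_subdegree T = 1"
  then have "T \<noteq> 0" by auto
  then have "T $$ 1 \<noteq> 0" using nth_fls_subdegree_nonzero[of T] * by simp
  then show "\<exists>\<theta>. leads T 1 \<theta> \<and> \<theta> \<noteq> 0" using subdegree_leads[of T] * by auto
qed (use leads_subdegree in blast)

lemma dual_iff:
  assumes "\<bar>\<epsilon>\<bar> = 1" "\<bar>\<delta>\<bar> = 1"
  shows "dual (ram q) \<epsilon> s \<delta> q p \<longleftrightarrow>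
    exp_factor q \<and> q \<noteq> 0 \<and> 0 < s \<and> \<epsilon> * int (ram q) + \<delta> * int s + int (Irr q) = 0 \<and>
    (\<exists>T. fls_subdegree T = 1 \<and>
      ev (ram q) (\<lambda>k. - of_int \<epsilon> * of_rat k) (int (ram q) * - \<epsilon>) q T = fls_X powi (\<delta> * int s) \<and>
      p = polar_ef s (legf (ram q) \<epsilon> s \<delta> q T))"
  unfolding dual_def solves_def subdegree_1_leads
  using assms ram_pos[of q] covers_ram[of q] by (auto simp: expo_ram_slope)

text \<open>At infinity \<open>\<xi> = u powi (- s)\<close>, so this is the contribution of the
  constant \<open>a\<close> in \<open>z = a + T ^ r\<close>.\<close>

lemma polar_ef_linear: "0 < s \<Longrightarrow> polar_ef s (fls_X powi (- int s) * fls_const a) = Poly_Mapping.single 1 a"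
proof (rule poly_mapping_eqI)
  fix k :: rat assume s: "0 < s"
  define g where "g = fls_X powi (- int s) * fls_const a"
  have *: "g $$ n = (if n = - int s then a else 0)" for n
    by (simp add: g_def fls_X_power_int)
  have "coef (polar_ef s g) k = coef (Poly_Mapping.single 1 a) k"
  proof (cases "0 < k \<and> of_nat s * k \<in> \<int>")
    case True
    then have e: "of_int (expo s k) = of_nat s * k" by (auto simp: expo_def elim: Ints_cases)
    have "expo s k = int s \<longleftrightarrow> (of_int (expo s k) :: rat) = of_int (int s)" by (simp only: of_int_eq_iff)
    also have "\<dots> \<longleftrightarrow> k = 1" using s by (simp add: e)
    finally show ?thesis using True s by (simp add: lookup_polar_ef * lookup_single when_def)
  next
    case False
    then have "k \<noteq> 1" by auto
    with False s show ?thesis by (auto simp: lookup_polar_ef lookup_single when_def)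
  qed
  then show "coef (polar_ef s (fls_X powi (- int s) * fls_const a)) k = coef (Poly_Mapping.single 1 a) k"
    by (simp only: g_def)
qed

text \<open>The exponential factors paired by the transform between a finite point (\<open>\<epsilon> = 1\<close>) and slopes
  less than one at infinity (\<open>\<epsilon> = - 1\<close>), stripped of the linear terms\<close>

definition paired :: "int \<Rightarrow> ef \<Rightarrow> ef \<Rightarrow> bool" where
  "paired \<epsilon> q p \<longleftrightarrow> q = 0 \<and> p = 0 \<or> (\<exists>s. dual (ram q) \<epsilon> s (- \<epsilon>) q p)"

lemma legendre_iff:
  "legendre a q b p \<longleftrightarrow>
     a = Infinity \<and> b = Infinity \<and> (\<exists>s. dual (ram q) (- 1) s (- 1) q p) \<or>
     (\<exists>c p0. a = Finite c \<and> b = Infinity \<and> p = p0 + Poly_Mapping.single 1 (- c) \<and> paired 1 q p0) \<or>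
     (\<exists>c q0. a = Infinity \<and> b = Finite c \<and> q = q0 + Poly_Mapping.single 1 c \<and> paired (- 1) q0 p)"
  (is "_ \<longleftrightarrow> ?A \<or> ?B \<or> ?C")
proof
  assume "legendre a q b p"
  then show "?A \<or> ?B \<or> ?C"
  proof cases
    case (inf_slope_gt_1 s T)
    have "ram q < Irr q" "q \<noteq> 0" using inf_slope_gt_1 slope_gt_one_iff[of q] by auto
    with inf_slope_gt_1 have "dual (ram q) (- 1) s (- 1) q p"
      unfolding dual_iff[of "- 1" "- 1", simplified]
      by (auto simp: legf_def ef_subst_ev ef_deriv_inf_ev intro!: exI[of _ T])
    with inf_slope_gt_1 show ?thesis by auto
  next
    case (fin_irregular s T c)
    have s: "s > 0" using fin_irregular ram_pos[of q] by simp
    define p0 where "p0 = polar_ef s (legf (ram q) 1 s (- 1) q T)"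
    have "dual (ram q) 1 s (- 1) q p0"
      using fin_irregular s unfolding dual_iff[of 1 "- 1", simplified]
      by (auto simp: p0_def ef_deriv_fin_ev intro!: exI[of _ T])
    moreover have "p = p0 + Poly_Mapping.single 1 (- c)"
    proof -
      have "ef_subst q T - fls_X powi (- int s) * (fls_const c + T ^ ram q) =
          legf (ram q) 1 s (- 1) q T - fls_X powi (- int s) * fls_const c"
        by (simp add: legf_def ef_subst_ev algebra_simps)
      then have "p = p0 - Poly_Mapping.single 1 c"
        using fin_irregular(3) s by (simp add: polar_ef_diff polar_ef_linear p0_def)
      then show ?thesis by (simp add: single_uminus)
    qed
    ultimately show ?thesis using fin_irregular unfolding paired_def by auto
  next
    case (fin_tame c)
    then show ?thesis by (auto simp: paired_def)
  next
    case (inf_linear c)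
    then show ?thesis by (auto simp: paired_def)
  next
    case (inf_slope_lt_1 q0 s T c)
    have "Irr q0 < ram q0" "q0 \<noteq> 0" using inf_slope_lt_1 slope_less_one_iff[of q0] by auto
    moreover have "fls_X powi (int (ram q0) - int (Irr q0)) = (fls_X ^ (ram q0 - Irr q0) :: complex fls)"
      using calculation(1) by (simp add: of_nat_diff flip: power_int_of_nat)
    ultimately have "dual (ram q0) (- 1) s 1 q0 p"
      using inf_slope_lt_1      unfolding dual_iff[of "- 1" 1, simplified]
      by (auto simp: legf_def ef_subst_ev ef_deriv_inf_ev intro!: exI[of _ T])
    with inf_slope_lt_1 show ?thesis unfolding paired_def by (auto simp: add.commute)
  qed
next
  assume "?A \<or> ?B \<or> ?C"
  then consider s where "a = Infinity" "b = Infinity" "dual (ram q) (- 1) s (- 1) q p"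
    | c p0 where "a = Finite c" "b = Infinity" "p = p0 + Poly_Mapping.single 1 (- c)" "paired 1 q p0"
    | c q0 where "a = Infinity" "b = Finite c" "q = q0 + Poly_Mapping.single 1 c" "paired (- 1) q0 p"
    by blast
  then show "legendre a q b p"
  proof cases
    case 1
    then obtain T where T: "exp_factor q" "q \<noteq> 0" "0 < s" "int (Irr q) = int (ram q) + int s"
        "fls_subdegree T = 1" "ef_deriv_inf q T = fls_X powi (- int s)"
        "p = polar_ef s (ef_subst q T - fls_X powi (- int s) * T powi (- int (ram q)))"
      unfolding dual_iff[of "- 1" "- 1", simplified] by (auto simp: legf_def ef_subst_ev ef_deriv_inf_ev)
    then have s: "s = Irr q - ram q" "slope q > 1" by (auto simp: slope_gt_one_iff)
    show ?thesis unfolding 1 T(7) by (rule legendre.inf_slope_gt_1) (use T s in auto)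
  next
    case 2
    show ?thesis
    proof (cases "q = 0 \<and> p0 = 0")
      case True
      then show ?thesis using 2 legendre.fin_tame by simp
    next
      case False
      then obtain s where "dual (ram q) 1 s (- 1) q p0" using 2 by (auto simp: paired_def)
      then obtain T where T: "exp_factor q" "q \<noteq> 0" "0 < s" "int s = int (ram q) + int (Irr q)"
          "fls_subdegree T = 1" "ef_deriv_fin q T = fls_X powi (- int s)"
          "p0 = polar_ef s (legf (ram q) 1 s (- 1) q T)"
        unfolding dual_iff[of 1 "- 1", simplified] by (auto simp: ef_deriv_fin_ev)
      have "ef_subst q T - fls_X powi (- int s) * (fls_const c + T ^ ram q) =
          legf (ram q) 1 s (- 1) q T - fls_X powi (- int s) * fls_const c"
        by (simp add: legf_def ef_subst_ev algebra_simps)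
      then have p: "p = polar_ef s (ef_subst q T - fls_X powi (- int s) * (fls_const c + T ^ ram q))"
        by (simp only: polar_ef_diff[OF T(3)] polar_ef_linear[OF T(3)] 2(3) T(7) single_uminus) simp
      show ?thesis unfolding 2(1,2) p by (rule legendre.fin_irregular) (use T in auto)
    qed
  next
    case 3
    show ?thesis
    proof (cases "q0 = 0 \<and> p = 0")
      case True
      then show ?thesis using 3 legendre.inf_linear by simp
    next
      case False
      then obtain s where "dual (ram q0) (- 1) s 1 q0 p" using 3 by (auto simp: paired_def)
      then obtain T where T: "exp_factor q0" "q0 \<noteq> 0" "0 < s" "int (ram q0) = int s + int (Irr q0)"
          "fls_subdegree T = 1" "ef_deriv_inf q0 T = fls_X ^ s"
          "p = polar_ef s (ef_subst q0 T - fls_X ^ s * T powi (- int (ram q0)))"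
        unfolding dual_iff[of "- 1" 1, simplified] by (auto simp: legf_def ef_subst_ev ef_deriv_inf_ev)
      have s: "s = ram q0 - Irr q0" "slope q0 < 1" "0 < slope q0"
        using T slope_pos by (auto simp: slope_less_one_iff)
      show ?thesis unfolding 3(1,2,3) T(7) add.commute[of q0]
        by (rule legendre.inf_slope_lt_1) (use T s in auto)
    qed
  qed
qed

lemma paired_imp:
  assumes "paired \<epsilon> q p" "\<bar>\<epsilon>\<bar> = 1"
  shows "exp_factor q" "exp_factor p" "Irr p = Irr q" "int (ram p) = int (ram q) + \<epsilon> * int (Irr q)"
    and "q = 0 \<longleftrightarrow> p = 0"
proof -
  have "exp_factor q \<and> exp_factor p \<and> Irr p = Irr q \<and> int (ram p) = int (ram q) + \<epsilon> * int (Irr q) \<and> (q = 0 \<longleftrightarrow> p = 0)"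
  proof (cases "q = 0 \<and> p = 0")
    case True
    then show ?thesis by (simp add: Irr_def)
  next
    case False
    then obtain s where s: "dual (ram q) \<epsilon> s (- \<epsilon>) q p" using assms by (auto simp: paired_def)
    consider "\<epsilon> = 1" | "\<epsilon> = - 1" using assms(2) by linarith
    then have "int (ram q) - int (ram p) + \<epsilon> * int (Irr q) = 0"
      using dual_Irr(2)[OF s] by cases simp_all
    then show ?thesis using dual_imp[OF s] dual_Irr(1)[OF s] by simp
  qed
  then show "exp_factor q" "exp_factor p" "Irr p = Irr q" "int (ram p) = int (ram q) + \<epsilon> * int (Irr q)"
    "q = 0 \<longleftrightarrow> p = 0" by auto
qed

section \<open>Pairs of circles under the transform\<close>

lemma slope_eq_iff_cross:
  "exp_factor q \<Longrightarrow> exp_factor q' \<Longrightarrow> slope q = slope q' \<longleftrightarrow> Irr q * ram q' = Irr q' * ram q"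
  using slope_cross[of q q'] slope_cross[of q' q] by (metis linorder_neq_iff)

lemma galois_orbit_slope_neq: "slope q \<noteq> slope q' \<Longrightarrow> galois_orbit q \<noteq> galois_orbit q'"
  using circle_eq_imp(3) by blast

text \<open>For equal slopes this is \<open>irr_Hom_dual_slope_eq\<close> with
  \<open>ram p' - ram q' = \<epsilon> * Irr q'\<close>. For different slopes the irregularity is the
  larger of two products, and both products change by the same amount.\<close>

lemma paired_pair:
  assumes "paired \<epsilon> q p" "paired \<epsilon> q' p'" "\<bar>\<epsilon>\<bar> = 1"
  shows "irr_Hom (circle a p) (circle a' p') = irr_Hom (circle b q) (circle b' q') + of_int (\<epsilon> * int (Irr q) * int (Irr q'))"
    and "galois_orbit q = galois_orbit q' \<longleftrightarrow> galois_orbit p = galois_orbit p'"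
proof -
  note P = paired_imp[OF assms(1,3)] and P' = paired_imp[OF assms(2,3)]
  have cross: "int (Irr p) * int (ram p') = int (Irr q) * int (ram q') + \<epsilon> * int (Irr q) * int (Irr q')"
      "int (Irr p') * int (ram p) = int (Irr q') * int (ram q) + \<epsilon> * int (Irr q) * int (Irr q')"
    by (simp_all add: P P' algebra_simps)
  have "slope p = slope p' \<longleftrightarrow> int (Irr p) * int (ram p') = int (Irr p') * int (ram p)"
    unfolding slope_eq_iff_cross[OF P(2) P'(2)] by (metis of_nat_mult of_nat_eq_iff)
  also have "\<dots> \<longleftrightarrow> int (Irr q) * int (ram q') = int (Irr q') * int (ram q)" using cross by simp
  also have "\<dots> \<longleftrightarrow> slope q = slope q'"
    unfolding slope_eq_iff_cross[OF P(1) P'(1)] by (metis of_nat_mult of_nat_eq_iff)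
  finally have sl: "slope p = slope p' \<longleftrightarrow> slope q = slope q'" .
  have "irr_Hom (circle a p) (circle a' p') = irr_Hom (circle b q) (circle b' q') + of_int (\<epsilon> * int (Irr q) * int (Irr q'))
    \<and> (galois_orbit q = galois_orbit q' \<longleftrightarrow> galois_orbit p = galois_orbit p')"
  proof (cases "slope q = slope q'")
    case False
    have "int (max (Irr p * ram p') (Irr p' * ram p)) = int (max (Irr q * ram q') (Irr q' * ram q)) + \<epsilon> * int (Irr q) * int (Irr q')"
      unfolding of_nat_max of_nat_mult cross by (simp add: max_add_distrib_left)
    then have "(of_int (int (max (Irr p * ram p') (Irr p' * ram p))) :: rat) = of_int (int (max (Irr q * ram q') (Irr q' * ram q)) + \<epsilon> * int (Irr q) * int (Irr q'))"
      by (simp only:)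
    then have "(of_nat (max (Irr p * ram p') (Irr p' * ram p)) :: rat) = of_nat (max (Irr q * ram q') (Irr q' * ram q)) + of_int (\<epsilon> * int (Irr q) * int (Irr q'))"
      by (simp only: of_int_add of_int_of_nat_eq)
    with False sl show ?thesis
      using galois_orbit_slope_neq[of q q'] galois_orbit_slope_neq[of p p']
      by (simp only: irr_Hom_slope_neq[OF P(1) P'(1) False] irr_Hom_slope_neq[OF P(2) P'(2)] simp_thms not_False_eq_True)
  next
    case True
    show ?thesis
    proof (cases "q = 0")
      case q: True
      with True have "q' = 0" using slope_eq_0_iff[OF P'(1)] by simp
      moreover have "p = 0" "p' = 0" using P(5) P'(5) q \<open>q' = 0\<close> by simp_all
      ultimately show ?thesis using q by (simp add: irr_Hom_def circle_def Irr_def)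
    next
      case q: False
      with True have q': "q' \<noteq> 0" using slope_eq_0_iff[OF P(1)] by auto
      obtain s where s: "dual (ram q) \<epsilon> s (- \<epsilon>) q p" using assms q by (auto simp: paired_def)
      obtain s' where s': "dual (ram q') \<epsilon> s' (- \<epsilon>) q' p'" using assms q' by (auto simp: paired_def)
      have "int (Irr q) * int (ram p') - int (Irr q) * int (ram q') = \<epsilon> * int (Irr q) * int (Irr q')"
        by (simp add: P' algebra_simps)
      then have "(of_int (int (Irr q) * int (ram p') - int (Irr q) * int (ram q')) :: rat) = of_int (\<epsilon> * int (Irr q) * int (Irr q'))"
        by (simp only:)
      then have "(of_nat (Irr q * ram p') - of_nat (Irr q * ram q') :: rat) = of_int (\<epsilon> * int (Irr q) * int (Irr q'))"
        by simp
      then show ?thesis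
        using irr_Hom_dual_slope_eq(1)[OF s s' True, of a a' b b'] irr_Hom_dual_slope_eq(2)[OF s s' True] by (simp only: add_diff_eq[symmetric] simp_thms)
    qed
  qed
  then show "irr_Hom (circle a p) (circle a' p') = irr_Hom (circle b q) (circle b' q') + of_int (\<epsilon> * int (Irr q) * int (Irr q'))"
    "galois_orbit q = galois_orbit q' \<longleftrightarrow> galois_orbit p = galois_orbit p'" by auto
qed

lemma dual_inf_imp:
  assumes "dual (ram q) (- 1) s (- 1) q p"
  shows "int (ram p) = int (Irr q) - int (ram q)" "1 < slope q" "1 < slope p"
proof -
  note d = dual_imp[OF assms] and I = dual_Irr[OF assms]
  show r: "int (ram p) = int (Irr q) - int (ram q)" using I by simp
  with ram_pos[of p] show "1 < slope q" using d by (simp add: slope_gt_one_iff)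
  show "1 < slope p" using d r ram_pos[of q] I by (simp add: slope_gt_one_iff)
qed

text \<open>For different slopes the transform reverses their order: the maximum of
  \<open>Irr q * ram q'\<close> and \<open>Irr q' * ram q\<close> is replaced by
  \<open>Irr q * Irr q'\<close> minus their minimum. Maximum plus minimum being the sum, the
  irregularity changes exactly as the product of the ramifications does.\<close>

lemma dual_inf_pair:
  assumes "dual (ram q) (- 1) s (- 1) q p" "dual (ram q') (- 1) s' (- 1) q' p'"
  shows "irr_Hom (circle a p) (circle a' p') - of_nat (ram p * ram p') =
           irr_Hom (circle b q) (circle b' q') - of_nat (ram q * ram q')"
    and "galois_orbit q = galois_orbit q' \<longleftrightarrow> galois_orbit p = galois_orbit p'"
proof -
  note d = dual_imp[OF assms(1)] and d' = dual_imp[OF assms(2)]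
  note I = dual_Irr(1)[OF assms(1)] and I' = dual_Irr(1)[OF assms(2)]
  note r = dual_inf_imp(1)[OF assms(1)] and r' = dual_inf_imp(1)[OF assms(2)]
  have cross: "int (Irr p) * int (ram p') = int (Irr q) * int (Irr q') - int (Irr q) * int (ram q')"
      "int (Irr p') * int (ram p) = int (Irr q) * int (Irr q') - int (Irr q') * int (ram q)"
      "int (ram p) * int (ram p') - int (ram q) * int (ram q') =
        int (Irr q) * int (Irr q') - int (Irr q) * int (ram q') - int (Irr q') * int (ram q)"
    by (simp_all add: I I' r r' algebra_simps)
  have "slope p = slope p' \<longleftrightarrow> int (Irr p) * int (ram p') = int (Irr p') * int (ram p)"
    unfolding slope_eq_iff_cross[OF d(1) d'(1)] by (metis of_nat_mult of_nat_eq_iff)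
  also have "\<dots> \<longleftrightarrow> int (Irr q) * int (ram q') = int (Irr q') * int (ram q)" using cross by simp
  also have "\<dots> \<longleftrightarrow> slope q = slope q'"
    unfolding slope_eq_iff_cross[OF d(5) d'(5)] by (metis of_nat_mult of_nat_eq_iff)
  finally have sl: "slope p = slope p' \<longleftrightarrow> slope q = slope q'" .
  have "irr_Hom (circle a p) (circle a' p') = irr_Hom (circle b q) (circle b' q')
      + of_int (int (ram p) * int (ram p') - int (ram q) * int (ram q'))
    \<and> (galois_orbit q = galois_orbit q' \<longleftrightarrow> galois_orbit p = galois_orbit p')"
  proof (cases "slope q = slope q'")
    case False
    have "int (max (Irr p * ram p') (Irr p' * ram p)) =
        int (max (Irr q * ram q') (Irr q' * ram q)) + (int (ram p) * int (ram p') - int (ram q) * int (ram q'))"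
      unfolding of_nat_max of_nat_mult cross by linarith
    then have "(of_int (int (max (Irr p * ram p') (Irr p' * ram p))) :: rat) =
        of_int (int (max (Irr q * ram q') (Irr q' * ram q)) + (int (ram p) * int (ram p') - int (ram q) * int (ram q')))"
      by (simp only:)
    then have "(of_nat (max (Irr p * ram p') (Irr p' * ram p)) :: rat) =
        of_nat (max (Irr q * ram q') (Irr q' * ram q)) + of_int (int (ram p) * int (ram p') - int (ram q) * int (ram q'))"
      by (simp only: of_int_add of_int_of_nat_eq)
    with False sl show ?thesis
      using galois_orbit_slope_neq[of q q'] galois_orbit_slope_neq[of p p']
      by (simp only: irr_Hom_slope_neq[OF d(5) d'(5) False] irr_Hom_slope_neq[OF d(1) d'(1)] simp_thms not_False_eq_True)
  next
    case True
    then have "Irr q * ram q' = Irr q' * ram q" using slope_eq_iff_cross d d' by simp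
    then have "int (Irr q) * int (ram q') = int (Irr q') * int (ram q)" by (metis of_nat_mult)
    then have "int (Irr q) * int (ram p') - int (Irr q) * int (ram q') = int (ram p) * int (ram p') - int (ram q) * int (ram q')"
      using cross by (simp add: I)
    then have "(of_int (int (Irr q) * int (ram p') - int (Irr q) * int (ram q')) :: rat) =
        of_int (int (ram p) * int (ram p') - int (ram q) * int (ram q'))"
      by (simp only:)
    then have "(of_nat (Irr q * ram p') - of_nat (Irr q * ram q') :: rat) =
        of_int (int (ram p) * int (ram p') - int (ram q) * int (ram q'))"
      by simp
    then show ?thesis
      using irr_Hom_dual_slope_eq(1)[OF assms True, of a a' b b'] irr_Hom_dual_slope_eq(2)[OF assms True] by (simp only: add_diff_eq[symmetric] simp_thms)
  qed
  then show "irr_Hom (circle a p) (circle a' p') - of_nat (ram p * ram p') =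
           irr_Hom (circle b q) (circle b' q') - of_nat (ram q * ram q')"
    "galois_orbit q = galois_orbit q' \<longleftrightarrow> galois_orbit p = galois_orbit p'"
    by (simp_all only: of_int_diff of_int_mult of_int_of_nat_eq of_nat_mult simp_thms)
qed

section \<open>Linear terms\<close>

lemma galois_orbit_lin:
  "galois_orbit (q + Poly_Mapping.single 1 c) = galois_orbit (q' + Poly_Mapping.single 1 c) \<longleftrightarrow> galois_orbit q = galois_orbit q'"
  using galois_orbit_shift_eq_iff[of q 1 c q'] by simp

lemma irr_Hom_lin:
  "irr_Hom (circle a (q + Poly_Mapping.single 1 c)) (circle b (q' + Poly_Mapping.single 1 c)) = irr_Hom (circle a q) (circle b q')"
  using irr_Hom_shift[of a q 1 c b q' a b] by simp

lemma ram_lin: "ram (q + Poly_Mapping.single 1 c) = ram q"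
  using ram_shift[of q 1 c] by simp

lemma slope_lin_le: "exp_factor q \<Longrightarrow> slope q < 1 \<Longrightarrow> slope (q + Poly_Mapping.single 1 c) \<le> 1"
  by (rule slope_leI)
     (auto intro!: exp_factor_add exp_factor_single simp: lookup_add lookup_single coef_above_slope)

text \<open>Conjugation fixes linear terms, so every difference starts with
  \<open>(c - c') * z\<close> and has slope 1. The irregularity then cancels the product of
  ramifications, whence the 0 for distinct finite points.\<close>

lemma lin_neq:
  assumes "exp_factor q" "exp_factor q'" "slope q < 1" "slope q' < 1" "c \<noteq> c'"
  shows "galois_orbit (q + Poly_Mapping.single 1 c) \<noteq> galois_orbit (q' + Poly_Mapping.single 1 c')"
    and "irr_Hom (circle a (q + Poly_Mapping.single 1 c)) (circle b (q' + Poly_Mapping.single 1 c')) = of_nat (ram q * ram q')"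
proof -
  let ?q = "q + Poly_Mapping.single 1 c" and ?q' = "q' + Poly_Mapping.single 1 c'"
  obtain R where R: "0 < R" "covers R ?q" "covers R ?q'" by (rule common_cover)
  have sl: "slope (?q - act R \<omega> ?q') = 1" if "\<omega> \<in> roots R" for \<omega>
  proof (rule slope_eqI)
    have "act R \<omega> (Poly_Mapping.single 1 c') = Poly_Mapping.single 1 c'"
      using act_integral[OF R(1) that, of 1 c'] by simp
    then have *: "?q - act R \<omega> ?q' = (q - act R \<omega> q') + (Poly_Mapping.single 1 c - Poly_Mapping.single 1 c')"
      by (simp add: act_add)
    have **: "coef (q - act R \<omega> q') j = 0" if "1 \<le> j" for j
      using that assms by (simp add: lookup_minus coef_act coef_above_slope)
    show "coef (?q - act R \<omega> ?q') 1 \<noteq> 0"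
      using assms(5) by (simp add: * lookup_add[of "q - act R \<omega> q'"] ** lookup_minus[of "Poly_Mapping.single 1 c"])
    show "coef (?q - act R \<omega> ?q') j = 0" if "1 < j" for j
      using that by (simp add: * lookup_add[of "q - act R \<omega> q'"] ** lookup_minus[of "Poly_Mapping.single 1 c"] lookup_single)
  qed
  show "galois_orbit ?q \<noteq> galois_orbit ?q'"
    unfolding galois_orbit_eq_iff[OF R] using sl by (metis cancel_comm_monoid_add_class.diff_cancel slope_0 zero_neq_one)
  have "of_nat R * irr_Hom (circle a ?q) (circle b ?q') = of_nat R * (of_nat (ram q * ram q') :: rat)"
    unfolding irr_Hom_cover[OF R] using R(1) by (simp add: sl card_roots ram_lin cong: sum.cong)
  then show "irr_Hom (circle a ?q) (circle b ?q') = of_nat (ram q * ram q')" using R(1) by simp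
qed

section \<open>Invariance of the number of edges\<close>

definition edges :: "point \<Rightarrow> ef \<Rightarrow> point \<Rightarrow> ef \<Rightarrow> rat" where
  "edges a q a' q' = (case (a, a') of
     (Infinity, Infinity) \<Rightarrow> B_inf (circle a q) (circle a' q')
   | (Infinity, Finite _) \<Rightarrow> of_nat (ram q * (Irr q' + ram q'))
   | (Finite _, Infinity) \<Rightarrow> of_nat (ram q' * (Irr q + ram q))
   | (Finite c, Finite c') \<Rightarrow>
       if c = c' then B_inf (circle a q) (circle a' q') - of_nat (Irr q * ram q') - of_nat (Irr q' * ram q) else 0)"

text \<open>Isolates the extra 1 of a loop, so that invariance splits into a statement on
  \<open>irr_Hom\<close> and one on equality of circles.\<close>

lemma B_inf_circle:
  "B_inf (circle a q) (circle a' q') = irr_Hom (circle a q) (circle a' q') - of_nat (ram q * ram q')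
     + (if a = a' \<and> galois_orbit q = galois_orbit q' then 1 else 0)"
proof (cases "a = a' \<and> galois_orbit q = galois_orbit q'")
  case True
  then have "circle a q = circle a' q'" by simp
  moreover have "ram q = ram q'" using True circle_eq_imp(2) by blast
  ultimately have "B_inf (circle a q) (circle a' q') = irr_Hom (circle a q) (circle a' q') - of_nat (ram q ^ 2) + 1"
    unfolding B_inf_def by (simp only: if_True circ_ram_circle simp_thms)
  with True \<open>ram q = ram q'\<close> show ?thesis by (simp only: if_True power2_eq_square simp_thms)
qed (auto simp: B_inf_def)

lemma irr_Hom_commute: "irr_Hom I J = irr_Hom J I"
  unfolding irr_Hom_def by (subst sum.swap) (simp add: slope_minus_commute)

lemma edges_commute: "edges a q a' q' = edges a' q' a q"
  unfolding edges_def B_inf_circle irr_Hom_commute[of "circle a q"]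
  by (auto split: point.splits simp: mult.commute)

lemma legendre_cases:
  assumes "legendre a q b p"
  obtains (inf_inf) s where "a = Infinity" "b = Infinity" "dual (ram q) (- 1) s (- 1) q p"
  | (fin_inf) c p0 where "a = Finite c" "b = Infinity" "p = p0 + Poly_Mapping.single 1 (- c)" "paired 1 q p0"
      "slope p0 < 1"
  | (inf_fin) c q0 where "a = Infinity" "b = Finite c" "q = q0 + Poly_Mapping.single 1 c" "paired (- 1) q0 p"
      "slope q0 < 1"
proof -
  have "slope p0 < 1" if "paired 1 q p0" for q p0
    using paired_imp[OF that] ram_pos[of q] by (simp add: slope_less_one_iff)
  moreover have "slope q0 < 1" if "paired (- 1) q0 p" for q0 p
    using paired_imp[OF that] ram_pos[of p] by (simp add: slope_less_one_iff)
  ultimately show ?thesis using assms that unfolding legendre_iff by blast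
qed

lemma legendre_exp_factor:
  assumes "legendre a q b p"
  shows "exp_factor q" "exp_factor p"
  using assms
  by (cases rule: legendre_cases; auto dest: dual_imp paired_imp intro!: exp_factor_add exp_factor_single)+

lemma irr_Hom_steep:
  assumes "exp_factor q" "exp_factor q'" "slope q' < slope q"
  shows "irr_Hom (circle a q) (circle a' q') = of_nat (Irr q * ram q')"
proof -
  have "Irr q' * ram q < Irr q * ram q'" using slope_cross assms by simp
  then show ?thesis using irr_Hom_slope_neq[OF assms(1,2)] assms(3) by (simp add: max_def)
qed

text \<open>The slope of \<open>p\<close> exceeds 1 and dominates that of the other image, so the
  irregularity is \<open>Irr p * ram p0\<close>. With \<open>Irr p - ram p = ram q\<close> and
  \<open>ram p0 = Irr q' + ram q'\<close> this yields the product in the mixed formula.\<close>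

lemma legendre_pair_inf_fin:
  assumes "dual (ram q) (- 1) s (- 1) q p" "paired 1 q' p0" "slope p0 < 1"
  shows "galois_orbit p \<noteq> galois_orbit (p0 + Poly_Mapping.single 1 c)"
    and "edges Infinity p Infinity (p0 + Poly_Mapping.single 1 c) = edges Infinity q (Finite c') q'"
proof -
  note d = dual_imp[OF assms(1)] and P = paired_imp[OF assms(2)]
  let ?p' = "p0 + Poly_Mapping.single 1 c"
  have "exp_factor p0" using P by simp
  then have e: "exp_factor ?p'" by (intro exp_factor_add exp_factor_single) auto
  have sl: "slope ?p' < slope p"
    using slope_lin_le[OF \<open>exp_factor p0\<close> assms(3), of c] dual_inf_imp[OF assms(1)] by simp
  then show neq: "galois_orbit p \<noteq> galois_orbit ?p'" using galois_orbit_slope_neq by fastforce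
  have *: "int (Irr q) = int (ram p) + int (ram q)" using dual_inf_imp(1)[OF assms(1)] by simp
  have "int (Irr p * ram ?p') - int (ram p * ram ?p') = int (ram q * (Irr q' + ram q'))"
    unfolding of_nat_mult of_nat_add dual_Irr(1)[OF assms(1)] ram_lin * using P by (simp add: algebra_simps)
  then have "(of_int (int (Irr p * ram ?p') - int (ram p * ram ?p')) :: rat) = of_int (int (ram q * (Irr q' + ram q')))"
    by (simp only:)
  then show "edges Infinity p Infinity ?p' = edges Infinity q (Finite c') q'"
    using irr_Hom_steep[OF d(1) e sl] neq by (simp add: edges_def B_inf_circle)
qed

text \<open>The preceding computation with source and target exchanged:
  \<open>Irr q - ram q = ram p\<close> and \<open>ram q0 = Irr p' + ram p'\<close>.\<close>

lemma legendre_pair_inf_inf: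
  assumes "dual (ram q) (- 1) s (- 1) q p" "paired (- 1) q0 p'" "slope q0 < 1"
  shows "galois_orbit q \<noteq> galois_orbit (q0 + Poly_Mapping.single 1 c)"
    and "edges Infinity q Infinity (q0 + Poly_Mapping.single 1 c) = edges Infinity p (Finite c') p'"
proof -
  note d = dual_imp[OF assms(1)] and P = paired_imp[OF assms(2)]
  let ?q' = "q0 + Poly_Mapping.single 1 c"
  have "exp_factor q0" using P by simp
  then have e: "exp_factor ?q'" by (intro exp_factor_add exp_factor_single) auto
  have sl: "slope ?q' < slope q"
    using slope_lin_le[OF \<open>exp_factor q0\<close> assms(3), of c] dual_inf_imp[OF assms(1)] by simp
  then show neq: "galois_orbit q \<noteq> galois_orbit ?q'" using galois_orbit_slope_neq by fastforce
  have *: "int (Irr q) = int (ram p) + int (ram q)" "int (ram q0) = int (ram p') + int (Irr q0)"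
    using dual_inf_imp(1)[OF assms(1)] P by simp_all
  have "int (Irr q * ram ?q') - int (ram q * ram ?q') = int (ram p * (Irr p' + ram p'))"
    unfolding of_nat_mult of_nat_add ram_lin * using P(3) by (simp add: algebra_simps)
  then have "(of_int (int (Irr q * ram ?q') - int (ram q * ram ?q')) :: rat) = of_int (int (ram p * (Irr p' + ram p')))"
    by (simp only:)
  then show "edges Infinity q Infinity ?q' = edges Infinity p (Finite c') p'"
    using irr_Hom_steep[OF d(5) e sl] neq by (simp add: edges_def B_inf_circle)
qed

text \<open>Expand \<open>ram p * ram p'\<close> using
  \<open>ram p = ram q + \<epsilon> * Irr q\<close>. The product of the irregularities is
  compensated by the change of \<open>irr_Hom\<close>, and the mixed products are the correction
  terms at a finite point.\<close>

lemma paired_edges: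
  assumes "paired \<epsilon> q p" "paired \<epsilon> q' p'" "\<bar>\<epsilon>\<bar> = 1"
  defines "at_fin x x' \<equiv> irr_Hom (circle Infinity x) (circle Infinity x') - of_nat (ram x * ram x')
      - of_nat (Irr x * ram x') - of_nat (Irr x' * ram x)"
    and "at_inf x x' \<equiv> irr_Hom (circle Infinity x) (circle Infinity x') - (of_nat (ram x * ram x') :: rat)"
  shows "\<epsilon> = 1 \<Longrightarrow> at_fin q q' = at_inf p p'" "\<epsilon> = - 1 \<Longrightarrow> at_fin p p' = at_inf q q'"
proof -
  note P = paired_imp[OF assms(1,3)] and P' = paired_imp[OF assms(2,3)]
  have r: "(of_nat (ram p) :: rat) = of_nat (ram q) + of_int \<epsilon> * of_nat (Irr q)"
      "(of_nat (ram p') :: rat) = of_nat (ram q') + of_int \<epsilon> * of_nat (Irr q')"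
    using arg_cong[OF P(4), of "of_int :: int \<Rightarrow> rat"] arg_cong[OF P'(4), of "of_int :: int \<Rightarrow> rat"] by simp_all
  have A: "irr_Hom (circle Infinity p) (circle Infinity p') =
      irr_Hom (circle Infinity q) (circle Infinity q') + of_int \<epsilon> * of_nat (Irr q) * of_nat (Irr q')"
    using paired_pair(1)[OF assms(1-3)] by simp
  show "\<epsilon> = 1 \<Longrightarrow> at_fin q q' = at_inf p p'" "\<epsilon> = - 1 \<Longrightarrow> at_fin p p' = at_inf q q'"
    by (simp_all add: at_fin_def at_inf_def A r P P' algebra_simps)
qed

lemma irr_Hom_base: "irr_Hom (circle a q) (circle b q') = irr_Hom (circle Infinity q) (circle Infinity q')"
  by (simp add: irr_Hom_def circle_def)

text \<open>The first part serves twice: from left to right it makes the transform well defined on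
  circles, whatever representatives and series are chosen; from right to left it is injectivity,
  needed for the extra 1 of loops.\<close>

lemma legendre_invariant:
  assumes "legendre a q b p" "legendre a' q' b' p'"
  shows "circle a q = circle a' q' \<longleftrightarrow> circle b p = circle b' p'" (is ?E)
    and "edges a q a' q' = edges b p b' p'" (is ?B)
proof -
  have "?E \<and> ?B"
    using assms(1)
  proof (cases rule: legendre_cases)
    case 1: (inf_inf s)
    show ?thesis using assms(2)
    proof (cases rule: legendre_cases)
      case 2: (inf_inf s')
      show ?thesis
        using 1 2 dual_inf_pair(1)[OF 1(3) 2(3), of Infinity Infinity Infinity Infinity]
          dual_inf_pair(2)[OF 1(3) 2(3)]
        by (simp add: edges_def B_inf_circle)
    next
      case 2: (fin_inf c p0)
      show ?thesis using 1 2 legendre_pair_inf_fin(1)[OF 1(3) 2(4,5), of "- c"] legendre_pair_inf_fin(2)[OF 1(3) 2(4,5), of "- c" c] by simp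
    next
      case 2: (inf_fin c q0)
      show ?thesis using 1 2 legendre_pair_inf_inf(1)[OF 1(3) 2(4,5), of c] legendre_pair_inf_inf(2)[OF 1(3) 2(4,5), of c c] by simp
    qed
  next
    case 1: (fin_inf c p0)
    note P = paired_imp[OF 1(4)]
    show ?thesis using assms(2)
    proof (cases rule: legendre_cases)
      case 2: (inf_inf s')
      show ?thesis
        using 1 2 legendre_pair_inf_fin(1)[OF 2(3) 1(4,5), of "- c"] legendre_pair_inf_fin(2)[OF 2(3) 1(4,5), of "- c" c] edges_commute[of a q] edges_commute[of b p] by auto
    next
      case 2: (fin_inf c' p0')
      note P' = paired_imp[OF 2(4)]
      show ?thesis
      proof (cases "c = c'")
        case True
        show ?thesis
          using 1 2 True paired_pair(2)[OF 1(4) 2(4)] paired_edges(1)[OF 1(4) 2(4)]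
          by (simp add: edges_def B_inf_circle irr_Hom_lin galois_orbit_lin ram_lin irr_Hom_base[of "Finite c'"])
      next
        case False
        show ?thesis
          using 1 2 False lin_neq(1)[of p0 p0' "- c" "- c'"] lin_neq(2)[of p0 p0' "- c" "- c'" Infinity Infinity] P P'
          by (simp add: edges_def B_inf_circle ram_lin)
      qed
    next
      case 2: (inf_fin c' q0')
      note P' = paired_imp[OF 2(4)]
      \<comment> \<open>One circle leaves a finite point while the other arrives at one. On both
        sides the mixed formula is the product of the ramifications that the two circles have while
        at infinity.\<close>
      have "ram p0 = Irr q + ram q" "ram q0' = Irr p' + ram p'" using P P' by simp_all
      then have "ram q' * (Irr q + ram q) = ram p * (Irr p' + ram p')"
        by (simp add: 1(3) 2(3) ram_lin mult.commute)
      with 1(1,2) 2(1,2) show ?thesis by (simp add: edges_def del: of_nat_mult of_nat_add)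
    qed
  next
    case 1: (inf_fin c q0)
    note P = paired_imp[OF 1(4)]
    show ?thesis using assms(2)
    proof (cases rule: legendre_cases)
      case 2: (inf_inf s')
      show ?thesis
        using 1 2 legendre_pair_inf_inf(1)[OF 2(3) 1(4,5), of c] legendre_pair_inf_inf(2)[OF 2(3) 1(4,5), of c c] edges_commute[of a q] edges_commute[of b p] by auto
    next
      case 2: (fin_inf c' p0')
      note P' = paired_imp[OF 2(4)]
      have "ram p0' = Irr q' + ram q'" "ram q0 = Irr p + ram p" using P P' by simp_all
      then have "ram q * (Irr q' + ram q') = ram p' * (Irr p + ram p)"
        by (simp add: 1(3) 2(3) ram_lin mult.commute)
      with 1(1,2) 2(1,2) show ?thesis by (simp add: edges_def del: of_nat_mult of_nat_add)
    next
      case 2: (inf_fin c' q0')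
      note P' = paired_imp[OF 2(4)]
      show ?thesis
      proof (cases "c = c'")
        case True
        show ?thesis
          using 1 2 True paired_pair(2)[OF 1(4) 2(4)] paired_edges(2)[OF 1(4) 2(4)]
          by (simp add: edges_def B_inf_circle irr_Hom_lin galois_orbit_lin ram_lin irr_Hom_base[of "Finite c'"])
      next
        case False
        show ?thesis
          using 1 2 False lin_neq(1)[of q0 q0' c c'] lin_neq(2)[of q0 q0' c c' Infinity Infinity] P P'
          by (simp add: edges_def B_inf_circle ram_lin)
      qed
    qed
  qed
  then show ?E ?B by auto
qed

text \<open>Totality on exponential factors, so that the choice made in \<open>fourier\<close> is
  never empty for such circles.\<close>

lemma ex_legendre:
  assumes "exp_factor q"
  shows "\<exists>b p. legendre a q b p"
proof -
  have paired: "\<exists>p. paired \<epsilon> q p" if "exp_factor q" "\<epsilon> = 1 \<or> \<epsilon> = - 1 \<and> slope q < 1" for \<epsilon> q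
  proof (cases "q = 0")
    case False
    define s where "s = nat (int (ram q) + \<epsilon> * int (Irr q))"
    have s: "int s = int (ram q) + \<epsilon> * int (Irr q)" "s > 0"
      using that ram_pos[of q] by (auto simp: s_def slope_less_one_iff)
    then have "\<exists>p. dual (ram q) \<epsilon> s (- \<epsilon>) q p"
      using that False ram_pos[of q] covers_ram[of q] by (intro ex_dual) (auto simp: expo_ram_slope)
    then show ?thesis unfolding paired_def by blast
  qed (auto simp: paired_def)
  show ?thesis
  proof (cases a)
    case (Finite c)
    then show ?thesis using paired[OF assms, of 1] unfolding legendre_iff by blast
  next
    case Infinity
    show ?thesis
    proof (cases "slope q > 1")
      case True
      then have "q \<noteq> 0" by auto
      moreover have "ram q < Irr q" using True assms by (simp add: slope_gt_one_iff)
      ultimately have "\<exists>p. dual (ram q) (- 1) (Irr q - ram q) (- 1) q p"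
        using assms ram_pos[of q] covers_ram[of q] by (intro ex_dual) (auto simp: expo_ram_slope)
      then show ?thesis using Infinity unfolding legendre_iff by blast
    next
      case False
      \<comment> \<open>At slope at most one, only the linear term can have exponent at least 1. Its
        coefficient, possibly 0, is the target point.\<close>
      define q0 where "q0 = q - Poly_Mapping.single 1 (coef q 1)"
      have q: "q = q0 + Poly_Mapping.single 1 (coef q 1)" by (simp add: q0_def)
      have e: "exp_factor q0" using assms by (auto simp: q0_def intro!: exp_factor_diff exp_factor_single)
      have "coef q0 j = 0" if "1 \<le> j" for j
        using that False by (cases "j = 1") (auto simp: q0_def lookup_minus lookup_single coef_above_slope)
      then have "slope q0 < 1"
        using slope_mem[of q0] by (cases "q0 = 0") (auto simp: not_le[symmetric])
      then obtain p where "paired (- 1) q0 p" using paired[OF e, of "- 1"] by blast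
      with q Infinity show ?thesis unfolding legendre_iff by blast
    qed
  qed
qed

lemma fourier_circle:
  assumes "legendre a q b p"
  shows "fourier (circle a q) = circle b p"
  unfolding fourier_def
proof (rule some_equality)
  show "\<exists>a' q' b' p'. circle a q = circle a' q' \<and> legendre a' q' b' p' \<and> circle b p = circle b' p'"
    using assms by blast
  fix J assume "\<exists>a' q' b' p'. circle a q = circle a' q' \<and> legendre a' q' b' p' \<and> J = circle b' p'"
  then show "J = circle b p" using legendre_invariant(1)[OF assms] by metis
qed

section \<open>Twists and scalings\<close>

lemma twist_circle:
  "twist \<mu> (circle Infinity q) = circle Infinity (q + Poly_Mapping.single 2 (- (\<mu> / 2)))"
  "twist \<mu> (circle (Finite c) q) = circle (Finite c) q"
  using galois_orbit_shift[of q 2 "- (\<mu> / 2)"]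
  by (simp_all add: twist_def circle_def single_uminus)

text \<open>The added term has integral exponent, so it commutes with conjugation and cancels in
  differences. The mixed formula involves only the ramification of the circle at infinity, and not
  its slope, which a twist may change.\<close>

lemma edges_twist:
  fixes c :: complex
  defines "tw a q \<equiv> (if a = Infinity then q + Poly_Mapping.single 2 c else q)"
  shows "edges a (tw a q) a' (tw a' q') = edges a q a' q'"
  using ram_shift[of q 2 c] ram_shift[of q' 2 c] galois_orbit_shift_eq_iff[of q 2 c q']
    irr_Hom_shift[of Infinity q 2 c Infinity q' Infinity Infinity]
  by (simp add: tw_def edges_def B_inf_circle split: point.splits)

lemma galois_orbit_rescale:
  assumes "\<And>k. g k \<noteq> 0"
  shows "galois_orbit (rescale g q) = rescale g ` galois_orbit q"
proof -
  have "act R \<omega> (rescale g q) = rescale g (act R \<omega> q)" for R \<omega>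
    by (rule poly_mapping_eqI) (simp add: coef_act)
  moreover have "ram (rescale g q) = ram q" using assms by (intro keys_eq_imp_ram_eq keys_rescale)
  ultimately show ?thesis by (simp add: galois_orbit_alt image_image)
qed

lemma inj_rescale: "(\<And>k. g k \<noteq> 0) \<Longrightarrow> inj (rescale g)"
  by (rule injI, rule poly_mapping_eqI) (metis lookup_rescale mult_cancel_left)

lemma rescale_invariant:
  assumes "\<And>k. g k \<noteq> 0"
  shows "ram (rescale g q) = ram q" "Irr (rescale g q) = Irr q"
    and "galois_orbit (rescale g q) = galois_orbit (rescale g q') \<longleftrightarrow> galois_orbit q = galois_orbit q'"
    and "irr_Hom (circle a (rescale g q)) (circle b (rescale g q')) = irr_Hom (circle a' q) (circle b' q')"
proof -
  have k: "Poly_Mapping.keys (rescale g q) = Poly_Mapping.keys q" for q using assms by (rule keys_rescale)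
  show "ram (rescale g q) = ram q" "Irr (rescale g q) = Irr q"
    using keys_eq_imp_ram_eq[OF k] keys_eq_imp_slope_eq[OF k] by (simp_all add: Irr_def)
  show "galois_orbit (rescale g q) = galois_orbit (rescale g q') \<longleftrightarrow> galois_orbit q = galois_orbit q'"
    unfolding galois_orbit_rescale[OF assms] by (rule inj_image_eq_iff[OF inj_rescale[OF assms]])
  have "rescale g x - rescale g y = rescale g (x - y)" for x y
    by (rule poly_mapping_eqI) (simp add: lookup_minus algebra_simps)
  then have "slope (rescale g x - rescale g y) = slope (x - y)" for x y
    using keys_eq_imp_slope_eq[OF k] by simp
  then show "irr_Hom (circle a (rescale g q)) (circle b (rescale g q')) = irr_Hom (circle a' q) (circle b' q')"
    unfolding irr_Hom_def circle_def
    by (simp add: galois_orbit_rescale[OF assms] sum.reindex inj_on_subset[OF inj_rescale[OF assms]])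
qed

definition scale_point :: "complex \<Rightarrow> point \<Rightarrow> point" where
  "scale_point \<mu> a = (case a of Infinity \<Rightarrow> Infinity | Finite c \<Rightarrow> Finite (\<mu> * c))"

definition scale_ef :: "complex \<Rightarrow> point \<Rightarrow> ef \<Rightarrow> ef" where
  "scale_ef \<mu> a = rescale (\<lambda>k. \<mu> powr (case a of Infinity \<Rightarrow> - of_rat k | Finite _ \<Rightarrow> of_rat k))"

lemma scaling_circle:
  assumes "\<mu> \<noteq> 0"
  shows "scaling \<mu> (circle a q) = circle (scale_point \<mu> a) (scale_ef \<mu> a q)"
  using assms
  by (cases a) (simp_all add: scaling_def circle_def scale_point_def scale_ef_def galois_orbit_rescale)

lemma edges_scaling:
  assumes "\<mu> \<noteq> 0"
  shows "edges (scale_point \<mu> a) (scale_ef \<mu> a q) (scale_point \<mu> a') (scale_ef \<mu> a' q') = edges a q a' q'"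
proof -
  define g h where "g = (\<lambda>k. \<mu> powr (- of_rat k))" and "h = (\<lambda>k. \<mu> powr (of_rat k))"
  have g: "g k \<noteq> 0" and h: "h k \<noteq> 0" for k using assms by (simp_all add: g_def h_def)
  have "scale_ef \<mu> Infinity = rescale g" "scale_ef \<mu> (Finite c) = rescale h" for c
    by (simp_all add: scale_ef_def g_def h_def)
  then show ?thesis
    using assms rescale_invariant(1,2)[of g, OF g] rescale_invariant(1,2)[of h, OF h]
      rescale_invariant(3)[of g q q', OF g] rescale_invariant(3)[of h q q', OF h]
      rescale_invariant(4)[of g _ q _ q' a a', OF g] rescale_invariant(4)[of h _ q _ q' a a', OF h]
    by (cases a; cases a') (simp_all add: edges_def B_inf_circle scale_point_def)
qed

text \<open>Induction along an arbitrary factorization, carrying both circles at once.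
  Representatives are renewed at each step, and \<open>exp_factor\<close> is kept so that the next
  transform exists.\<close>

lemma sl2_action_edges:
  assumes "sl2_action A \<phi>" "exp_factor q" "exp_factor q'"
  shows "\<exists>b p b' p'. \<phi> (circle a q) = circle b p \<and> \<phi> (circle a' q') = circle b' p' \<and>
           exp_factor p \<and> exp_factor p' \<and> edges b p b' p' = edges a q a' q'"
  using assms(1)
proof induction
  case 1
  then show ?case using assms by blast
next
  case (2 A \<phi> \<mu>)
  then obtain b p b' p' where *: "\<phi> (circle a q) = circle b p" "\<phi> (circle a' q') = circle b' p'"
      "exp_factor p" "exp_factor p'" "edges b p b' p' = edges a q a' q'" by blast
  define tw :: "point \<Rightarrow> ef \<Rightarrow> ef" where "tw a q = (if a = Infinity then q + Poly_Mapping.single 2 (- (\<mu> / 2)) else q)" for a q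
  have "twist \<mu> (circle a q) = circle a (tw a q)" for a q
    by (cases a) (simp_all add: tw_def twist_circle)
  moreover have "exp_factor (tw a q)" if "exp_factor q" for a q
    using that by (auto simp: tw_def intro!: exp_factor_add exp_factor_single)
  moreover have "edges b (tw b p) b' (tw b' p') = edges a q a' q'"
    using edges_twist[of b p "- (\<mu> / 2)" b' p'] * by (simp add: tw_def)
  ultimately show ?case using * by (metis comp_apply)
next
  case (3 A \<phi> \<mu>)
  then obtain b p b' p' where *: "\<phi> (circle a q) = circle b p" "\<phi> (circle a' q') = circle b' p'"
      "exp_factor p" "exp_factor p'" "edges b p b' p' = edges a q a' q'" by blast
  have "exp_factor (scale_ef \<mu> b p)" "exp_factor (scale_ef \<mu> b' p')"
    using * by (simp_all add: scale_ef_def exp_factor_rescale)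
  with * show ?case using scaling_circle[OF 3(2)] edges_scaling[OF 3(2), of b p b' p'] by (metis comp_apply)
next
  case (4 A \<phi>)
  then obtain b p b' p' where *: "\<phi> (circle a q) = circle b p" "\<phi> (circle a' q') = circle b' p'"
      "exp_factor p" "exp_factor p'" "edges b p b' p' = edges a q a' q'" by blast
  obtain d r where 1: "legendre b p d r" using ex_legendre[OF *(3)] by blast
  obtain d' r' where 2: "legendre b' p' d' r'" using ex_legendre[OF *(4)] by blast
  show ?case
    using * fourier_circle[OF 1] fourier_circle[OF 2] legendre_exp_factor[OF 1] legendre_exp_factor[OF 2]
      legendre_invariant(2)[OF 1 2] by (metis comp_apply)
qed

theorem theorem5p3:
  fixes S :: "complex set" and M :: "complex \<Rightarrow> complex^'n^'n"
    and a a' :: point and q q' :: ef and I I' :: circ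
    and \<alpha> \<beta> \<alpha>' \<beta>' :: nat and B :: "circ \<Rightarrow> circ \<Rightarrow> rat"
  assumes "irreducible_connection S M"
    and "\<not> rank_one_only_infinity_order_less_two M"
    and "exp_factor q" and "I = circle a q" and "I \<in> active_circles M"
    and "exp_factor q'" and "I' = circle a' q'" and "I' \<in> active_circles M"
    and "\<beta> = ram q" and "\<alpha> = Irr q" and "\<beta>' = ram q'" and "\<alpha>' = Irr q'"
    and "core_diagram M B"
  shows "(a = Infinity \<and> a' = Infinity \<longrightarrow> B I I' = B_inf I I') \<and>
         (a = Infinity \<and> a' \<noteq> Infinity \<longrightarrow> B I I' = of_nat (\<beta> * (\<alpha>' + \<beta>'))) \<and>
         (a \<noteq> Infinity \<and> a' \<noteq> Infinity \<and> a \<noteq> a' \<longrightarrow> B I I' = 0) \<and>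
         (a = a' \<and> a \<noteq> Infinity \<longrightarrow> 
            B I I' = B_inf I I' - of_nat (\<alpha> * \<beta>') - of_nat (\<alpha>' * \<beta>))"
proof -
  obtain A \<phi> where "sl2_action A \<phi>" and inf: "base_point (\<phi> I) = Infinity" "base_point (\<phi> I') = Infinity"
    and B: "B I I' = B_inf (\<phi> I) (\<phi> I')"
    using assms(5,8,13) unfolding core_diagram_def by blast
  then obtain b p b' p' where \<phi>: "\<phi> I = circle b p" "\<phi> I' = circle b' p'" "edges b p b' p' = edges a q a' q'"
    using sl2_action_edges[of A \<phi> q q' a a'] assms(3,4,6,7) by blast
  have "b = Infinity" "b' = Infinity" using inf by (simp_all add: \<phi> circle_def)
  then have "B I I' = edges b p b' p'" using B by (simp add: \<phi> edges_def)
  with \<phi>(3) have "B I I' = edges a q a' q'" by simp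
  then show ?thesis using assms(4,7,9-12) by (auto simp: edges_def split: point.splits)
qed

end
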